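(* Let $0<p<1$ and $\omega\in\widehat{\mathcal{D}}$. Then the following statements are equivalent: (i) $T_c(D^p_\omega,H^\infty)$ consists of constant functions only; (ii) $\displaystyle\limsup_{r\to1^-}\frac{(1-r)^{2-\frac1p}}{\widehat{\omega}(r)^{\frac1p}}>0$; (iii) $\displaystyle\limsup_{r\to1^-}\left((1-r)\sum_{k=1}^{\infty}\frac{r^{2k}}{\widehat{\omega}(1-\frac1k)^{\frac1p}k^{2-\frac1p}}\right)>0$; (iv) the identity map $I:D^p_\omega\to D^1_0$ is not compact.
   Context: $\mathbb{D}$ is the open unit disc, $\mathcal{H}(\mathbb{D})$ the analytic functions on it, $dA(z)=\frac{dx\,dy}{\pi}$. A radial weight is a non-negative $\omega\in L^1([0,1))$ extended by $\omega(z)=\omega(|z|)$; always assume $\widehat\omega(r)=\int_r^1\omega(s)\,ds>0$ for all $0\le r<1$. $\omega\in\widehat{\mathcal{D}}$ means there is $C\ge1$ with $\widehat\omega(r)\le C\widehat\omega(\frac{1+r}{2})$ for all $0\le r<1$. $D^p_\omega$ consists of $f\in\mathcal H(\mathbb D)$ with $\|f\|_{D^p_\omega}^p=\int_{\mathbb D}|f'|^p\omega\,dA+|f(0)|^p<\infty$; $D^1_0$ is the case $p=1$, $\omega\equiv1$, i.e. $\|f\|_{D^1_0}=\int_{\mathbb D}|f'|\,dA+|f(0)|$. For $g\in\mathcal H(\mathbb D)$, $T_g(f)(z)=\int_0^z f(\zeta)g'(\zeta)\,d\zeta$. $T_c(X,H^\infty)$ is the set of $g\in\mathcal H(\mathbb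 D)$ such that $T_g:X\to H^\infty$ is compact. *)

theory Defs
  imports "HOL-Complex_Analysis.Complex_Analysis"
begin

definition omega_hat :: "(real \<Rightarrow> real) \<Rightarrow> real \<Rightarrow> real" where
  "omega_hat \<omega> r = (LINT s:{r..<1}|lborel. \<omega> s)"

definition radial_weight :: "(real \<Rightarrow> real) \<Rightarrow> bool" where
  "radial_weight \<omega> \<longleftrightarrow>
     (\<forall>s\<in>{0..<1}. 0 \<le> \<omega> s) \<and> set_integrable lborel {0..<1} \<omega> \<and>
     (\<forall>r\<in>{0..<1}. omega_hat \<omega> r > 0)"

definition Dhat :: "(real \<Rightarrow> real) set" where
  "Dhat = {\<omega>. radial_weight \<omega> \<and>
     (\<exists>C\<ge>1. \<forall>r\<in>{0..<1}. omega_hat \<omega> r \<le> C * omega_hat \<omega> ((1 + r) / 2))}"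

text \<open>The p-th power of the D^p_omega (quasi-)norm, with dA = dx dy / pi.\<close>
definition Dnorm_pow :: "real \<Rightarrow> (real \<Rightarrow> real) \<Rightarrow> (complex \<Rightarrow> complex) \<Rightarrow> ennreal" where
  "Dnorm_pow p \<omega> f =
     (\<integral>\<^sup>+ z. indicator (ball 0 1) z * ennreal (norm (deriv f z) powr p * \<omega> (norm z)) \<partial>lborel) / ennreal pi
     + ennreal (norm (f 0) powr p)"

definition Dspace :: "real \<Rightarrow> (real \<Rightarrow> real) \<Rightarrow> (complex \<Rightarrow> complex) set" where
  "Dspace p \<omega> = {f. f holomorphic_on ball 0 1 \<and> Dnorm_pow p \<omega> f < \<infinity>}"

abbreviation D10 :: "(complex \<Rightarrow> complex) set" where
  "D10 \<equiv> Dspace 1 (\<lambda>_. 1)"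

definition Tg :: "(complex \<Rightarrow> complex) \<Rightarrow> (complex \<Rightarrow> complex) \<Rightarrow> complex \<Rightarrow> complex" where
  "Tg g f z = contour_integral (linepath 0 z) (\<lambda>\<zeta>. f \<zeta> * deriv g \<zeta>)"

definition Tg_compact_Hinf :: "real \<Rightarrow> (real \<Rightarrow> real) \<Rightarrow> (complex \<Rightarrow> complex) \<Rightarrow> bool" where
  "Tg_compact_Hinf p \<omega> g \<longleftrightarrow>
     (\<forall>f\<in>Dspace p \<omega>. bounded (Tg g f ` ball 0 1)) \<and>
     (\<forall>(F::nat\<Rightarrow>complex\<Rightarrow>complex) (M::real). (\<forall>n. F n \<in> Dspace p \<omega> \<and> Dnorm_pow p \<omega> (F n) \<le> ennreal M) \<longrightarrow>
        (\<exists>(r::nat\<Rightarrow>nat) (h::complex\<Rightarrow>complex). strict_mono r \<and>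
           uniform_limit (ball 0 1) (\<lambda>n. Tg g (F (r n))) h sequentially))"

definition Tc_Hinf :: "real \<Rightarrow> (real \<Rightarrow> real) \<Rightarrow> (complex \<Rightarrow> complex) set" where
  "Tc_Hinf p \<omega> = {g. g holomorphic_on ball 0 1 \<and> Tg_compact_Hinf p \<omega> g}"

definition identity_compact_D10 :: "real \<Rightarrow> (real \<Rightarrow> real) \<Rightarrow> bool" where
  "identity_compact_D10 p \<omega> \<longleftrightarrow>
     Dspace p \<omega> \<subseteq> D10 \<and>
     (\<forall>(F::nat\<Rightarrow>complex\<Rightarrow>complex) (M::real). (\<forall>n. F n \<in> Dspace p \<omega> \<and> Dnorm_pow p \<omega> (F n) \<le> ennreal M) \<longrightarrow>
        (\<exists>(r::nat\<Rightarrow>nat) (h::complex\<Rightarrow>complex). strict_mono r \<and> h \<in> D10 \<and>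
           (\<lambda>n. Dnorm_pow 1 (\<lambda>_. 1) (\<lambda>z. F (r n) z - h z)) \<longlonglongrightarrow> 0))"

end

theory Submission
  imports Defs
begin

text \<open>
  Write \<open>W\<close> for \<open>omega_hat \<omega>\<close> and \<open>\<phi> r = (1 - r) powr (2 - 1/p) / W r powr (1/p)\<close>. Condition (iii) is about Abel
  means of the values \<open>\<phi> (1 - 1/k)\<close>; since \<open>W\<close> is decreasing, a large value of \<open>\<phi>\<close> at \<open>t\<close> persists
  on the dyadic block \<open>(1 - t)/4 \<le> 1 - s \<le> 1 - t\<close>, so these means tend to 0 exactly when \<open>\<phi>\<close> does.

  If \<open>\<phi>\<close> does not tend to 0, test functions \<open>f\<^sub>a z = A ((1 - r)/(1 - cnj a z))^n\<close> with \<open>r = |a|\<close> and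
  \<open>A = \<phi> r / (1 - r)\<close> are bounded in the space (this is where the doubling condition is used) and tend to 0
  locally uniformly, so a compact \<open>T_g\<close> sends them to 0 uniformly. Cauchy's estimate for
  \<open>(T_g f\<^sub>a)' = f\<^sub>a g'\<close> at \<open>a\<close> gives \<open>\<phi>(r) |g'(a)| \<rightarrow> 0\<close>, and \<open>g' = 0\<close> by the maximum principle.

  If the identity is compact, then so is \<open>T_g\<close> for \<open>g z = z\<close>: the operator \<open>T_z\<close> is bounded from
  \<open>D10\<close> to the bounded functions, because \<open>(1 - x) |f'(xu)|\<close> is at most a constant times the circle mean of
  \<open>|f'|\<close> on the radius \<open>(1 + x)/2\<close>.

  If \<open>\<phi>\<close> tends to 0, then \<open>p > 1/2\<close>. With \<open>M r\<close> the integral of \<open>|f'|^p\<close> over the circle of radius \<open>r\<close>,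
  subharmonicity of \<open>|f'|^p\<close> bounds the mean of \<open>|f'|\<close> on the radius \<open>r\<close> by \<open>o(1) (1 - \<rho>) powr (2p - 2) M \<rho>\<close>
  with \<open>\<rho> = (1 + r)/2\<close>. The tails of \<open>(1 - \<rho>) powr (2p - 2)\<close> are at most \<open>o(1) W\<close> and \<open>M\<close> is increasing, so
  the part of the \<open>D10\<close> norm near the boundary is uniformly small on bounded sets, and Montel's theorem
  gives compactness of the identity.
\<close>

section \<open>Polar coordinates\<close>

text \<open>The quotient \<open>\<phi>\<close> is what remains when two normalisations meet. A bump
  of height \<open>A\<close> at distance \<open>1 - r\<close> from the boundary, living at scale
  \<open>1 - r\<close>, has derivative of size \<open>A / (1 - r)\<close>, and the weighted integral
  of its p-th power has size \<open>(A / (1 - r)) powr p * (1 - r) * W r\<close>. Making this 1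
  forces \<open>A = \<phi> r / (1 - r)\<close>, and Cauchy's estimate at that scale removes exactly
  the factor \<open>1 / (1 - r)\<close>. In the other direction the obstacle is
  \<open>p < 1\<close>: a p-th power mean does not dominate a first power mean. So
  \<open>|f'|\<close> is split as \<open>(|f'| powr p) powr (1/p - 1)\<close> times
  \<open>|f'| powr p\<close>, only the first factor being estimated pointwise. This costs
  \<open>\<phi> powr (1 - p)\<close>, the comparison of tails costs \<open>\<phi> powr p\<close>,
  and together they give \<open>\<phi>\<close> itself. Logically the proof is the cycle (ii), (i),
  (iv), (ii), with (iii) attached to (ii).\<close>

lemma lborel_complex_eq_distr:
  "(lborel :: complex measure) = distr (lborel \<Otimes>\<^sub>M lborel) borel (\<lambda>(x, y). Complex x y)"
proof (rule lborel_eqI)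
  have [measurable]: "(\<lambda>(x, y). Complex x y) \<in> borel_measurable (borel \<Otimes>\<^sub>M borel)"
    unfolding Complex_eq case_prod_beta borel_prod
    by (intro borel_measurable_continuous_onI continuous_intros)
  have [measurable]: "(\<lambda>(x, y). Complex x y) \<in> borel_measurable (lborel \<Otimes>\<^sub>M lborel)"
    by measurable
  fix l u :: complex
  assume le: "\<And>b. b \<in> Basis \<Longrightarrow> l \<bullet> b \<le> u \<bullet> b"
  have le': "Re l \<le> Re u" "Im l \<le> Im u"
    using le[of 1] le[of \<i>] by (auto simp: Basis_complex_def inner_complex_def)
  have "(\<lambda>(x, y). Complex x y) -` box l u = {Re l <..< Re u} \<times> {Im l <..< Im u}"
    by (auto simp: box_def Basis_complex_def inner_complex_def)
  then show "emeasure (distr (lborel \<Otimes>\<^sub>M lborel) borel (\<lambda>(x, y). Complex x y)) (box l u)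
      = (\<Prod>b\<in>Basis. (u - l) \<bullet> b)"
    using le' by (subst emeasure_distr)
      (auto simp: lborel.emeasure_pair_measure_Times space_pair_measure
         Basis_complex_def inner_complex_def ennreal_mult)
qed simp

lemma nn_integral_complex_eq_iterated:
  fixes F :: "complex \<Rightarrow> ennreal"
  assumes [measurable]: "F \<in> borel_measurable borel"
  shows "(\<integral>\<^sup>+z. F z \<partial>lborel) = (\<integral>\<^sup>+y. \<integral>\<^sup>+x. F (Complex x y) \<partial>lborel \<partial>lborel)"
proof -
  have [measurable]: "(\<lambda>(x, y). Complex x y) \<in> borel_measurable (borel \<Otimes>\<^sub>M borel)"
    unfolding Complex_eq case_prod_beta borel_prod
    by (intro borel_measurable_continuous_onI continuous_intros)
  have [measurable]: "(\<lambda>(x, y). Complex x y) \<in> borel_measurable (lborel \<Otimes>\<^sub>M lborel)"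
    by measurable
  have "(\<integral>\<^sup>+z. F z \<partial>lborel) = (\<integral>\<^sup>+z. F (case z of (x, y) \<Rightarrow> Complex x y) \<partial>(lborel \<Otimes>\<^sub>M lborel))"
    by (subst lborel_complex_eq_distr, subst nn_integral_distr) auto
  also have "\<dots> = (\<integral>\<^sup>+y. \<integral>\<^sup>+x. F (Complex x y) \<partial>lborel \<partial>lborel)"
    by (subst lborel_pair.nn_integral_snd[symmetric]) auto
  finally show ?thesis .
qed

text \<open>\<open>tan\<close> is unbounded at the ends of the interval, so the substitution is made
  on the compact intervals \<open>[-a n, a n]\<close>, which \<open>tan\<close> maps onto
  \<open>[-(n + 1), n + 1]\<close>. Both sides then increase to the full integrals by monotone
  convergence.\<close>

lemma nn_integral_tan_substitution:
  fixes f :: "real \<Rightarrow> ennreal"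
  assumes [measurable]: "f \<in> borel_measurable borel"
  shows "(\<integral>\<^sup>+x. f x \<partial>lborel) =
    (\<integral>\<^sup>+t. f (tan t) * ennreal (inverse ((cos t)\<^sup>2)) * indicator {-(pi/2)<..<pi/2} t \<partial>lborel)"
proof -
  \<comment> \<open>\<open>Suc n\<close> instead of \<open>n\<close> makes every interval
    \<open>[-a n, a n]\<close> nondegenerate.\<close>
  define a where "a n = arctan (real (Suc n))" for n
  have a0: "0 < a n" "a n < pi/2" for n using arctan_bounded[of "real (Suc n)"] by (auto simp: a_def)
  have a_mono: "a m \<le> a n" if "m \<le> n" for m n
    unfolding a_def using that by (simp add: arctan_monotone')
  have tan_a: "tan (a n) = real (Suc n)" for n by (simp add: a_def tan_arctan)
  have cosn0: "cos x \<noteq> 0" if "x \<in> {-a n..a n}" for n x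
    using cos_gt_zero_pi[of x] a0(2)[of n] that by force
  have [measurable]: "(tan :: real \<Rightarrow> real) \<in> borel_measurable borel"
    unfolding tan_def by measurable
  have eq: "(\<integral>\<^sup>+x. f x * indicator {-real (Suc n)..real (Suc n)} x \<partial>lborel) =
     (\<integral>\<^sup>+t. f (tan t) * ennreal (inverse ((cos t)\<^sup>2)) * indicator {-a n..a n} t \<partial>lborel)" for n
  proof -
    have "(\<integral>\<^sup>+x. f x * indicator {tan (-a n)..tan (a n)} x \<partial>lborel) =
     (\<integral>\<^sup>+t. f (tan t) * ennreal (inverse ((cos t)\<^sup>2)) * indicator {-a n..a n} t \<partial>lborel)"
    proof (rule nn_integral_substitution_aux)
      show "(tan has_real_derivative inverse ((cos x)\<^sup>2)) (at x)" if "x \<in> {-a n..a n}" for x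
        using cosn0[OF that] by (rule DERIV_tan)
      show "continuous_on {-a n..a n} (\<lambda>x. inverse ((cos x)\<^sup>2))"
        using cosn0 by (intro continuous_intros) auto
      show "-a n < a n" using a0[of n] by linarith
    qed auto
    then show ?thesis by (simp add: tan_a)
  qed
  have s1: "(SUP n. f x * indicator {-real (Suc n)..real (Suc n)} x) = f x" for x
  proof (rule antisym)
    obtain n where "\<bar>x\<bar> \<le> real n" using real_arch_simple by blast
    then have "f x * indicator {-real (Suc n)..real (Suc n)} x = f x" by (auto simp: indicator_def)
    then show "f x \<le> (SUP n. f x * indicator {-real (Suc n)..real (Suc n)} x)"
      by (intro SUP_upper2[of n]) simp_all
  qed (auto intro!: SUP_least simp: indicator_def)
  have s2: "(SUP n. g t * indicator {-a n..a n} t) = g t * indicator {-(pi/2)<..<pi/2} t"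
    for g :: "real \<Rightarrow> ennreal" and t
  proof (rule antisym)
    have "{-a n..a n} \<subseteq> {-(pi/2)<..<pi/2}" for n using a0[of n] by auto
    then have "indicator {-a n..a n} t \<le> (indicator {-(pi/2)<..<pi/2} t :: ennreal)" for n
      by (intro indicator_leI) blast
    then show "(SUP n. g t * indicator {-a n..a n} t) \<le> g t * indicator {-(pi/2)<..<pi/2} t"
      by (intro SUP_least mult_left_mono) auto
    show "g t * indicator {-(pi/2)<..<pi/2} t \<le> (SUP n. g t * indicator {-a n..a n} t)"
    proof (cases "t \<in> {-(pi/2)<..<pi/2}")
      case True
      obtain n where n: "\<bar>tan t\<bar> \<le> real n" using real_arch_simple by blast
      have t: "arctan (tan t) = t" using True by (intro arctan_tan) auto
      have "t \<le> a n" unfolding a_def using n by (subst t[symmetric]) (simp add: arctan_monotone')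
      moreover have "- a n \<le> t"
        unfolding a_def using n by (subst t[symmetric], subst arctan_minus[symmetric]) (simp add: arctan_monotone')
      ultimately have "g t * indicator {-(pi/2)<..<pi/2} t = g t * indicator {-a n..a n} t"
        using True by simp
      then show ?thesis by (intro SUP_upper2[of n]) simp_all
    qed auto
  qed
  have "(\<integral>\<^sup>+x. f x \<partial>lborel) = (\<integral>\<^sup>+x. (SUP n. f x * indicator {-real (Suc n)..real (Suc n)} x) \<partial>lborel)"
    by (simp only: s1)
  also have "\<dots> = (SUP n. \<integral>\<^sup>+x. f x * indicator {-real (Suc n)..real (Suc n)} x \<partial>lborel)"
    by (intro nn_integral_monotone_convergence_SUP) (auto simp: incseq_def le_fun_def indicator_def)
  also have "\<dots> = (\<integral>\<^sup>+t. (SUP n. f (tan t) * ennreal (inverse ((cos t)\<^sup>2)) * indicator {-a n..a n} t) \<partial>lborel)"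
    unfolding eq
    by (intro nn_integral_monotone_convergence_SUP[symmetric])
      (auto simp: incseq_def le_fun_def indicator_def dest!: a_mono)
  also have "\<dots> = (\<integral>\<^sup>+t. f (tan t) * ennreal (inverse ((cos t)\<^sup>2)) * indicator {-(pi/2)<..<pi/2} t \<partial>lborel)"
    by (intro nn_integral_cong s2)
  finally show ?thesis .
qed

lemma borel_measurable_Complex [measurable (raw)]:
  assumes [measurable]: "f \<in> borel_measurable M" "g \<in> borel_measurable M"
  shows "(\<lambda>x. Complex (f x) (g x)) \<in> borel_measurable M"
  unfolding Complex_eq by measurable

lemma borel_measurable_cis [measurable]: "cis \<in> borel_measurable borel"
  unfolding cis_conv_exp by (intro borel_measurable_continuous_onI continuous_intros)

text \<open>Substitute \<open>x = y tan s\<close> for fixed \<open>y\<close>, exchange the integrals, then \<open>y = r cos s\<close> for fixed \<open>s\<close>; the angle is \<open>pi/2 - s\<close>.\<close>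

lemma nn_integral_upper_half_plane_polar:
  fixes F :: "complex \<Rightarrow> ennreal"
  assumes [measurable]: "F \<in> borel_measurable borel"
  shows "(\<integral>\<^sup>+y. indicator {0<..} y * (\<integral>\<^sup>+x. F (Complex x y) \<partial>lborel) \<partial>lborel) =
    (\<integral>\<^sup>+t. indicator {0<..<pi} t * (\<integral>\<^sup>+r. indicator {0<..} r * (ennreal r * F (of_real r * cis t)) \<partial>lborel) \<partial>lborel)"
proof -
  have [measurable]: "(tan :: real \<Rightarrow> real) \<in> borel_measurable borel"
    unfolding tan_def by measurable
  define I :: "real \<Rightarrow> ennreal" where "I = indicator {-(pi/2)<..<pi/2}"
  have [measurable]: "I \<in> borel_measurable borel" unfolding I_def by simp
  have 1: "(\<integral>\<^sup>+x. F (Complex x y) \<partial>lborel) =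
     (\<integral>\<^sup>+s. ennreal y * F (Complex (y * tan s) y) * ennreal (inverse ((cos s)\<^sup>2)) * I s \<partial>lborel)"
    if "y > 0" for y
  proof -
    have "(\<integral>\<^sup>+x. F (Complex x y) \<partial>lborel) = ennreal y * (\<integral>\<^sup>+x. F (Complex (y * x) y) \<partial>lborel)"
      using nn_integral_real_affine[of "\<lambda>x. F (Complex x y)" y 0] that by simp
    also have "\<dots> = (\<integral>\<^sup>+x. ennreal y * F (Complex (y * x) y) \<partial>lborel)"
      by (rule nn_integral_cmult[symmetric]) measurable
    also have "\<dots> = (\<integral>\<^sup>+s. ennreal y * F (Complex (y * tan s) y) * ennreal (inverse ((cos s)\<^sup>2)) * I s \<partial>lborel)"
      unfolding I_def by (rule nn_integral_tan_substitution) measurable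
    finally show ?thesis .
  qed
  \<comment> \<open>Three factors combine here: \<open>cos s\<close> from the scaling
    \<open>y = r cos s\<close>, \<open>y = r cos s\<close> from the first substitution, and
    \<open>1 / (cos s)^2\<close> from the derivative of \<open>tan\<close>. Their product is the
    polar Jacobian \<open>r\<close>.\<close>
  have 2: "(\<integral>\<^sup>+y. indicator {0<..} y * (ennreal y * F (Complex (y * tan s) y) * ennreal (inverse ((cos s)\<^sup>2)) * I s) \<partial>lborel)
     = I s * (\<integral>\<^sup>+r. indicator {0<..} r * (ennreal r * F (Complex (r * sin s) (r * cos s))) \<partial>lborel)" for s
  proof (cases "s \<in> {-(pi/2)<..<pi/2}")
    case True
    then have c: "cos s > 0" by (auto intro: cos_gt_zero_pi)
    then have [simp]: "I s = 1" "r * cos s * tan s = r * sin s" for r using True by (auto simp: I_def tan_def)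
    have "(\<integral>\<^sup>+y. indicator {0<..} y * (ennreal y * F (Complex (y * tan s) y) * ennreal (inverse ((cos s)\<^sup>2))) \<partial>lborel)
      = ennreal (cos s) * (\<integral>\<^sup>+r. indicator {0<..} (r * cos s) * (ennreal (r * cos s) * F (Complex (r * sin s) (r * cos s)) * ennreal (inverse ((cos s)\<^sup>2))) \<partial>lborel)"
      using c by (subst nn_integral_real_affine[where c="cos s" and t=0]) (auto simp: mult.commute[of "cos s"])
    also have "\<dots> = (\<integral>\<^sup>+r. ennreal (cos s) * (indicator {0<..} (r * cos s) * (ennreal (r * cos s) * F (Complex (r * sin s) (r * cos s)) * ennreal (inverse ((cos s)\<^sup>2)))) \<partial>lborel)"
      by (rule nn_integral_cmult[symmetric]) measurable
    also have "\<dots> = (\<integral>\<^sup>+r. indicator {0<..} r * (ennreal r * F (Complex (r * sin s) (r * cos s))) \<partial>lborel)"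
    proof (intro nn_integral_cong)
      fix r :: real
      show "ennreal (cos s) * (indicator {0<..} (r * cos s) * (ennreal (r * cos s) * F (Complex (r * sin s) (r * cos s)) * ennreal (inverse ((cos s)\<^sup>2))))
        = indicator {0<..} r * (ennreal r * F (Complex (r * sin s) (r * cos s)))"
      proof (cases "r > 0")
        case True
        have "ennreal (cos s) * (ennreal (r * cos s) * ennreal (inverse ((cos s)\<^sup>2))) = ennreal r"
          using c True by (simp add: ennreal_mult[symmetric] field_simps power2_eq_square)
        then show ?thesis using c True
          by (simp add: zero_less_mult_iff ac_simps) (metis mult.assoc)
      qed (use c in \<open>simp add: zero_less_mult_iff\<close>)
    qed
    finally show ?thesis by simp
  qed (auto simp: I_def)
  have "(\<integral>\<^sup>+y. indicator {0<..} y * (\<integral>\<^sup>+x. F (Complex x y) \<partial>lborel) \<partial>lborel) =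
     (\<integral>\<^sup>+y. (\<integral>\<^sup>+s. indicator {0<..} y * (ennreal y * F (Complex (y * tan s) y) * ennreal (inverse ((cos s)\<^sup>2)) * I s) \<partial>lborel) \<partial>lborel)"
    by (intro nn_integral_cong) (auto simp: indicator_def 1)
  also have "\<dots> = (\<integral>\<^sup>+s. I s * (\<integral>\<^sup>+r. indicator {0<..} r * (ennreal r * F (Complex (r * sin s) (r * cos s))) \<partial>lborel) \<partial>lborel)"
    unfolding 2[symmetric] by (rule lborel_pair.Fubini') measurable
  also have "\<dots> = (\<integral>\<^sup>+t. I (pi/2 + (-1) * t) * (\<integral>\<^sup>+r. indicator {0<..} r * (ennreal r * F (Complex (r * sin (pi/2 + (-1) * t)) (r * cos (pi/2 + (-1) * t)))) \<partial>lborel) \<partial>lborel)"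
  proof -
    define H where "H s = (\<integral>\<^sup>+r. indicator {0<..} r * (ennreal r * F (Complex (r * sin s) (r * cos s))) \<partial>lborel)" for s
    have [measurable]: "H \<in> borel_measurable borel" unfolding H_def by measurable
    show ?thesis
      using nn_integral_real_affine[of "\<lambda>s. I s * H s" "-1" "pi/2"] by (simp add: H_def)
  qed
  also have "\<dots> = (\<integral>\<^sup>+t. indicator {0<..<pi} t * (\<integral>\<^sup>+r. indicator {0<..} r * (ennreal r * F (of_real r * cis t)) \<partial>lborel) \<partial>lborel)"
  proof (intro nn_integral_cong)
    fix t :: real
    have "I (pi/2 + (-1) * t) = indicator {0<..<pi} t" by (auto simp: I_def indicator_def)
    moreover have "Complex (r * sin (pi/2 + (-1) * t)) (r * cos (pi/2 + (-1) * t)) = of_real r * cis t" for r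
      by (simp add: complex_eq_iff sin_diff cos_diff)
    ultimately show "I (pi/2 + (-1) * t) * (\<integral>\<^sup>+r. indicator {0<..} r * (ennreal r * F (Complex (r * sin (pi/2 + (-1) * t)) (r * cos (pi/2 + (-1) * t)))) \<partial>lborel)
       = indicator {0<..<pi} t * (\<integral>\<^sup>+r. indicator {0<..} r * (ennreal r * F (of_real r * cis t)) \<partial>lborel)" by simp
  qed
  finally show ?thesis .
qed

text \<open>The lower half plane is the upper one rotated by \<open>pi\<close>, so applying the
  previous lemma to \<open>F (- z)\<close> shifts the angle by \<open>pi\<close>. The real axis and
  the angles 0, \<open>pi\<close>, \<open>2*pi\<close> are null sets.\<close>

theorem nn_integral_polar:
  fixes F :: "complex \<Rightarrow> ennreal"
  assumes [measurable]: "F \<in> borel_measurable borel"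
  shows "(\<integral>\<^sup>+z. F z \<partial>lborel) =
    (\<integral>\<^sup>+r. indicator {0<..} r * (ennreal r * (\<integral>\<^sup>+t. indicator {0..2*pi} t * F (of_real r * cis t) \<partial>lborel)) \<partial>lborel)"
proof -
  define G where "G t = (\<integral>\<^sup>+r. indicator {0<..} r * (ennreal r * F (of_real r * cis t)) \<partial>lborel)" for t
  have [measurable]: "G \<in> borel_measurable borel" unfolding G_def by measurable
  define J where "J y = (\<integral>\<^sup>+x. F (Complex x y) \<partial>lborel)" for y
  have [measurable]: "J \<in> borel_measurable borel" unfolding J_def by measurable
  have up: "(\<integral>\<^sup>+y. indicator {0<..} y * J y \<partial>lborel) = (\<integral>\<^sup>+t. indicator {0<..<pi} t * G t \<partial>lborel)"
    unfolding J_def G_def by (rule nn_integral_upper_half_plane_polar) measurable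
  have Jm: "J (-y) = (\<integral>\<^sup>+x. F (- Complex x y) \<partial>lborel)" for y
    unfolding J_def by (subst nn_integral_real_affine[where c="-1" and t=0]) (auto simp: uminus_complex.code)
  have "(\<integral>\<^sup>+y. indicator {..<0} y * J y \<partial>lborel) = (\<integral>\<^sup>+y. indicator {0<..} y * J (-y) \<partial>lborel)"
    by (subst nn_integral_real_affine[where c="-1" and t=0]) (auto intro!: nn_integral_cong simp: indicator_def)
  also have "\<dots> = (\<integral>\<^sup>+t. indicator {0<..<pi} t * G (pi + t) \<partial>lborel)"
    unfolding Jm G_def
    by (subst nn_integral_upper_half_plane_polar) (measurable, simp add: cis_mult[symmetric])
  also have "\<dots> = (\<integral>\<^sup>+t. indicator {pi<..<2*pi} t * G t \<partial>lborel)"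
    by (subst (2) nn_integral_real_affine[where c=1 and t=pi]) (auto intro!: nn_integral_cong simp: indicator_def)
  finally have down: "(\<integral>\<^sup>+y. indicator {..<0} y * J y \<partial>lborel) = (\<integral>\<^sup>+t. indicator {pi<..<2*pi} t * G t \<partial>lborel)" .
  have "(\<integral>\<^sup>+z. F z \<partial>lborel) = (\<integral>\<^sup>+y. J y \<partial>lborel)"
    unfolding J_def by (rule nn_integral_complex_eq_iterated) measurable
  also have "\<dots> = (\<integral>\<^sup>+y. indicator {0<..} y * J y + indicator {..<0} y * J y \<partial>lborel)"
    using AE_lborel_singleton[of "0::real"] by (intro nn_integral_cong_AE) (auto simp: indicator_def)
  also have "\<dots> = (\<integral>\<^sup>+t. indicator {0<..<pi} t * G t \<partial>lborel) + (\<integral>\<^sup>+t. indicator {pi<..<2*pi} t * G t \<partial>lborel)"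
    by (subst nn_integral_add) (auto simp: up down)
  also have "\<dots> = (\<integral>\<^sup>+t. indicator {0<..<pi} t * G t + indicator {pi<..<2*pi} t * G t \<partial>lborel)"
    by (subst nn_integral_add) auto
  also have "\<dots> = (\<integral>\<^sup>+t. indicator {0..2*pi} t * G t \<partial>lborel)"
    using AE_lborel_singleton[of "0::real"] AE_lborel_singleton[of pi] AE_lborel_singleton[of "2*pi"]
    by (intro nn_integral_cong_AE) (auto simp: indicator_def)
  also have "\<dots> = (\<integral>\<^sup>+t. (\<integral>\<^sup>+r. indicator {0..2*pi} t * (indicator {0<..} r * (ennreal r * F (of_real r * cis t))) \<partial>lborel) \<partial>lborel)"
    unfolding G_def by (subst nn_integral_cmult) auto
  also have "\<dots> = (\<integral>\<^sup>+r. (\<integral>\<^sup>+t. indicator {0<..} r * (ennreal r * (indicator {0..2*pi} t * F (of_real r * cis t))) \<partial>lborel) \<partial>lborel)"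
    by (subst lborel_pair.Fubini') (auto simp: mult_ac)
  also have "\<dots> = (\<integral>\<^sup>+r. indicator {0<..} r * (ennreal r * (\<integral>\<^sup>+t. indicator {0..2*pi} t * F (of_real r * cis t) \<partial>lborel)) \<partial>lborel)"
    by (intro nn_integral_cong) (simp add: nn_integral_cmult)
  finally show ?thesis .
qed

section \<open>Subharmonicity and circle means\<close>

text \<open>The factor \<open>1 / (2 * pi)\<close> is built in, so the integral over a period is
  1.\<close>

definition poisson :: "complex \<Rightarrow> real \<Rightarrow> real" where
  "poisson w t = (1 - (norm w)\<^sup>2) / (2 * pi * (norm (cis t - w))\<^sup>2)"

lemma borel_measurable_poisson [measurable]: "poisson w \<in> borel_measurable borel"
  unfolding poisson_def by measurable

text \<open>Cauchy's formula at \<open>w\<close>, applied not to \<open>f\<close> but to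
  \<open>h u = f u * (1 - |w|^2) / (1 - cnj w * u)\<close>, which has the same value at
  \<open>w\<close>. On the circle \<open>1 - cnj w * u = u * cnj (u - w)\<close>, and this turns the
  Cauchy kernel into the Poisson kernel.\<close>

lemma has_integral_poisson:
  assumes "continuous_on (cball 0 1) f" "f holomorphic_on ball 0 1" "norm w < 1"
  shows "((\<lambda>t. of_real (poisson w t) * f (cis t)) has_integral f w) {0..2*pi}"
proof -
  define h where "h u = f u * (1 - (norm w)\<^sup>2) / (1 - cnj w * u)" for u
  have nz: "1 - cnj w * u \<noteq> 0" if "norm u \<le> 1" for u
  proof -
    have "norm (cnj w * u) < 1" using assms(3) that
      by (simp add: norm_mult) (metis mult_left_le norm_ge_zero order_le_less_trans)
    then show ?thesis by auto
  qed
  have "continuous_on (cball 0 1) h" unfolding h_def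
    using assms(1) nz by (intro continuous_intros) auto
  moreover have "h holomorphic_on ball 0 1" unfolding h_def
    using assms(2) nz by (intro holomorphic_intros) auto
  ultimately have "((\<lambda>u. h u / (u - w)) has_contour_integral (2 * of_real pi * \<i> * h w)) (circlepath 0 1)"
    using assms(3) by (intro Cauchy_integral_circlepath) auto
  then have "((\<lambda>t. h (cis t) / (cis t - w) * 1 * \<i> * cis t) has_integral 2 * of_real pi * \<i> * h w) {0..2*pi}"
    unfolding circlepath_def by (subst (asm) has_contour_integral_part_circlepath_iff) auto
  then have "((\<lambda>t. (1 / (2 * of_real pi * \<i>)) * (h (cis t) / (cis t - w) * 1 * \<i> * cis t)) has_integral
       (1 / (2 * of_real pi * \<i>)) * (2 * of_real pi * \<i> * h w)) {0..2*pi}"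
    by (rule has_integral_mult_right)
  moreover have "(1 / (2 * of_real pi * \<i>)) * (2 * of_real pi * \<i> * h w) = f w"
  proof -
    have "1 - cnj w * w = of_real (1 - (norm w)\<^sup>2)"
      using complex_norm_square[of w] by (simp add: mult.commute)
    then show ?thesis using nz[of w] assms(3) by (simp add: h_def)
  qed
  moreover have "(1 / (2 * of_real pi * \<i>)) * (h (cis t) / (cis t - w) * 1 * \<i> * cis t) = of_real (poisson w t) * f (cis t)" for t
  proof -
    have c1: "cis t * cnj (cis t) = 1" using complex_norm_square[of "cis t"] by simp
    have ne: "cis t - w \<noteq> 0" using assms(3) by auto
    have "1 - cnj w * cis t = cis t * cnj (cis t - w)" using c1 by (simp add: algebra_simps)
    then have *: "(1 - cnj w * cis t) * (cis t - w) = cis t * of_real ((norm (cis t - w))\<^sup>2)"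
      using complex_norm_square[of "cis t - w"] by (simp only: mult_ac)
    have "h (cis t) / (cis t - w) * cis t = f (cis t) * (1 - (norm w)\<^sup>2) / of_real ((norm (cis t - w))\<^sup>2)"
      unfolding h_def divide_divide_eq_left * using ne by (simp add: field_simps)
    then have "h (cis t) / (cis t - w) * cis t / (2 * of_real pi) = of_real (poisson w t) * f (cis t)"
      by (simp only: poisson_def) (simp add: divide_simps)
    then show ?thesis by (simp add: mult.commute)
  qed
  ultimately show ?thesis by simp
qed

lemma poisson_nonneg: "norm w < 1 \<Longrightarrow> 0 \<le> poisson w t"
  by (simp add: poisson_def power_le_one)

lemma poisson_le:
  assumes "norm w < 1"
  shows "poisson w t \<le> 1 / (pi * (1 - norm w))"
proof -
  have "1 - norm w \<le> norm (cis t - w)" using norm_triangle_ineq2[of "cis t" w] by simp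
  then have "(1 - norm w)\<^sup>2 \<le> (norm (cis t - w))\<^sup>2" using assms by (intro power_mono) auto
  then have "poisson w t \<le> (1 - (norm w)\<^sup>2) / (2 * pi * (1 - norm w)\<^sup>2)"
    unfolding poisson_def using assms \<open>1 - norm w \<le> norm (cis t - w)\<close>
    by (intro divide_left_mono mult_left_mono mult_pos_pos zero_less_power) (auto simp: power_le_one)
  also have "\<dots> = (1 + norm w) / (2 * pi * (1 - norm w))"
  proof -
    have "1 - (norm w)\<^sup>2 = (1 + norm w) * (1 - norm w)" by (simp add: power2_eq_square algebra_simps)
    then show ?thesis using assms by (simp add: power2_eq_square)
  qed
  also have "\<dots> \<le> 2 / (2 * pi * (1 - norm w))"
    using assms by (intro divide_right_mono) auto
  finally show ?thesis using assms by simp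
qed

text \<open>The two differences agree up to conjugation and a unimodular factor. The symmetry is
  what makes circle means monotone: after exchanging integrals, the kernel is integrated over the
  angle of its centre and must still give 1.\<close>

lemma poisson_commute: "poisson (of_real x * cis s) t = poisson (of_real x * cis t) s"
proof -
  have "cis t - of_real x * cis s = cis (s + t) * cnj (cis s - of_real x * cis t)"
    by (simp add: cis_cnj right_diff_distrib cis_mult mult.left_commute)
  then have "norm (cis t - of_real x * cis s) = norm (cis s - of_real x * cis t)"
    by (simp add: norm_mult del: complex_cnj_diff complex_cnj_mult)
  then show ?thesis by (simp add: poisson_def norm_mult)
qed

lemma cis_neq_of_norm_less_1: "norm w < 1 \<Longrightarrow> cis t - w \<noteq> 0"
  by auto

lemma continuous_on_poisson: "norm w < 1 \<Longrightarrow> continuous_on A (poisson w)"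
proof -
  assume w: "norm w < 1"
  show ?thesis unfolding poisson_def
    using cis_neq_of_norm_less_1[OF w] by (intro continuous_intros) auto
qed

lemma has_integral_poisson_1: "norm w < 1 \<Longrightarrow> (poisson w has_integral 1) {0..2*pi}"
  using has_integral_Re[OF has_integral_poisson[of "\<lambda>_. 1" w]] by simp

section \<open>Approximation on the circle by real parts of polynomials\<close>

inductive harmonic_polynomial :: "(complex \<Rightarrow> real) \<Rightarrow> bool" where
  monom: "harmonic_polynomial (\<lambda>z. Re (c * z ^ k))"
| add: "harmonic_polynomial f \<Longrightarrow> harmonic_polynomial g \<Longrightarrow> harmonic_polynomial (\<lambda>z. f z + g z)"

lemma harmonic_polynomial_eq_Re_holomorphic:
  "harmonic_polynomial f \<Longrightarrow> \<exists>Q. Q holomorphic_on UNIV \<and> (\<forall>z. f z = Re (Q z))"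
proof (induction rule: harmonic_polynomial.induct)
  case (monom c k)
  then show ?case by (intro exI[of _ "\<lambda>z. c * z ^ k"]) (auto intro!: holomorphic_intros)
next
  case (add f g)
  then obtain Q R where "Q holomorphic_on UNIV \<and> (\<forall>z. f z = Re (Q z))" "R holomorphic_on UNIV \<and> (\<forall>z. g z = Re (R z))"
    by blast
  then show ?case by (intro exI[of _ "\<lambda>z. Q z + R z"]) (auto intro!: holomorphic_intros)
qed

text \<open>This is \<open>Re u * Re v = (Re (u * v) + Re (u * cnj v)) / 2\<close> together with
  \<open>cnj z = 1 / z\<close> on the circle. The condition \<open>k \<le> j\<close> keeps the
  exponent \<open>j - k\<close> a true difference.\<close>

lemma monom_mult_monom_on_circle:
  assumes "norm z = 1" "k \<le> j"
  shows "Re (a * z ^ j) * Re (b * z ^ k) = Re (a * b / 2 * z ^ (j + k)) + Re (a * cnj b / 2 * z ^ (j - k))"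
proof -
  have zz: "z * cnj z = 1" using complex_norm_square[of z] assms by simp
  have "z ^ (j - k) = z ^ (j - k) * (z * cnj z) ^ k" by (simp add: zz)
  also have "\<dots> = z ^ j * cnj (z ^ k)" using assms(2) by (simp add: power_mult_distrib power_add[symmetric] flip: mult.assoc)
  finally have "a * cnj b / 2 * z ^ (j - k) = (a * z ^ j) * cnj (b * z ^ k) / 2" by simp
  moreover have "a * b / 2 * z ^ (j + k) = (a * z ^ j) * (b * z ^ k) / 2" by (simp add: power_add)
  moreover have "Re u * Re v = Re (u * v / 2) + Re (u * cnj v / 2)" for u v by (simp add: field_simps)
  ultimately show ?thesis by (simp only:)
qed

text \<open>A product of harmonic functions is in general not harmonic, but only boundary values
  matter: on the circle it can be replaced by a harmonic polynomial with the same values.\<close>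

lemma harmonic_polynomial_mult_on_circle:
  assumes "harmonic_polynomial f" "harmonic_polynomial g"
  shows "\<exists>h. harmonic_polynomial h \<and> (\<forall>z\<in>sphere 0 1. h z = f z * g z)"
  using assms
proof (induction arbitrary: g rule: harmonic_polynomial.induct)
  case (monom a j)
  from monom show ?case
  proof (induction rule: harmonic_polynomial.induct)
    case (monom b k)
    show ?case
    proof (cases "k \<le> j")
      case True
      then show ?thesis
        by (intro exI[of _ "\<lambda>z. Re (a * b / 2 * z ^ (j + k)) + Re (a * cnj b / 2 * z ^ (j - k))"] conjI
            harmonic_polynomial.intros ballI monom_mult_monom_on_circle[symmetric]) auto
    next
      case False
      then have "Re (a * z ^ j) * Re (b * z ^ k) = Re (b * a / 2 * z ^ (k + j)) + Re (b * cnj a / 2 * z ^ (k - j))"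
        if "norm z = 1" for z  using monom_mult_monom_on_circle[of z j k b a] that
        by (simp only: mult.commute[of "Re (a * z ^ j)"])
      then show ?thesis
        by (intro exI[of _ "\<lambda>z. Re (b * a / 2 * z ^ (k + j)) + Re (b * cnj a / 2 * z ^ (k - j))"] conjI
            harmonic_polynomial.intros) (simp del: times_complex.sel)
    qed
  next
    case (add f g)
    then obtain F G where "harmonic_polynomial F" "harmonic_polynomial G"
      "\<forall>z\<in>sphere 0 1. F z = Re (a * z ^ j) * f z" "\<forall>z\<in>sphere 0 1. G z = Re (a * z ^ j) * g z" by blast
    then show ?case
      by (intro exI[of _ "\<lambda>z. F z + G z"] conjI harmonic_polynomial.add)
         (auto simp: distrib_left simp del: times_complex.sel)
  qed
next
  case (add f f')
  then obtain F G where "harmonic_polynomial F" "harmonic_polynomial G"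
      "\<forall>z\<in>sphere 0 1. F z = f z * g z" "\<forall>z\<in>sphere 0 1. G z = f' z * g z" by metis
  then show ?case
    by (intro exI[of _ "\<lambda>z. F z + G z"] conjI harmonic_polynomial.add) (auto simp: algebra_simps)
qed

lemma real_polynomial_function_eq_harmonic_on_circle:
  fixes f :: "complex \<Rightarrow> real"
  assumes "real_polynomial_function f"
  shows "\<exists>h. harmonic_polynomial h \<and> (\<forall>z\<in>sphere 0 1. h z = f z)"
  using assms
proof (induction rule: real_polynomial_function.induct)
  case (linear f)
  then interpret bounded_linear f .
  \<comment> \<open>A real linear functional on the plane is the real part of multiplication by
    \<open>f 1 - \<i> * f \<i>\<close>.\<close>
  have eq: "f z = Re (Complex (f 1) (- f \<i>) * z ^ 1)" for z
  proof -
    have "z = Re z *\<^sub>R 1 + Im z *\<^sub>R \<i>" by (simp add: complex_eq_iff)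
    then have "f z = f (Re z *\<^sub>R 1 + Im z *\<^sub>R \<i>)" by simp
    also have "\<dots> = Re z * f 1 + Im z * f \<i>" by (simp only: add scaleR) simp
    finally show ?thesis by simp
  qed
  show ?case
    by (intro exI[of _ "\<lambda>z. Re (Complex (f 1) (- f \<i>) * z ^ 1)"] conjI harmonic_polynomial.monom ballI eq[symmetric])
next
  case (const c)
  then show ?case
    by (intro exI[of _ "\<lambda>z. Re (of_real c * z ^ 0)"] conjI harmonic_polynomial.intros) auto
next
  case (add f g)
  then obtain F G where "harmonic_polynomial F" "harmonic_polynomial G"
      "\<forall>z\<in>sphere 0 1. F z = f z" "\<forall>z\<in>sphere 0 1. G z = g z" by metis
  then show ?case
    by (intro exI[of _ "\<lambda>z. F z + G z"] conjI harmonic_polynomial.add) auto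
next
  case (mult f g)
  then obtain F G where "harmonic_polynomial F" "harmonic_polynomial G"
      "\<forall>z\<in>sphere 0 1. F z = f z" "\<forall>z\<in>sphere 0 1. G z = g z" by metis
  then show ?case using harmonic_polynomial_mult_on_circle[of F G] by auto
qed

text \<open>Stone-Weierstrass supplies a polynomial in the real and imaginary parts; replacing it on
  the circle by a harmonic polynomial makes it the real part of an entire function.\<close>

lemma approximate_on_circle_by_Re_holomorphic:
  fixes L :: "complex \<Rightarrow> real"
  assumes "continuous_on (sphere 0 1) L" "0 < e"
  obtains Q where "Q holomorphic_on UNIV" "\<And>z. norm z = 1 \<Longrightarrow> \<bar>L z - Re (Q z)\<bar> < e"
proof -
  obtain g where g: "real_polynomial_function g" "\<And>x. x \<in> sphere 0 1 \<Longrightarrow> \<bar>L x - g x\<bar> < e"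
    using Stone_Weierstrass_real_polynomial_function[OF compact_sphere assms] by metis
  obtain h where h: "harmonic_polynomial h" "\<forall>z\<in>sphere 0 1. h z = g z"
    using real_polynomial_function_eq_harmonic_on_circle[OF g(1)] by blast
  obtain Q where "Q holomorphic_on UNIV" "\<forall>z. h z = Re (Q z)"
    using harmonic_polynomial_eq_Re_holomorphic[OF h(1)] by blast
  then show ?thesis using that[of Q] g(2) h(2) by simp
qed

text \<open>
  Subharmonicity of \<open>|f|^p\<close> without factoring out zeros: on the circle, \<open>ln (|f|^p + d) / p\<close> is within
  \<open>d\<close> of the real part of a polynomial \<open>Q\<close>. The maximum principle for \<open>f exp (-Q)\<close> bounds \<open>|f|\<close> by
  \<open>exp d |exp Q|\<close>, and the Poisson formula applies to the holomorphic function \<open>exp (p Q)\<close>.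
\<close>

lemma norm_powr_le_poisson_integral:
  assumes contf: "continuous_on (cball 0 1) f" and holf: "f holomorphic_on ball 0 1"
    and w: "norm w < 1" and p: "0 < p"
  shows "norm (f w) powr p \<le> integral {0..2*pi} (\<lambda>t. poisson w t * norm (f (cis t)) powr p)"
proof -
  define I where "I = integral {0..2*pi} (\<lambda>t. poisson w t * norm (f (cis t)) powr p)"
  have cont_cis: "continuous_on A (\<lambda>t. f (cis t))" for A
    by (intro continuous_on_compose2[OF contf] continuous_on_cis continuous_on_id) auto
  have cont_p: "continuous_on A (\<lambda>t. norm (f (cis t)) powr p)" for A
    using p by (intro continuous_on_powr' continuous_intros cont_cis) auto
  have intp: "(\<lambda>t. poisson w t * norm (f (cis t)) powr p) integrable_on {0..2*pi}"
    by (intro integrable_continuous_real continuous_intros cont_p continuous_on_poisson w)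
  have le: "norm (f w) powr p \<le> exp (2 * p * d) * (I + d)" if d: "0 < d" for d
  proof -
    \<comment> \<open>The summand \<open>d\<close> keeps the logarithm finite and continuous at
      boundary zeros of \<open>f\<close>.\<close>
    define u where "u z = norm (f z) powr p + d" for z
    have u0: "u z > 0" for z using d by (simp add: u_def add_nonneg_pos)
    define L where "L z = ln (u z) / p" for z
    have contf': "continuous_on (sphere 0 1) f" by (rule continuous_on_subset[OF contf]) auto
    have "continuous_on (sphere 0 1) L"
      unfolding L_def u_def using p d
      by (intro continuous_intros continuous_on_powr' contf') (auto simp: add_nonneg_eq_0_iff)
    then obtain Q where Q: "Q holomorphic_on UNIV" "\<And>z. norm z = 1 \<Longrightarrow> \<bar>L z - Re (Q z)\<bar> < d"
      using approximate_on_circle_by_Re_holomorphic d by blast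
    have Qc: "continuous_on A Q" for A
      using Q(1) holomorphic_on_imp_continuous_on continuous_on_subset by blast
    have Qh: "Q holomorphic_on A" for A using Q(1) holomorphic_on_subset by blast
    have "norm (f w * exp (- Q w)) \<le> exp d"
    proof (rule maximum_modulus_frontier[where S="ball 0 1" and f="\<lambda>z. f z * exp (- Q z)"])
      show "(\<lambda>z. f z * exp (- Q z)) holomorphic_on interior (ball 0 1)"
        using holf Qh by (auto intro!: holomorphic_intros)
      show "continuous_on (closure (ball 0 1)) (\<lambda>z. f z * exp (- Q z))"
        using contf Qc by (auto intro!: continuous_intros)
      fix z :: complex assume "z \<in> frontier (ball 0 1)"
      then have z: "norm z = 1" by auto
      have "norm (f z) = (norm (f z) powr p) powr (1 / p)" using p by (simp add: powr_powr)
      also have "\<dots> \<le> u z powr (1 / p)" using p d by (intro powr_mono2) (auto simp: u_def)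
      also have "\<dots> = exp (L z)" using u0[of z] by (simp add: powr_def L_def)
      also have "\<dots> \<le> exp (d + Re (Q z))" using Q(2)[OF z] by simp
      finally show "norm (f z * exp (- Q z)) \<le> exp d"
        by (simp add: norm_mult exp_add exp_minus norm_inverse) (simp add: field_simps)
    qed (use w in auto)
    then have "norm (f w) \<le> exp (d + Re (Q w))"
      by (simp add: norm_mult exp_add exp_minus norm_inverse) (simp add: field_simps)
    then have "norm (f w) powr p \<le> exp (d + Re (Q w)) powr p" using p by (intro powr_mono2) auto
    also have "\<dots> = exp (p * d) * norm (exp (of_real p * Q w))"
      by (simp add: powr_def exp_add[symmetric] algebra_simps)
    also have "norm (exp (of_real p * Q w)) \<le> exp (p * d) * (I + d)"
    proof -
      have hi: "((\<lambda>t. of_real (poisson w t) * exp (of_real p * Q (cis t))) has_integral exp (of_real p * Q w)) {0..2*pi}"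
        using Qc Qh w by (intro has_integral_poisson) (auto intro!: continuous_intros holomorphic_intros)
      have "((\<lambda>t. poisson w t * norm (f (cis t)) powr p + d * poisson w t) has_integral I + d * 1) {0..2*pi}"
        using intp unfolding I_def
        by (intro has_integral_add has_integral_mult_right has_integral_poisson_1 integrable_integral w)
      then have "((\<lambda>t. exp (p * d) * (poisson w t * norm (f (cis t)) powr p + d * poisson w t)) has_integral exp (p * d) * (I + d * 1)) {0..2*pi}"
        by (rule has_integral_mult_right)
      then have hi2: "((\<lambda>t. exp (p * d) * (poisson w t * u (cis t))) has_integral exp (p * d) * (I + d)) {0..2*pi}"
        by (simp add: u_def algebra_simps)
      have "norm (of_real (poisson w t) * exp (of_real p * Q (cis t))) \<le> exp (p * d) * (poisson w t * u (cis t))" for t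
      proof -
        have "p * Re (Q (cis t)) \<le> p * (L (cis t) + d)" using Q(2)[of "cis t"] p by simp
        also have "\<dots> = p * d + ln (u (cis t))" using p by (simp add: L_def algebra_simps)
        finally have "exp (p * Re (Q (cis t))) \<le> exp (p * d) * u (cis t)"
          using u0[of "cis t"] by (metis exp_add exp_le_cancel_iff exp_ln)
        then have "poisson w t * exp (p * Re (Q (cis t))) \<le> poisson w t * (exp (p * d) * u (cis t))"
          using poisson_nonneg[OF w] by (rule mult_left_mono)
        then show ?thesis using poisson_nonneg[OF w, of t] by (simp add: norm_mult mult_ac)
      qed
      then show ?thesis
        using has_integral_norm_bound_integral_component[OF hi hi2, of 1] by simp
    qed
    finally show ?thesis by (simp add: exp_add[symmetric] mult_ac flip: mult.assoc)
  qed
  \<comment> \<open>Of the exponent \<open>2 * p * d\<close>, one half comes from the maximum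
    principle and the other from replacing \<open>Re Q\<close> by \<open>L\<close> under the Poisson
    integral. Both errors vanish with \<open>d\<close>.\<close>
  have "((\<lambda>d. exp (2 * p * d) * (I + d)) \<longlongrightarrow> exp (2 * p * 0) * (I + 0)) (at_right 0)"
    by (intro tendsto_intros)
  then show ?thesis unfolding I_def[symmetric]
    using le by (intro tendsto_lowerbound[of _ I "at_right 0"]) (auto simp: eventually_at_filter)
qed

lemma ennreal_norm_powr_le_poisson:
  assumes contf: "continuous_on (cball 0 1) f" and holf: "f holomorphic_on ball 0 1"
    and w: "norm w < 1" and p: "0 < p"
  shows "ennreal (norm (f w) powr p)
    \<le> (\<integral>\<^sup>+t. indicator {0..2*pi} t * ennreal (poisson w t * norm (f (cis t)) powr p) \<partial>lborel)"
proof -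
  have cont_cis: "continuous_on A (\<lambda>t. f (cis t))" for A
    by (intro continuous_on_compose2[OF contf] continuous_on_cis continuous_on_id) auto
  have cont_p: "continuous_on A (\<lambda>t. norm (f (cis t)) powr p)" for A
    using p by (intro continuous_on_powr' continuous_intros cont_cis) auto
  have intp: "(\<lambda>t. poisson w t * norm (f (cis t)) powr p) integrable_on {0..2*pi}"
    by (intro integrable_continuous_real continuous_intros cont_p continuous_on_poisson w)
  have "(\<integral>\<^sup>+t. ennreal (poisson w t * norm (f (cis t)) powr p) * indicator {0..2*pi} t \<partial>lborel)
     = ennreal (integral {0..2*pi} (\<lambda>t. poisson w t * norm (f (cis t)) powr p))"
    using intp poisson_nonneg[OF w] by (intro nn_integral_has_integral_lebesgue') auto
  then show ?thesis
    using norm_powr_le_poisson_integral[OF assms] by (simp add: mult.commute ennreal_leI)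
qed

lemma nn_integral_poisson:
  assumes "norm w < 1"
  shows "(\<integral>\<^sup>+t. indicator {0..2*pi} t * ennreal (poisson w t) \<partial>lborel) = 1"
  using nn_integral_has_integral_lebesgue'[OF poisson_nonneg[OF assms] has_integral_poisson_1[OF assms]]
  by (simp add: mult.commute)

text \<open>The indicator makes \<open>pmean p G\<close> Borel measurable on the whole line for \<open>G\<close> continuous on the disc only.\<close>

definition pmean :: "real \<Rightarrow> (complex \<Rightarrow> complex) \<Rightarrow> real \<Rightarrow> ennreal" where
  "pmean p G r = (\<integral>\<^sup>+t. indicator {0..2*pi} t *
     (indicator (ball 0 1) (of_real r * cis t) * ennreal (norm (G (of_real r * cis t)) powr p)) \<partial>lborel)"

lemma borel_measurable_indicator_norm_powr:
  assumes "continuous_on (ball 0 1) G"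
  shows "(\<lambda>z::complex. indicator (ball 0 1) z * ennreal (norm (G z :: complex) powr p)) \<in> borel_measurable borel"
proof -
  have "(\<lambda>z. indicator (ball 0 1) z *\<^sub>R G z) \<in> borel_measurable borel"
    using assms by (intro borel_measurable_continuous_on_indicator) auto
  then have *: "(\<lambda>z. norm (indicator (ball 0 1) z *\<^sub>R G z) powr p) \<in> borel_measurable borel"
    by measurable
  have "(\<lambda>z. indicator (ball 0 1) z * ennreal (norm (G z) powr p)) =
    (\<lambda>z. indicator (ball 0 1) z * ennreal (norm (indicator (ball 0 1) z *\<^sub>R G z) powr p))"
    by (auto simp: indicator_def)
  also have "\<dots> \<in> borel_measurable borel"
    by (intro borel_measurable_times_ennreal borel_measurable_indicator measurable_compose[OF * measurable_ennreal]) simp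
  finally show ?thesis .
qed

lemma borel_measurable_pmean:
  assumes "continuous_on (ball 0 1) G"
  shows "pmean p G \<in> borel_measurable borel"
proof -
  note [measurable] = borel_measurable_indicator_norm_powr[OF assms]
  have [measurable]: "(\<lambda>x::real\<times>real. of_real (fst x) * cis (snd x) :: complex) \<in> borel \<Otimes>\<^sub>M borel \<rightarrow>\<^sub>M borel"
    by measurable
  have "(\<lambda>(r, t). indicator {0..2*pi} t *
     (indicator (ball 0 1) (of_real r * cis t) * ennreal (norm (G (of_real r * cis t)) powr p))) \<in> borel_measurable (borel \<Otimes>\<^sub>M lborel)"
    using measurable_compose[OF \<open>(\<lambda>x. of_real (fst x) * cis (snd x)) \<in> _\<close> borel_measurable_indicator_norm_powr[OF assms, of p]]
    by (simp add: case_prod_beta)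
  then show ?thesis unfolding pmean_def by measurable
qed

lemma nn_integral_disc_radial_weight:
  assumes "continuous_on (ball 0 1) G" and [measurable]: "v \<in> borel_measurable borel"
  shows "(\<integral>\<^sup>+z. indicator (ball 0 1) z * ennreal (norm (G z) powr p) * v (norm z) \<partial>lborel) =
    (\<integral>\<^sup>+r. indicator {0<..<1} r * (ennreal r * (v r * pmean p G r)) \<partial>lborel)"
proof -
  note [measurable] = borel_measurable_indicator_norm_powr[OF assms(1)]
  have "(\<integral>\<^sup>+z. indicator (ball 0 1) z * ennreal (norm (G z) powr p) * v (norm z) \<partial>lborel) =
    (\<integral>\<^sup>+r. indicator {0<..} r * (ennreal r * (\<integral>\<^sup>+t. indicator {0..2*pi} t *
       (indicator (ball 0 1) (of_real r * cis t) * ennreal (norm (G (of_real r * cis t)) powr p) * v (norm (of_real r * cis t))) \<partial>lborel)) \<partial>lborel)"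
    by (rule nn_integral_polar) measurable
  also have "\<dots> = (\<integral>\<^sup>+r. indicator {0<..<1} r * (ennreal r * (v r * pmean p G r)) \<partial>lborel)"
  proof (intro nn_integral_cong)
    fix r :: real
    have [measurable]: "(\<lambda>t. indicator (ball 0 1) (of_real r * cis t) * ennreal (norm (G (of_real r * cis t)) powr p)) \<in> borel_measurable borel"
      using measurable_compose[OF _ borel_measurable_indicator_norm_powr[OF assms(1), of p], of "\<lambda>t. of_real r * cis t" borel]
      by simp
    have "(\<integral>\<^sup>+t. indicator {0..2*pi} t *
       (indicator (ball 0 1) (of_real r * cis t) * ennreal (norm (G (of_real r * cis t)) powr p) * v (norm (of_real r * cis t))) \<partial>lborel)
      = (\<integral>\<^sup>+t. v r * (indicator {0..2*pi} t *
       (indicator (ball 0 1) (of_real r * cis t) * ennreal (norm (G (of_real r * cis t)) powr p))) \<partial>lborel)" if "0 < r"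
      using that by (intro nn_integral_cong) (simp add: norm_mult mult_ac)
    moreover have "\<dots> = v r * pmean p G r" unfolding pmean_def by (rule nn_integral_cmult) measurable
    moreover have "pmean p G r = 0" if "1 \<le> r" using that by (simp add: pmean_def norm_mult)
    ultimately show "indicator {0<..} r * (ennreal r * (\<integral>\<^sup>+t. indicator {0..2*pi} t *
       (indicator (ball 0 1) (of_real r * cis t) * ennreal (norm (G (of_real r * cis t)) powr p) * v (norm (of_real r * cis t))) \<partial>lborel))
       = indicator {0<..<1} r * (ennreal r * (v r * pmean p G r))"
      by (cases "0 < r"; cases "r < 1") auto
  qed
  finally show ?thesis .
qed

text \<open>Dilation: \<open>u \<mapsto> G (s * u)\<close> is holomorphic on the closed unit disc
  because \<open>s < 1\<close>, so the Poisson inequality of the unit disc applies to it at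
  \<open>z / s\<close>.\<close>

lemma norm_powr_le_poisson_pmean:
  assumes G: "G holomorphic_on ball 0 1" and p: "0 < p" and zs: "norm z < s" "s < 1"
  shows "ennreal (norm (G z) powr p) \<le> (\<integral>\<^sup>+t. indicator {0..2*pi} t *
     (ennreal (poisson (z / of_real s) t) * ennreal (norm (G (of_real s * cis t)) powr p)) \<partial>lborel)"
proof -
  have s0: "0 < s" using zs(1) norm_ge_zero[of z] by linarith
  have sub: "(\<lambda>u::complex. of_real s * u) ` cball 0 1 \<subseteq> ball 0 1"
  proof
    fix y assume "y \<in> (\<lambda>u. of_real s * u) ` cball (0::complex) 1"
    then obtain u where u: "norm u \<le> 1" "y = of_real s * u" by auto
    then have "s * norm u \<le> s" using s0 by (simp add: mult_left_le)
    then have "s * norm u < 1" using zs by linarith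
    then show "y \<in> ball 0 1" using u s0 by (simp add: norm_mult)
  qed
  have h: "(\<lambda>u. G (of_real s * u)) holomorphic_on cball 0 1"
    using holomorphic_on_compose_gen[of "\<lambda>u. of_real s * u" "cball 0 1" G "ball 0 1"] G sub
    by (auto simp: o_def intro!: holomorphic_intros)
  have w: "norm (z / of_real s) < 1" using zs s0 by (simp add: norm_divide)
  have "ennreal (norm (G (of_real s * (z / of_real s))) powr p)
    \<le> (\<integral>\<^sup>+t. indicator {0..2*pi} t * ennreal (poisson (z / of_real s) t * norm (G (of_real s * cis t)) powr p) \<partial>lborel)"
    using h by (intro ennreal_norm_powr_le_poisson[where f="\<lambda>u. G (of_real s * u)"] w p)
      (auto intro: holomorphic_on_imp_continuous_on holomorphic_on_subset)
  then show ?thesis using s0 poisson_nonneg[OF w] by (simp add: ennreal_mult)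
qed

text \<open>The Poisson kernel is replaced by its upper bound. Since \<open>s < 1\<close>,
  \<open>1 - |z| / s\<close> is at least \<open>s - |z|\<close>, which gives a constant depending on
  the gap alone.\<close>

lemma norm_powr_le_pmean:
  assumes G: "G holomorphic_on ball 0 1" and p: "0 < p" and zs: "norm z < s" "s < 1"
  shows "ennreal (norm (G z) powr p) \<le> ennreal (1 / (pi * (s - norm z))) * pmean p G s"
proof -
  have s0: "0 < s" using zs(1) norm_ge_zero[of z] by linarith
  have w: "norm (z / of_real s) < 1" using zs s0 by (simp add: norm_divide)
  have P: "poisson (z / of_real s) t \<le> 1 / (pi * (s - norm z))" for t
  proof -
    have "s - norm z \<le> 1 - norm z / s"
    proof -
      have "1 - norm z / s = (s - norm z) / s" using s0 by (simp add: field_simps)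
      also have "\<dots> \<ge> (s - norm z) / 1" using s0 zs by (intro divide_left_mono) auto
      finally show ?thesis by simp
    qed
    then have "1 / (pi * (1 - norm z / s)) \<le> 1 / (pi * (s - norm z))"
      using zs s0 by (intro divide_left_mono mult_left_mono mult_pos_pos) auto
    then show ?thesis using poisson_le[OF w, of t] s0 by (simp add: norm_divide)
  qed
  note [measurable] = borel_measurable_indicator_norm_powr[OF holomorphic_on_imp_continuous_on[OF G]]
  have [measurable]: "(\<lambda>t. indicator (ball 0 1) (of_real s * cis t) * ennreal (norm (G (of_real s * cis t)) powr p)) \<in> borel_measurable borel"
    using measurable_compose[OF _ borel_measurable_indicator_norm_powr[OF holomorphic_on_imp_continuous_on[OF G], of p], of "\<lambda>t. of_real s * cis t" borel]
    by simp
  have "ennreal (norm (G z) powr p) \<le> (\<integral>\<^sup>+t. indicator {0..2*pi} t *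
     (ennreal (poisson (z / of_real s) t) * ennreal (norm (G (of_real s * cis t)) powr p)) \<partial>lborel)"
    by (rule norm_powr_le_poisson_pmean[OF assms])
  also have "\<dots> \<le> (\<integral>\<^sup>+t. ennreal (1 / (pi * (s - norm z))) * (indicator {0..2*pi} t *
     (indicator (ball 0 1) (of_real s * cis t) * ennreal (norm (G (of_real s * cis t)) powr p))) \<partial>lborel)"
    using s0 zs P by (intro nn_integral_mono) (auto simp: indicator_def norm_mult intro!: mult_right_mono ennreal_leI)
  also have "\<dots> = ennreal (1 / (pi * (s - norm z))) * pmean p G s"
    unfolding pmean_def by (rule nn_integral_cmult) measurable
  finally show ?thesis .
qed

text \<open>Integrate the Poisson inequality over the smaller circle and exchange the integrals. By
  symmetry of the kernel the inner integral is again that of a Poisson kernel, hence 1, and the mean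
  over the larger circle remains.\<close>

lemma pmean_mono:
  assumes G: "G holomorphic_on ball 0 1" and p: "0 < p" and rs: "0 \<le> r" "r \<le> s" "s < 1"
  shows "pmean p G r \<le> pmean p G s"
proof (cases "r = s")
  case False
  then have rs': "r < s" "0 < s" using rs by auto
  have [measurable]: "(\<lambda>t. indicator (ball 0 1) (of_real s * cis t) * ennreal (norm (G (of_real s * cis t)) powr p)) \<in> borel_measurable borel"
    using measurable_compose[OF _ borel_measurable_indicator_norm_powr[OF holomorphic_on_imp_continuous_on[OF G], of p], of "\<lambda>t. of_real s * cis t" borel]
    by simp
  define g where "g t = indicator (ball 0 1) (of_real s * cis t) * ennreal (norm (G (of_real s * cis t)) powr p)" for t
  have [measurable]: "g \<in> borel_measurable borel" unfolding g_def by measurable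
  have [measurable]: "(\<lambda>x. poisson (of_real (r/s) * cis (fst x)) (snd x)) \<in> borel_measurable (borel \<Otimes>\<^sub>M borel)"
    unfolding poisson_def by measurable
  have [measurable]: "(\<lambda>x. poisson (of_real (r/s) * cis (snd x)) (fst x)) \<in> borel_measurable (borel \<Otimes>\<^sub>M borel)"
    unfolding poisson_def by measurable
  have rs1: "norm (of_real (r/s) * cis t :: complex) < 1" for t using rs rs' by (simp add: norm_mult norm_divide)
  have "pmean p G r \<le> (\<integral>\<^sup>+t. indicator {0..2*pi} t * (\<integral>\<^sup>+u. indicator {0..2*pi} u *
     (ennreal (poisson (of_real (r/s) * cis t) u) * g u) \<partial>lborel) \<partial>lborel)"
    unfolding pmean_def
  proof (intro nn_integral_mono mult_left_mono)
    fix t :: real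
    have "ennreal (norm (G (of_real r * cis t)) powr p) \<le> (\<integral>\<^sup>+u. indicator {0..2*pi} u *
     (ennreal (poisson (of_real r * cis t / of_real s) u) * ennreal (norm (G (of_real s * cis u)) powr p)) \<partial>lborel)"
      using rs rs' by (intro norm_powr_le_poisson_pmean G p) (auto simp: norm_mult)
    also have "\<dots> = (\<integral>\<^sup>+u. indicator {0..2*pi} u * (ennreal (poisson (of_real (r/s) * cis t) u) * g u) \<partial>lborel)"
      using rs rs' by (intro nn_integral_cong) (simp add: g_def norm_mult)
    finally show "indicator (ball 0 1) (of_real r * cis t) * ennreal (norm (G (of_real r * cis t)) powr p) \<le>
      (\<integral>\<^sup>+u. indicator {0..2*pi} u * (ennreal (poisson (of_real (r/s) * cis t) u) * g u) \<partial>lborel)"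
      by (auto simp: indicator_def)
  qed auto
  also have "\<dots> = (\<integral>\<^sup>+t. (\<integral>\<^sup>+u. indicator {0..2*pi} t * (indicator {0..2*pi} u *
     (ennreal (poisson (of_real (r/s) * cis t) u) * g u)) \<partial>lborel) \<partial>lborel)"
    by (intro nn_integral_cong nn_integral_cmult[symmetric]) simp_all
  also have "\<dots> = (\<integral>\<^sup>+u. (\<integral>\<^sup>+t. indicator {0..2*pi} t * (indicator {0..2*pi} u *
     (ennreal (poisson (of_real (r/s) * cis t) u) * g u)) \<partial>lborel) \<partial>lborel)"
    by (rule lborel_pair.Fubini') measurable
  also have "\<dots> = (\<integral>\<^sup>+u. (\<integral>\<^sup>+t. (indicator {0..2*pi} u * g u) *
     (indicator {0..2*pi} t * ennreal (poisson (of_real (r/s) * cis u) t)) \<partial>lborel) \<partial>lborel)"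
    by (intro nn_integral_cong) (subst poisson_commute, simp add: mult_ac)
  also have "\<dots> = (\<integral>\<^sup>+u. (indicator {0..2*pi} u * g u) *
     (\<integral>\<^sup>+t. indicator {0..2*pi} t * ennreal (poisson (of_real (r/s) * cis u) t) \<partial>lborel) \<partial>lborel)"
    by (intro nn_integral_cong nn_integral_cmult) simp_all
  also have "\<dots> = pmean p G s"
    by (simp only: nn_integral_poisson[OF rs1] mult_1_right) (simp only: pmean_def g_def)
  finally show ?thesis .
qed simp

lemma pmean_finite:
  assumes G: "G holomorphic_on ball 0 1" and p: "0 < p" and r: "0 \<le> r" "r < 1"
  shows "pmean p G r < \<infinity>"
proof -
  have "continuous_on (sphere 0 r) G"
    using r by (intro holomorphic_on_imp_continuous_on holomorphic_on_subset[OF G]) auto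
  then have "compact (G ` sphere 0 r)" by (intro compact_continuous_image) auto
  then obtain B where B: "\<And>z. norm z = r \<Longrightarrow> norm (G z) \<le> B"
    using compact_imp_bounded[THEN bounded_normE] by (metis imageI mem_sphere_0)
  have "pmean p G r \<le> (\<integral>\<^sup>+t. indicator {0..2*pi} t * ennreal (B powr p) \<partial>lborel)"
    unfolding pmean_def using B r p
    by (intro nn_integral_mono mult_left_mono) (auto simp: indicator_def norm_mult intro!: ennreal_leI powr_mono2)
  also have "\<dots> < \<infinity>" by (simp add: nn_integral_multc ennreal_mult_less_top)
  finally show ?thesis .
qed

section \<open>Estimates near the boundary\<close>

text \<open>Layer-cake decomposition: the superlevel sets of the increasing function \<open>M\<close> are tails.\<close>

lemma nn_integral_mono_of_tails:
  fixes M :: "real \<Rightarrow> real" and u v :: "real \<Rightarrow> ennreal"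
  assumes [measurable]: "M \<in> borel_measurable borel" "u \<in> borel_measurable borel" "v \<in> borel_measurable borel"
    and M0: "\<And>x. 0 \<le> M x" and mono: "\<And>x y. a \<le> x \<Longrightarrow> x \<le> y \<Longrightarrow> y < b \<Longrightarrow> M x \<le> M y"
    and tails: "\<And>r. a \<le> r \<Longrightarrow> r < b \<Longrightarrow>
      (\<integral>\<^sup>+x. indicator {r..<b} x * u x \<partial>lborel) \<le> (\<integral>\<^sup>+x. indicator {r..<b} x * v x \<partial>lborel)"
  shows "(\<integral>\<^sup>+x. indicator {a..<b} x * (ennreal (M x) * u x) \<partial>lborel)
    \<le> (\<integral>\<^sup>+x. indicator {a..<b} x * (ennreal (M x) * v x) \<partial>lborel)"
proof -
  define S where "S t = {x\<in>{a..<b}. t < M x}" for t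
  have layers: "(\<integral>\<^sup>+x. indicator {a..<b} x * (ennreal (M x) * w x) \<partial>lborel)
      = (\<integral>\<^sup>+t. indicator {0..} t * (\<integral>\<^sup>+x. indicator (S t) x * w x \<partial>lborel) \<partial>lborel)"
    if [measurable]: "w \<in> borel_measurable borel" for w :: "real \<Rightarrow> ennreal"
  proof -
    have [measurable]: "Measurable.pred (borel \<Otimes>\<^sub>M borel) (\<lambda>x. snd x \<in> S (fst x))"
      "Measurable.pred (borel \<Otimes>\<^sub>M borel) (\<lambda>x. fst x \<in> S (snd x))"
      unfolding S_def mem_Collect_eq by measurable
    have [measurable]: "S t \<in> sets borel" for t unfolding S_def by measurable
    have "(\<integral>\<^sup>+x. indicator {a..<b} x * (ennreal (M x) * w x) \<partial>lborel) =
      (\<integral>\<^sup>+x. (\<integral>\<^sup>+t. indicator {0..} t * (indicator (S t) x * w x) \<partial>lborel) \<partial>lborel)"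
    proof (intro nn_integral_cong)
      fix x :: real
      have "ennreal (M x) = (\<integral>\<^sup>+t. indicator {0..<M x} t \<partial>lborel)" using M0[of x] by simp
      then have "indicator {a..<b} x * (ennreal (M x) * w x) = (\<integral>\<^sup>+t. indicator {0..<M x} t \<partial>lborel) * (indicator {a..<b} x * w x)"
        by (simp add: mult_ac)
      also have "\<dots> = (\<integral>\<^sup>+t. indicator {0..<M x} t * (indicator {a..<b} x * w x) \<partial>lborel)"
        by (rule nn_integral_multc[symmetric]) measurable
      also have "\<dots> = (\<integral>\<^sup>+t. indicator {0..} t * (indicator (S t) x * w x) \<partial>lborel)"
        by (intro nn_integral_cong) (auto simp: indicator_def S_def)
      finally show "indicator {a..<b} x * (ennreal (M x) * w x) = (\<integral>\<^sup>+t. indicator {0..} t * (indicator (S t) x * w x) \<partial>lborel)" .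
    qed
    also have "\<dots> = (\<integral>\<^sup>+t. (\<integral>\<^sup>+x. indicator {0..} t * (indicator (S t) x * w x) \<partial>lborel) \<partial>lborel)"
      by (rule lborel_pair.Fubini') measurable
    also have "\<dots> = (\<integral>\<^sup>+t. indicator {0..} t * (\<integral>\<^sup>+x. indicator (S t) x * w x \<partial>lborel) \<partial>lborel)"
      by (intro nn_integral_cong nn_integral_cmult) simp_all
    finally show ?thesis .
  qed
  have "(\<integral>\<^sup>+x. indicator (S t) x * u x \<partial>lborel) \<le> (\<integral>\<^sup>+x. indicator (S t) x * v x \<partial>lborel)" for t
  proof (cases "S t = {}")
    case False
    define r where "r = Inf (S t)"
    have bdd: "bdd_below (S t)" unfolding S_def by (intro bdd_belowI[of _ a]) auto
    obtain x0 where x0: "x0 \<in> S t" using False by auto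
    have ar: "a \<le> r" unfolding r_def using False by (intro cInf_greatest) (auto simp: S_def)
    have rb: "r < b" using cInf_lower[OF x0 bdd] x0 by (auto simp: r_def S_def)
    have up: "x \<in> S t" if x: "r < x" "x < b" for x
    proof -
      obtain y where y: "y \<in> S t" "y < x" using cInf_lessD[OF False, of x] x r_def by auto
      then show ?thesis using mono[of y x] x by (auto simp: S_def)
    qed
    \<comment> \<open>The superlevel set may or may not contain its infimum \<open>r\<close>, so it
      agrees with \<open>[r, b)\<close> only up to one point.\<close>
    have eq: "AE x in lborel. indicator (S t) x * w x = indicator {r..<b} x * w x" for w :: "real \<Rightarrow> ennreal"
      using AE_lborel_singleton[of r]
    proof eventually_elim
      case (elim x)
      have "x \<in> S t \<longleftrightarrow> x \<in> {r..<b}"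
        using up[of x] elim cInf_lower[OF _ bdd, of x] by (auto simp: r_def) (auto simp: S_def)
      then show ?case by (simp add: indicator_def)
    qed
    show ?thesis using tails[OF ar rb] nn_integral_cong_AE[OF eq[of u]] nn_integral_cong_AE[OF eq[of v]] by simp
  qed simp
  then show ?thesis unfolding layers[OF assms(2)] layers[OF assms(3)]
    by (intro nn_integral_mono) (simp add: mult_left_mono)
qed

text \<open>A weight is only assumed measurable on \<open>[0, 1)\<close>; its values elsewhere are arbitrary.\<close>

definition radial_density :: "(real \<Rightarrow> real) \<Rightarrow> real \<Rightarrow> ennreal" where
  "radial_density \<omega> s = indicator {0..<1} s * ennreal (\<omega> s)"

lemma borel_measurable_radial_density:
  assumes "radial_weight \<omega>"
  shows "radial_density \<omega> \<in> borel_measurable borel"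
proof -
  have "(\<lambda>s. indicator {0..<1} s *\<^sub>R \<omega> s) \<in> borel_measurable borel"
    using assms by (auto simp: radial_weight_def set_integrable_def)
  then have "(\<lambda>s. ennreal (indicator {0..<1} s *\<^sub>R \<omega> s)) \<in> borel_measurable borel" by measurable
  also have "(\<lambda>s. ennreal (indicator {0..<1} s *\<^sub>R \<omega> s)) = radial_density \<omega>"
    by (auto simp: radial_density_def indicator_def)
  finally show ?thesis .
qed

lemma nn_integral_radial_density:
  assumes "radial_weight \<omega>" "0 \<le> r"
  shows "(\<integral>\<^sup>+s. indicator {r..<1} s * radial_density \<omega> s \<partial>lborel) = ennreal (omega_hat \<omega> r)"
proof -
  have i: "integrable lborel (\<lambda>s. indicator {r..<1} s *\<^sub>R \<omega> s)"
    using assms set_integrable_subset[of lborel "{0..<1}" \<omega> "{r..<1}"]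
    by (auto simp: radial_weight_def set_integrable_def)
  have "(\<integral>\<^sup>+s. indicator {r..<1} s * radial_density \<omega> s \<partial>lborel) = (\<integral>\<^sup>+s. ennreal (indicator {r..<1} s *\<^sub>R \<omega> s) \<partial>lborel)"
    using assms by (intro nn_integral_cong) (auto simp: radial_density_def indicator_def)
  also have "\<dots> = ennreal (\<integral>s. indicator {r..<1} s *\<^sub>R \<omega> s \<partial>lborel)"
    using assms by (intro nn_integral_eq_integral i) (auto simp: radial_weight_def indicator_def)
  finally show ?thesis by (simp add: omega_hat_def set_lebesgue_integral_def)
qed

lemma omega_hat_pos: "radial_weight \<omega> \<Longrightarrow> 0 \<le> r \<Longrightarrow> r < 1 \<Longrightarrow> 0 < omega_hat \<omega> r"
  by (auto simp: radial_weight_def)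

lemma omega_hat_antimono:
  assumes "radial_weight \<omega>" "0 \<le> r" "r \<le> s" "s < 1"
  shows "omega_hat \<omega> s \<le> omega_hat \<omega> r"
proof -
  have "ennreal (omega_hat \<omega> s) \<le> ennreal (omega_hat \<omega> r)"
    using assms by (subst (1 2) nn_integral_radial_density[symmetric])
      (auto intro!: nn_integral_mono mult_right_mono indicator_leI)
  then show ?thesis using omega_hat_pos[OF assms(1,2)] assms by (simp add: ennreal_le_iff)
qed

section \<open>Weighted disc integrals and the growth they allow\<close>

definition disc_integral :: "real \<Rightarrow> (real \<Rightarrow> real) \<Rightarrow> (complex \<Rightarrow> complex) \<Rightarrow> ennreal" where
  "disc_integral p \<omega> G = (\<integral>\<^sup>+z. indicator (ball 0 1) z * ennreal (norm (G z) powr p * \<omega> (norm z)) \<partial>lborel)"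

lemma disc_integral_polar:
  assumes \<omega>: "radial_weight \<omega>" and G: "G holomorphic_on ball 0 1"
  shows "disc_integral p \<omega> G = (\<integral>\<^sup>+r. indicator {0<..<1} r * (ennreal r * (radial_density \<omega> r * pmean p G r)) \<partial>lborel)"
proof -
  have "disc_integral p \<omega> G = (\<integral>\<^sup>+z. indicator (ball 0 1) z * ennreal (norm (G z) powr p) * radial_density \<omega> (norm z) \<partial>lborel)"
    unfolding disc_integral_def using \<omega>
    by (intro nn_integral_cong) (auto simp: indicator_def radial_density_def ennreal_mult radial_weight_def)
  also have "\<dots> = (\<integral>\<^sup>+r. indicator {0<..<1} r * (ennreal r * (radial_density \<omega> r * pmean p G r)) \<partial>lborel)"
    by (intro nn_integral_disc_radial_weight holomorphic_on_imp_continuous_on[OF G] borel_measurable_radial_density \<omega>)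
  finally show ?thesis .
qed

text \<open>The factor 2 pays for the polar Jacobian, which is at least 1/2 on the range of
  integration.\<close>

lemma radial_integral_le_disc_integral:
  assumes \<omega>: "radial_weight \<omega>" and G: "G holomorphic_on ball 0 1" and r: "1/2 \<le> r"
  shows "(\<integral>\<^sup>+s. indicator {r..<1} s * (pmean p G s * radial_density \<omega> s) \<partial>lborel) \<le> 2 * disc_integral p \<omega> G"
proof -
  note [measurable] = borel_measurable_radial_density[OF \<omega>] borel_measurable_pmean[OF holomorphic_on_imp_continuous_on[OF G]]
  have "(\<integral>\<^sup>+s. indicator {r..<1} s * (pmean p G s * radial_density \<omega> s) \<partial>lborel)
     \<le> (\<integral>\<^sup>+s. 2 * (indicator {0<..<1} s * (ennreal s * (radial_density \<omega> s * pmean p G s))) \<partial>lborel)"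
  proof (intro nn_integral_mono)
    fix s :: real
    show "indicator {r..<1} s * (pmean p G s * radial_density \<omega> s) \<le> 2 * (indicator {0<..<1} s * (ennreal s * (radial_density \<omega> s * pmean p G s)))"
    proof (cases "s \<in> {r..<1}")
      case True
      then have "1 \<le> 2 * ennreal s" using r by (simp add: ennreal_mult'[symmetric] flip: ennreal_numeral ennreal_1)
      then have "1 * (pmean p G s * radial_density \<omega> s) \<le> (2 * ennreal s) * (pmean p G s * radial_density \<omega> s)"
        by (rule mult_right_mono) simp
      then show ?thesis using True r by (simp add: mult_ac)
    qed simp
  qed
  also have "\<dots> = 2 * disc_integral p \<omega> G"
    unfolding disc_integral_polar[OF \<omega> G] by (rule nn_integral_cmult) measurable
  finally show ?thesis .
qed

text \<open>Circle means increase, so the mean at \<open>r\<close> is at most every mean that enters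
  the integral over \<open>[r, 1)\<close>; \<open>omega_hat\<close> is the total weight
  there.\<close>

lemma pmean_mult_omega_hat_le:
  assumes \<omega>: "radial_weight \<omega>" and G: "G holomorphic_on ball 0 1" and p: "0 < p" and r: "1/2 \<le> r" "r < 1"
  shows "pmean p G r * ennreal (omega_hat \<omega> r) \<le> 2 * disc_integral p \<omega> G"
proof -
  note [measurable] = borel_measurable_radial_density[OF \<omega>]
  have "pmean p G r * ennreal (omega_hat \<omega> r) = (\<integral>\<^sup>+s. pmean p G r * (indicator {r..<1} s * radial_density \<omega> s) \<partial>lborel)"
    using r by (subst nn_integral_cmult) (auto simp: nn_integral_radial_density[OF \<omega>])
  also have "\<dots> \<le> (\<integral>\<^sup>+s. indicator {r..<1} s * (pmean p G s * radial_density \<omega> s) \<partial>lborel)"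
    using r by (intro nn_integral_mono) (auto simp: indicator_def intro!: mult_right_mono pmean_mono[OF G p])
  also have "\<dots> \<le> 2 * disc_integral p \<omega> G" by (rule radial_integral_le_disc_integral[OF \<omega> G r(1)])
  finally show ?thesis .
qed

text \<open>A value is controlled by the mean on a larger circle, and that mean by the weighted
  integral outside the circle. The constant \<open>2 / pi\<close> that arises is at most 1 and is
  dropped. The radius \<open>s\<close> stays free: it is taken midway to the boundary for tails, and
  fixed for local bounds.\<close>

lemma norm_powr_le_disc_integral:
  assumes \<omega>: "radial_weight \<omega>" and G: "G holomorphic_on ball 0 1" and p: "0 < p"
    and X: "disc_integral p \<omega> G \<le> ennreal B" "0 \<le> B" and z: "norm z < s" and s: "1/2 \<le> s" "s < 1"
  shows "norm (G z) powr p \<le> B / ((s - norm z) * omega_hat \<omega> s)"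
proof -
  define m where "m = enn2real (pmean p G s)"
  have m: "pmean p G s = ennreal m" "0 \<le> m" using pmean_finite[OF G p, of s] s by (auto simp: m_def)
  have W: "omega_hat \<omega> s > 0" using omega_hat_pos[OF \<omega>] s by simp
  have "ennreal (m * omega_hat \<omega> s) \<le> 2 * disc_integral p \<omega> G"
    using pmean_mult_omega_hat_le[OF \<omega> G p s] m W by (simp add: ennreal_mult)
  also have "\<dots> \<le> ennreal (2 * B)" using X by (simp add: ennreal_mult mult_left_mono)
  finally have "m * omega_hat \<omega> s \<le> 2 * B" using X by simp
  then have mB: "m \<le> 2 * B / omega_hat \<omega> s" using W by (simp add: field_simps)
  have "ennreal (1 / (pi * (s - norm z))) * ennreal m = ennreal (1 / (pi * (s - norm z)) * m)"
    using m z by (intro ennreal_mult[symmetric]) auto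
  then have "ennreal (norm (G z) powr p) \<le> ennreal (1 / (pi * (s - norm z)) * m)"
    using norm_powr_le_pmean[OF G p z s(2)] by (simp only: m(1))
  then have "norm (G z) powr p \<le> 1 / (pi * (s - norm z)) * m" using m z by (simp add: ennreal_le_iff)
  also have "\<dots> \<le> 1 / (pi * (s - norm z)) * (2 * B / omega_hat \<omega> s)" using mB z by (intro mult_left_mono) auto
  also have "\<dots> = (2 / pi) * (B / ((s - norm z) * omega_hat \<omega> s))" by simp
  also have "\<dots> \<le> 1 * (B / ((s - norm z) * omega_hat \<omega> s))"
    using X z W pi_ge_two by (intro mult_right_mono) auto
  finally show ?thesis by simp
qed

lemma nn_integral_powr_tail:
  assumes "-1 < a" "r < 1"
  shows "(\<integral>\<^sup>+x. indicator {r..<1} x * ennreal ((1 - x) powr a) \<partial>lborel) = ennreal ((1 - r) powr (a + 1) / (a + 1))"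
proof -
  have "(\<integral>\<^sup>+x. indicator {r..<1} x * ennreal ((1 - x) powr a) \<partial>lborel) = (\<integral>\<^sup>+x. indicator {r..<1} (1 + (-1) * x) * ennreal ((1 - (1 + (-1) * x)) powr a) \<partial>lborel)"
    by (subst nn_integral_real_affine[where c="-1" and t=1]) auto
  also have "\<dots> = (\<integral>\<^sup>+x. ennreal (x powr a) * indicator {0..1-r} x \<partial>lborel)"
    using AE_lborel_singleton[of "0::real"] by (intro nn_integral_cong_AE) (auto simp: indicator_def)
  also have "\<dots> = ennreal ((1 - r) powr (a + 1) / (a + 1))"
    using assms by (intro nn_integral_has_integral_lebesgue' has_integral_powr_from_0) auto
  finally show ?thesis .
qed

text \<open>With \<open>\<phi> = x powr (2 - 1/p) / W powr (1/p)\<close> the left sides are exact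
  powers: \<open>(1 / (x * W)) powr (1/p - 1) = \<phi> powr (1 - p) * x powr (2*p - 2)\<close> and
  \<open>x powr (2*p - 1) = \<phi> powr p * W\<close>. Taking logarithms, the assumption is
  multiplied by the positive numbers \<open>1 - p\<close> and \<open>p\<close>.\<close>

lemma powr_omega_hat_bounds:
  fixes p x W \<eta> :: real
  assumes p: "0 < p" "p < 1" and x: "0 < x" and W: "0 < W" and eta: "0 < \<eta>"
    and le: "x powr (2 - 1/p) / W powr (1/p) \<le> \<eta>"
  shows "(1 / (x * W)) powr (1/p - 1) \<le> \<eta> powr (1 - p) * x powr (2*p - 2)"
    and "x powr (2*p - 1) \<le> \<eta> powr p * W"
proof -
  have le': "x powr (2 - 1/p) \<le> \<eta> * W powr (1/p)" using le W by (simp add: field_simps)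
  have l: "(2 - 1/p) * ln x \<le> ln \<eta> + (1/p) * ln W"
  proof -
    have "ln (x powr (2 - 1/p)) \<le> ln (\<eta> * W powr (1/p))" using le' x W eta by (subst ln_le_cancel_iff) auto
    then show ?thesis using x W eta by (simp add: ln_mult ln_powr)
  qed
  have "p * ((2 - 1/p) * ln x) \<le> p * (ln \<eta> + (1/p) * ln W)" using l p by (intro mult_left_mono) auto
  then have "(2*p - 1) * ln x \<le> p * ln \<eta> + ln W" using p by (simp add: algebra_simps)
  then have "exp ((2*p - 1) * ln x) \<le> exp (p * ln \<eta> + ln W)" by simp
  then show "x powr (2*p - 1) \<le> \<eta> powr p * W" using x W eta by (simp add: powr_def exp_add)
  have "(1-p) * ((2 - 1/p) * ln x) \<le> (1-p) * (ln \<eta> + (1/p) * ln W)" using l p by (intro mult_left_mono) auto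
  then have "(1/p - 1) * (- (ln x + ln W)) \<le> (1-p) * ln \<eta> + (2*p - 2) * ln x"
    using p by (simp add: algebra_simps diff_divide_distrib)
  then have "exp ((1/p - 1) * (- (ln x + ln W))) \<le> exp ((1-p) * ln \<eta> + (2*p - 2) * ln x)" by simp
  then show "(1 / (x * W)) powr (1/p - 1) \<le> \<eta> powr (1 - p) * x powr (2*p - 2)"
    using x W eta by (simp add: powr_def exp_add ln_div ln_mult)
qed

text \<open>The extra power \<open>1/p - 1\<close> of \<open>|G| powr p\<close> is bounded
  pointwise, the remaining \<open>|G| powr p\<close> is kept inside the mean. This produces the
  weight \<open>(1 - \<rho>) powr (2*p - 2)\<close>, whose tails are dominated by those of
  \<open>\<omega>\<close>; because the means increase, tail domination suffices to change weights.
  The powers of \<open>\<eta>\<close> add up to 1 and those of \<open>B\<close> to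
  \<open>1/p\<close>, as homogeneity requires. Of the constant 4, one factor 2 comes from the
  substitution \<open>\<rho> = (1 + r)/2\<close> and one from the polar Jacobian.\<close>

lemma disc_tail_estimate:
  assumes \<omega>: "radial_weight \<omega>" and G: "G holomorphic_on ball 0 1" and p: "1/2 < p" "p < 1"
    and X: "disc_integral p \<omega> G \<le> ennreal B" "0 \<le> B" and R: "1/2 \<le> R" "R < 1" and eta: "0 < \<eta>"
    and phi: "\<And>r. R \<le> r \<Longrightarrow> r < 1 \<Longrightarrow> (1 - r) powr (2 - 1/p) / omega_hat \<omega> r powr (1/p) \<le> \<eta>"
  shows "(\<integral>\<^sup>+z. indicator (ball 0 1 - ball 0 R) z * ennreal (norm (G z)) \<partial>lborel)
     \<le> ennreal (4 * \<eta> / (2*p - 1) * B powr (1/p))"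
proof -
  have p0: "0 < p" using p by simp
  note cG = holomorphic_on_imp_continuous_on[OF G]
  note [measurable] = borel_measurable_radial_density[OF \<omega>] borel_measurable_pmean[OF cG]
  define C where "C = B powr (1/p - 1) * \<eta> powr (1-p)"
  have C0: "0 \<le> C" by (simp add: C_def)
  define h where "h \<rho> = ennreal (C * (1-\<rho>) powr (2*p-2)) * pmean p G \<rho>" for \<rho>
  have [measurable]: "h \<in> borel_measurable borel" unfolding h_def by measurable
  \<comment> \<open>For \<open>\<rho>\<close> midway between \<open>r\<close> and 1 the gap
    \<open>\<rho> - r\<close> equals \<open>1 - \<rho>\<close>, so the growth estimate is expressed
    by \<open>\<rho>\<close> alone and the bound on the quotient applies at
    \<open>\<rho>\<close>.\<close>
  have key: "pmean 1 G r \<le> h ((1 + r)/2)" if r: "R \<le> r" "r < 1" for r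
  proof -
    define \<rho> where "\<rho> = (1+r)/2"
    have \<rho>: "1/2 \<le> \<rho>" "\<rho> < 1" "R \<le> \<rho>" "r < \<rho>" "\<rho> - r = 1 - \<rho>" using r R by (auto simp: \<rho>_def field_simps)
    define W where "W = omega_hat \<omega> \<rho>"
    have W: "W > 0" using omega_hat_pos[OF \<omega>] \<rho> by (simp add: W_def)
    have bd: "(1 / ((1-\<rho>) * W)) powr (1/p - 1) \<le> \<eta> powr (1 - p) * (1-\<rho>) powr (2*p - 2)"
      using phi[of \<rho>] \<rho> W eta p by (intro powr_omega_hat_bounds(1)) (auto simp: W_def)
    have G1: "norm (G z) \<le> C * (1-\<rho>) powr (2*p-2) * norm (G z) powr p" if z: "norm z = r" for z
    proof -
      have "norm (G z) powr p \<le> B / ((\<rho> - norm z) * W)"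
        unfolding W_def using \<rho> z by (intro norm_powr_le_disc_integral[OF \<omega> G p0 X]) auto
      then have "norm (G z) powr p \<le> B * (1 / ((1-\<rho>) * W))" using \<rho> z by simp
      then have "(norm (G z) powr p) powr (1/p - 1) \<le> (B * (1 / ((1-\<rho>) * W))) powr (1/p - 1)"
        using p by (intro powr_mono2) (auto simp: field_simps)
      also have "\<dots> = B powr (1/p - 1) * (1 / ((1-\<rho>) * W)) powr (1/p - 1)"
        by (rule powr_mult)
      also have "\<dots> \<le> B powr (1/p - 1) * (\<eta> powr (1 - p) * (1-\<rho>) powr (2*p - 2))"
        using bd by (intro mult_left_mono) auto
      finally have 1: "(norm (G z) powr p) powr (1/p - 1) \<le> C * (1-\<rho>) powr (2*p - 2)" by (simp add: C_def mult_ac)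
      have "norm (G z) = (norm (G z) powr p) powr (1/p - 1) * norm (G z) powr p"
        using p0 by (cases "G z = 0") (auto simp: powr_powr powr_add[symmetric] algebra_simps)
      also have "\<dots> \<le> C * (1-\<rho>) powr (2*p-2) * norm (G z) powr p" using 1 by (rule mult_right_mono) simp
      finally show ?thesis .
    qed
    have [measurable]: "(\<lambda>t. indicator (ball 0 1) (of_real r * cis t) * ennreal (norm (G (of_real r * cis t)) powr p)) \<in> borel_measurable borel"
      using measurable_compose[OF _ borel_measurable_indicator_norm_powr[OF cG, of p], of "\<lambda>t. of_real r * cis t" borel]
      by simp
    have r0: "0 \<le> r" using r R by simp
    have "pmean 1 G r \<le> (\<integral>\<^sup>+t. ennreal (C * (1-\<rho>) powr (2*p-2)) * (indicator {0..2*pi} t *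
     (indicator (ball 0 1) (of_real r * cis t) * ennreal (norm (G (of_real r * cis t)) powr p))) \<partial>lborel)"
      unfolding pmean_def
    proof (intro nn_integral_mono)
      fix t :: real
      have "ennreal (norm (G (of_real r * cis t)) powr 1) \<le> ennreal (C * (1-\<rho>) powr (2*p-2)) * ennreal (norm (G (of_real r * cis t)) powr p)"
        using G1[of "of_real r * cis t"] r0 C0 by (subst ennreal_mult[symmetric]) (auto simp: norm_mult intro!: ennreal_leI)
      then show "indicator {0..2*pi} t * (indicator (ball 0 1) (of_real r * cis t) * ennreal (norm (G (of_real r * cis t)) powr 1)) \<le>
        ennreal (C * (1-\<rho>) powr (2*p-2)) * (indicator {0..2*pi} t * (indicator (ball 0 1) (of_real r * cis t) * ennreal (norm (G (of_real r * cis t)) powr p)))"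
        by (auto simp: indicator_def)
    qed
    also have "\<dots> = ennreal (C * (1-\<rho>) powr (2*p-2)) * pmean p G r"
      unfolding pmean_def by (rule nn_integral_cmult) measurable
    \<comment> \<open>The mean is moved from \<open>r\<close> to \<open>\<rho>\<close> so that both
      factors depend on \<open>\<rho>\<close> and a linear change of variable finishes.\<close>
    also have "\<dots> \<le> ennreal (C * (1-\<rho>) powr (2*p-2)) * pmean p G \<rho>"
      using r0 \<rho> by (intro mult_left_mono pmean_mono G p0) auto
    finally show ?thesis by (simp add: h_def \<rho>_def)
  qed
  \<comment> \<open>The layer-cake comparison needs a real-valued function; nothing is lost, since
    the means are finite inside the disc.\<close>
  define M where "M \<rho> = enn2real (pmean p G \<rho>)" for \<rho>
  have [measurable]: "M \<in> borel_measurable borel" unfolding M_def by measurable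
  have M: "pmean p G \<rho> = ennreal (M \<rho>)" if "R \<le> \<rho>" "\<rho> < 1" for \<rho>
    using pmean_finite[OF G p0, of \<rho>] that R by (simp add: M_def)
  define K where "K = C * (\<eta> powr p / (2*p - 1))"
  have K0: "0 \<le> K" using C0 p by (simp add: K_def)
  have "(\<integral>\<^sup>+z. indicator (ball 0 1 - ball 0 R) z * ennreal (norm (G z)) \<partial>lborel) =
     (\<integral>\<^sup>+z. indicator (ball 0 1) z * ennreal (norm (G z) powr 1) * indicator {R..<1} (norm z) \<partial>lborel)"
    by (intro nn_integral_cong) (auto simp: indicator_def)
  also have "\<dots> = (\<integral>\<^sup>+r. indicator {0<..<1} r * (ennreal r * (indicator {R..<1} r * pmean 1 G r)) \<partial>lborel)"
    by (intro nn_integral_disc_radial_weight cG) simp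
  also have "\<dots> \<le> (\<integral>\<^sup>+r. indicator {(1+R)/2..<1} (1/2 + 1/2 * r) * h (1/2 + 1/2 * r) \<partial>lborel)"
  proof (intro nn_integral_mono)
    fix r :: real
    show "indicator {0<..<1} r * (ennreal r * (indicator {R..<1} r * pmean 1 G r)) \<le> indicator {(1+R)/2..<1} (1/2 + 1/2 * r) * h (1/2 + 1/2 * r)"
    proof (cases "r \<in> {R..<1}")
      case True
      then have "ennreal r * pmean 1 G r \<le> 1 * h ((1 + r)/2)"
        using R key[of r] by (intro mult_mono) auto
      moreover have "(1 + r)/2 = 1/2 + 1/2 * r" by (simp add: field_simps)
      ultimately show ?thesis using True R by (simp add: indicator_def)
    qed simp
  qed
  also have "\<dots> = 2 * (\<integral>\<^sup>+\<rho>. indicator {(1+R)/2..<1} \<rho> * h \<rho> \<partial>lborel)"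
  proof -
    have "2 * ennreal \<bar>1/2\<bar> = 1" by (subst ennreal_numeral[symmetric], subst ennreal_mult[symmetric]) auto
    then show ?thesis
      by (subst (2) nn_integral_real_affine[where c="1/2" and t="1/2"]) (measurable, simp_all only: mult.assoc[symmetric], auto)
  qed
  also have "\<dots> \<le> 2 * (\<integral>\<^sup>+\<rho>. indicator {R..<1} \<rho> * (ennreal (M \<rho>) * ennreal (C * (1-\<rho>) powr (2*p-2))) \<partial>lborel)"
    using R by (intro mult_left_mono nn_integral_mono) (auto simp: h_def M mult.commute indicator_def)
  also have "(\<integral>\<^sup>+\<rho>. indicator {R..<1} \<rho> * (ennreal (M \<rho>) * ennreal (C * (1-\<rho>) powr (2*p-2))) \<partial>lborel)
     \<le> (\<integral>\<^sup>+\<rho>. indicator {R..<1} \<rho> * (ennreal (M \<rho>) * (ennreal K * radial_density \<omega> \<rho>)) \<partial>lborel)"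
  proof (rule nn_integral_mono_of_tails)
    show "M x \<le> M y" if "R \<le> x" "x \<le> y" "y < 1" for x y
      unfolding M_def using pmean_mono[OF G p0, of x y] pmean_finite[OF G p0, of y] that R by (intro enn2real_mono) auto
    fix r assume r: "R \<le> r" "r < 1"
    have "(\<integral>\<^sup>+x. indicator {r..<1} x * ennreal (C * (1-x) powr (2*p-2)) \<partial>lborel)
      = (\<integral>\<^sup>+x. ennreal C * (indicator {r..<1} x * ennreal ((1-x) powr (2*p-2))) \<partial>lborel)"
      using C0 by (intro nn_integral_cong) (simp add: ennreal_mult mult_ac)
    also have "\<dots> = ennreal C * ennreal ((1 - r) powr (2*p-2 + 1) / (2*p-2 + 1))"
      using p r by (subst nn_integral_cmult) (auto simp: nn_integral_powr_tail)
    also have "\<dots> = ennreal (C * ((1 - r) powr (2*p-1) / (2*p-1)))"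
      using C0 p by (subst ennreal_mult) auto
    also have "\<dots> \<le> ennreal (K * omega_hat \<omega> r)"
    proof (rule ennreal_leI)
      have "(1 - r) powr (2*p-1) \<le> \<eta> powr p * omega_hat \<omega> r"
        using r R p eta phi[of r] omega_hat_pos[OF \<omega>, of r] by (intro powr_omega_hat_bounds(2)) auto
      then have "C * ((1 - r) powr (2*p-1) / (2*p-1)) \<le> C * ((\<eta> powr p * omega_hat \<omega> r) / (2*p-1))"
        using p C0 by (intro mult_left_mono divide_right_mono) auto
      then show "C * ((1 - r) powr (2*p-1) / (2*p-1)) \<le> K * omega_hat \<omega> r" by (simp add: K_def)
    qed
    also have "\<dots> = ennreal K * (\<integral>\<^sup>+x. indicator {r..<1} x * radial_density \<omega> x \<partial>lborel)"
      using r R K0 omega_hat_pos[OF \<omega>, of r] by (subst nn_integral_radial_density[OF \<omega>]) (auto simp: ennreal_mult)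
    also have "\<dots> = (\<integral>\<^sup>+x. indicator {r..<1} x * (ennreal K * radial_density \<omega> x) \<partial>lborel)"
      by (subst nn_integral_cmult[symmetric]) (auto simp: mult_ac)
    finally show "(\<integral>\<^sup>+x. indicator {r..<1} x * ennreal (C * (1-x) powr (2*p-2)) \<partial>lborel)
       \<le> (\<integral>\<^sup>+x. indicator {r..<1} x * (ennreal K * radial_density \<omega> x) \<partial>lborel)" .
  qed (auto simp: M_def)
  also have "(\<integral>\<^sup>+\<rho>. indicator {R..<1} \<rho> * (ennreal (M \<rho>) * (ennreal K * radial_density \<omega> \<rho>)) \<partial>lborel)
     = (\<integral>\<^sup>+\<rho>. ennreal K * (indicator {R..<1} \<rho> * (pmean p G \<rho> * radial_density \<omega> \<rho>)) \<partial>lborel)"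
    by (intro nn_integral_cong) (auto simp: M indicator_def mult_ac)
  also have "\<dots> = ennreal K * (\<integral>\<^sup>+\<rho>. indicator {R..<1} \<rho> * (pmean p G \<rho> * radial_density \<omega> \<rho>) \<partial>lborel)"
    by (rule nn_integral_cmult) measurable
  also have "\<dots> \<le> ennreal K * (2 * ennreal B)"
  proof (rule mult_left_mono)
    show "(\<integral>\<^sup>+\<rho>. indicator {R..<1} \<rho> * (pmean p G \<rho> * radial_density \<omega> \<rho>) \<partial>lborel) \<le> 2 * ennreal B"
      using radial_integral_le_disc_integral[OF \<omega> G R(1), of p] mult_left_mono[OF X(1), of 2] by simp
  qed simp
  also have "2 * (ennreal K * (2 * ennreal B)) = ennreal (2 * (K * (2 * B)))"
    by (simp only: ennreal_mult K0 X(2) mult_nonneg_nonneg zero_le_numeral ennreal_numeral)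
  also have "2 * (K * (2 * B)) = 4 * \<eta> / (2*p - 1) * B powr (1/p)"
  proof -
    have "B powr (1/p - 1) * B = B powr (1/p)"
      using X(2) p0 by (cases "B = 0") (auto simp: powr_diff)
    moreover have "\<eta> powr (1 - p) * \<eta> powr p = \<eta>" using eta by (simp add: powr_add[symmetric])
    ultimately show ?thesis by (simp add: K_def C_def) (metis (no_types, opaque_lifting) mult.assoc mult.commute)
  qed
  finally show ?thesis by (auto simp: mult_left_mono)
qed

section \<open>Compactness of the identity\<close>

lemma Dnorm_pow_eq: "Dnorm_pow p \<omega> f = disc_integral p \<omega> (deriv f) / ennreal pi + ennreal (norm (f 0) powr p)"
  by (simp add: Dnorm_pow_def disc_integral_def)

lemma disc_integral_1_1: "disc_integral 1 (\<lambda>_. 1) G = (\<integral>\<^sup>+z. indicator (ball 0 1) z * ennreal (norm (G z)) \<partial>lborel)"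
  by (simp add: disc_integral_def)

text \<open>The bound \<open>M\<close> in the compactness definitions is an arbitrary real and
  \<open>ennreal\<close> sends negative numbers to 0, hence \<open>max 0 M\<close>.\<close>

lemma disc_integral_le_of_Dnorm_pow_le:
  assumes "Dnorm_pow p \<omega> f \<le> ennreal M"
  shows "disc_integral p \<omega> (deriv f) \<le> ennreal (pi * max 0 M)" "norm (f 0) powr p \<le> max 0 M"
proof -
  have M: "ennreal M = ennreal (max 0 M)" by (simp add: max_def ennreal_neg)
  have "disc_integral p \<omega> (deriv f) / ennreal pi \<le> Dnorm_pow p \<omega> f"
    unfolding Dnorm_pow_eq by (rule add_increasing2) auto
  also note assms[unfolded M]
  finally have "ennreal pi * (disc_integral p \<omega> (deriv f) / ennreal pi) \<le> ennreal pi * ennreal (max 0 M)"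
    by (rule mult_left_mono) simp
  moreover have "ennreal pi * (disc_integral p \<omega> (deriv f) / ennreal pi) = disc_integral p \<omega> (deriv f)"
    by (simp add: ennreal_times_divide mult.commute[of "ennreal pi"] mult_divide_eq_ennreal)
  ultimately show "disc_integral p \<omega> (deriv f) \<le> ennreal (pi * max 0 M)"
    by (simp add: ennreal_mult)
  have "ennreal (norm (f 0) powr p) \<le> Dnorm_pow p \<omega> f"
    unfolding Dnorm_pow_eq by (rule add_increasing) auto
  also note assms[unfolded M]
  finally show "norm (f 0) powr p \<le> max 0 M" by (simp add: ennreal_le_iff)
qed

section \<open>Consequences of the quotient tending to 0\<close>

definition phi_quot :: "real \<Rightarrow> (real \<Rightarrow> real) \<Rightarrow> real \<Rightarrow> real" where
  "phi_quot p \<omega> r = (1 - r) powr (2 - 1 / p) / omega_hat \<omega> r powr (1 / p)"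

lemma phi_quot_nonneg: "0 \<le> phi_quot p \<omega> r"
  by (simp add: phi_quot_def)

text \<open>For \<open>p \<le> 1/2\<close> the exponent \<open>2 - 1/p\<close> is not positive, so
  the numerator is at least 1, while the denominator is at most its value at 0: the quotient stays
  away from 0.\<close>

lemma half_less_p_of_phi_quot_tendsto_0:
  assumes \<omega>: "radial_weight \<omega>" and p: "0 < p" and lim: "(phi_quot p \<omega> \<longlongrightarrow> 0) (at_left 1)"
  shows "1/2 < p"
proof (rule ccontr)
  assume "\<not> 1/2 < p"
  then have e: "2 - 1/p \<le> 0" using p by (simp add: field_simps)
  define c where "c = 1 / omega_hat \<omega> 0 powr (1/p)"
  have W0: "omega_hat \<omega> 0 > 0" using omega_hat_pos[OF \<omega>] by simp
  have "c > 0" using W0 by (simp add: c_def)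
  then have "eventually (\<lambda>r. phi_quot p \<omega> r < c) (at_left 1)" using lim by (rule order_tendstoD(2)[rotated])
  moreover have "eventually (\<lambda>r. 0 < r \<and> r < 1) (at_left (1::real))"
    using eventually_at_left_real[of 0 1] by simp
  ultimately have "eventually (\<lambda>r::real. False) (at_left 1)"
  proof eventually_elim
    case (elim r)
    have W: "omega_hat \<omega> r > 0" "omega_hat \<omega> r \<le> omega_hat \<omega> 0"
      using omega_hat_pos[OF \<omega>, of r] omega_hat_antimono[OF \<omega>, of 0 r] elim by auto
    have "1 powr (2 - 1/p) \<le> (1 - r) powr (2 - 1/p)" using e elim by (intro powr_mono2') auto
    moreover have "omega_hat \<omega> r powr (1/p) \<le> omega_hat \<omega> 0 powr (1/p)" using W p by (intro powr_mono2) auto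
    ultimately have "c \<le> phi_quot p \<omega> r" unfolding c_def phi_quot_def using W W0 by (intro frac_le) auto
    then show ?case using elim by simp
  qed
  then show False by (simp add: trivial_limit_at_left_real)
qed

lemma uniform_disc_tail:
  assumes \<omega>: "radial_weight \<omega>" and p: "0 < p" "p < 1" and lim: "(phi_quot p \<omega> \<longlongrightarrow> 0) (at_left 1)"
    and B: "0 \<le> B" and e: "0 < e"
  obtains R where "1/2 \<le> R" "R < 1"
    "\<And>G. G holomorphic_on ball 0 1 \<Longrightarrow> disc_integral p \<omega> G \<le> ennreal B \<Longrightarrow>
       (\<integral>\<^sup>+z. indicator (ball 0 1 - ball 0 R) z * ennreal (norm (G z)) \<partial>lborel) \<le> ennreal e"
proof -
  have p': "1/2 < p" by (rule half_less_p_of_phi_quot_tendsto_0[OF \<omega> p(1) lim])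
  \<comment> \<open>The tail estimate is solved for \<open>\<eta>\<close>; the added 1 keeps the
    denominator positive when \<open>B = 0\<close>.\<close>
  define \<eta> where "\<eta> = e * (2*p - 1) / (4 * (B powr (1/p) + 1))"
  have Bp: "B powr (1/p) + 1 > 0" by (simp add: add_nonneg_pos)
  have eta: "\<eta> > 0" unfolding \<eta>_def using e p' Bp by (intro divide_pos_pos mult_pos_pos) auto
  have "eventually (\<lambda>r. phi_quot p \<omega> r < \<eta>) (at_left 1)" using lim eta by (rule order_tendstoD(2))
  then obtain b where b: "b < 1" "\<And>r. b < r \<Longrightarrow> r < 1 \<Longrightarrow> phi_quot p \<omega> r < \<eta>"
    unfolding eventually_at_left_field by blast
  define R where "R = max (1/2) ((1+b)/2)"
  have R: "1/2 \<le> R" "R < 1" "b < R" using b by (auto simp: R_def less_max_iff_disj)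
  show thesis
  proof (rule that[OF R(1,2)])
    fix G assume G: "G holomorphic_on ball 0 1" "disc_integral p \<omega> G \<le> ennreal B"
    have "(\<integral>\<^sup>+z. indicator (ball 0 1 - ball 0 R) z * ennreal (norm (G z)) \<partial>lborel)
       \<le> ennreal (4 * \<eta> / (2*p - 1) * B powr (1/p))"
    proof (rule disc_tail_estimate[OF \<omega> G(1) p' p(2) G(2) B R(1,2) eta])
      show "(1 - r) powr (2 - 1/p) / omega_hat \<omega> r powr (1/p) \<le> \<eta>" if "R \<le> r" "r < 1" for r
        using b(2)[of r] R that by (simp add: phi_quot_def)
    qed
    also have "4 * \<eta> / (2*p - 1) * B powr (1/p) \<le> e"
    proof -
      have "4 * \<eta> / (2*p - 1) = e / (B powr (1/p) + 1)" using p' Bp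
        by (simp add: \<eta>_def) (simp add: divide_simps)
      then have "4 * \<eta> / (2*p - 1) * B powr (1/p) = e * (B powr (1/p) / (B powr (1/p) + 1))" by simp
      also have "\<dots> \<le> e * 1" using e Bp by (intro mult_left_mono) auto
      finally show ?thesis by simp
    qed
    finally show "(\<integral>\<^sup>+z. indicator (ball 0 1 - ball 0 R) z * ennreal (norm (G z)) \<partial>lborel) \<le> ennreal e"
      by (simp add: ennreal_leI)
  qed
qed

lemma local_bound_of_disc_integral:
  assumes \<omega>: "radial_weight \<omega>" and p: "0 < p" and B: "0 \<le> B" and R: "R < 1"
  obtains K where "0 \<le> K"
    "\<And>G z. G holomorphic_on ball 0 1 \<Longrightarrow> disc_integral p \<omega> G \<le> ennreal B \<Longrightarrow> norm z \<le> R \<Longrightarrow> norm (G z) \<le> K"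
proof -
  define s where "s = max (1/2) ((1 + R)/2)"
  have s: "1/2 \<le> s" "s < 1" "R < s" using R by (auto simp: s_def less_max_iff_disj)
  have W: "omega_hat \<omega> s > 0" using omega_hat_pos[OF \<omega>, of s] s by simp
  show thesis
  proof (rule that[of "(B / ((s - R) * omega_hat \<omega> s)) powr (1/p)"])
    fix G z assume G: "G holomorphic_on ball 0 1" "disc_integral p \<omega> G \<le> ennreal B" and z: "norm (z::complex) \<le> R"
    have "norm (G z) powr p \<le> B / ((s - norm z) * omega_hat \<omega> s)"
      using z s by (intro norm_powr_le_disc_integral[OF \<omega> G(1) p G(2) B]) auto
    also have "\<dots> \<le> B / ((s - R) * omega_hat \<omega> s)"
      using z s W B by (intro divide_left_mono mult_right_mono mult_pos_pos) auto
    finally have "(norm (G z) powr p) powr (1/p) \<le> (B / ((s - R) * omega_hat \<omega> s)) powr (1/p)"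
      using p by (intro powr_mono2) auto
    then show "norm (G z) \<le> (B / ((s - R) * omega_hat \<omega> s)) powr (1/p)" using p by (simp add: powr_powr)
  qed simp
qed

lemma borel_measurable_indicator_norm:
  assumes "continuous_on (ball 0 1) G" "S \<in> sets borel" "S \<subseteq> ball 0 1"
  shows "(\<lambda>z::complex. indicator S z * ennreal (norm (G z :: complex))) \<in> borel_measurable borel"
proof -
  have "(\<lambda>z. indicator S z * (indicator (ball 0 1) z * ennreal (norm (G z) powr 1))) \<in> borel_measurable borel"
    using assms(2) by (intro borel_measurable_times_ennreal borel_measurable_indicator borel_measurable_indicator_norm_powr[OF assms(1)])
  also have "(\<lambda>z. indicator S z * (indicator (ball 0 1) z * ennreal (norm (G z) powr 1))) = (\<lambda>z. indicator S z * ennreal (norm (G z)))"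
    using assms(3) by (auto simp: indicator_def fun_eq_iff)
  finally show ?thesis .
qed

lemma nn_integral_disc_split:
  fixes G :: "complex \<Rightarrow> complex"
  assumes "continuous_on (ball 0 1) G" "R \<le> 1"
  shows "(\<integral>\<^sup>+z. indicator (ball 0 1) z * ennreal (norm (G z)) \<partial>lborel) =
    (\<integral>\<^sup>+z. indicator (ball 0 R) z * ennreal (norm (G z)) \<partial>lborel) +
    (\<integral>\<^sup>+z. indicator (ball 0 1 - ball 0 R) z * ennreal (norm (G z)) \<partial>lborel)"
proof -
  have "(\<integral>\<^sup>+z. indicator (ball 0 1) z * ennreal (norm (G z)) \<partial>lborel) =
    (\<integral>\<^sup>+z. indicator (ball 0 R) z * ennreal (norm (G z)) + indicator (ball 0 1 - ball 0 R) z * ennreal (norm (G z)) \<partial>lborel)"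
    using assms(2) by (intro nn_integral_cong) (auto simp: indicator_def)
  also have "\<dots> = (\<integral>\<^sup>+z. indicator (ball 0 R) z * ennreal (norm (G z)) \<partial>lborel) +
    (\<integral>\<^sup>+z. indicator (ball 0 1 - ball 0 R) z * ennreal (norm (G z)) \<partial>lborel)"
    using assms borel_measurable_indicator_norm[OF assms(1), of "ball 0 R"]
      borel_measurable_indicator_norm[OF assms(1), of "ball 0 1 - ball 0 R"]
    by (intro nn_integral_add) (auto simp: subset_ball)
  finally show ?thesis .
qed

text \<open>A smaller disc is handled by the pointwise bound, the rest by the tail estimate with
  \<open>e = 1\<close>. This is boundedness of the identity, needed both for the inclusion of the
  spaces and for the limit function.\<close>

lemma uniform_disc_integral_bound:
  assumes \<omega>: "radial_weight \<omega>" and p: "0 < p" "p < 1" and lim: "(phi_quot p \<omega> \<longlongrightarrow> 0) (at_left 1)"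
    and B: "0 \<le> B"
  obtains L where "\<And>G. G holomorphic_on ball 0 1 \<Longrightarrow> disc_integral p \<omega> G \<le> ennreal B \<Longrightarrow>
     disc_integral 1 (\<lambda>_. 1) G \<le> ennreal L"
proof -
  obtain R where R: "1/2 \<le> R" "R < 1" and tail:
    "\<And>G. G holomorphic_on ball 0 1 \<Longrightarrow> disc_integral p \<omega> G \<le> ennreal B \<Longrightarrow>
       (\<integral>\<^sup>+z. indicator (ball 0 1 - ball 0 R) z * ennreal (norm (G z)) \<partial>lborel) \<le> ennreal 1"
    using uniform_disc_tail[OF \<omega> p lim B zero_less_one] by metis
  obtain K where K: "0 \<le> K"
    "\<And>G z. G holomorphic_on ball 0 1 \<Longrightarrow> disc_integral p \<omega> G \<le> ennreal B \<Longrightarrow> norm z \<le> R \<Longrightarrow> norm (G z) \<le> K"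
    using local_bound_of_disc_integral[OF \<omega> p(1) B R(2)] by metis
  have fin: "emeasure lborel (ball 0 R :: complex set) < \<infinity>" using emeasure_bounded_finite by blast
  define m where "m = measure lborel (ball 0 R :: complex set)"
  have m: "emeasure lborel (ball 0 R :: complex set) = ennreal m"
    unfolding m_def using fin by (intro emeasure_eq_ennreal_measure) auto
  show thesis
  proof (rule that[of "K * m + 1"])
    fix G assume G: "G holomorphic_on ball 0 1" "disc_integral p \<omega> G \<le> ennreal B"
    have "(\<integral>\<^sup>+z. indicator (ball 0 R) z * ennreal (norm (G z)) \<partial>lborel) \<le> (\<integral>\<^sup>+z. ennreal K * indicator (ball 0 R :: complex set) z \<partial>lborel)"
      using K(2)[OF G] by (intro nn_integral_mono) (auto simp: indicator_def intro!: ennreal_leI)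
    also have "\<dots> = ennreal (K * m)" using m K(1) by (simp add: nn_integral_cmult_indicator ennreal_mult m_def)
    finally have "(\<integral>\<^sup>+z. indicator (ball 0 R) z * ennreal (norm (G z)) \<partial>lborel) \<le> ennreal (K * m)" .
    then have "disc_integral 1 (\<lambda>_. 1) G \<le> ennreal (K * m) + ennreal 1"
      unfolding disc_integral_1_1 using tail[OF G] R(2) holomorphic_on_imp_continuous_on[OF G(1)]
      by (subst nn_integral_disc_split[of _ R]) (auto intro!: add_mono)
    also have "\<dots> = ennreal (K * m + 1)" using K(1) by (simp add: m_def)
    finally show "disc_integral 1 (\<lambda>_. 1) G \<le> ennreal (K * m + 1)" .
  qed
qed

text \<open>Fatou's lemma. It hands the tail bounds and the norm bound of a sequence on to its
  Montel limit.\<close>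

lemma nn_integral_norm_le_of_pointwise_limit:
  fixes G :: "nat \<Rightarrow> complex \<Rightarrow> complex"
  assumes G: "\<And>n. continuous_on (ball 0 1) (G n)" and S: "S \<in> sets borel" "S \<subseteq> ball 0 1"
    and lim: "\<And>z. norm z < 1 \<Longrightarrow> (\<lambda>n. G n z) \<longlonglongrightarrow> H z"
    and le: "\<And>n. (\<integral>\<^sup>+z. indicator S z * ennreal (norm (G n z)) \<partial>lborel) \<le> C"
  shows "(\<integral>\<^sup>+z. indicator S z * ennreal (norm (H z)) \<partial>lborel) \<le> C"
proof -
  have "(\<integral>\<^sup>+z. indicator S z * ennreal (norm (H z)) \<partial>lborel) =
     (\<integral>\<^sup>+z. liminf (\<lambda>n. indicator S z * ennreal (norm (G n z))) \<partial>lborel)"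
  proof (intro nn_integral_cong)
    fix z :: complex
    have "(\<lambda>n. indicator S z * ennreal (norm (G n z))) \<longlonglongrightarrow> indicator S z * ennreal (norm (H z))"
    proof (cases "z \<in> S")
      case True
      then have "(\<lambda>n. ennreal (norm (G n z))) \<longlonglongrightarrow> ennreal (norm (H z))"
        using S by (intro tendsto_ennrealI tendsto_norm lim) auto
      then show ?thesis using True by simp
    qed simp
    then show "indicator S z * ennreal (norm (H z)) = liminf (\<lambda>n. indicator S z * ennreal (norm (G n z)))"
      by (simp add: lim_imp_Liminf)
  qed
  also have "\<dots> \<le> liminf (\<lambda>n. \<integral>\<^sup>+z. indicator S z * ennreal (norm (G n z)) \<partial>lborel)"
    using borel_measurable_indicator_norm[OF G S] by (intro nn_integral_liminf) simp
  also have "\<dots> \<le> C" using le by (intro Liminf_le) (auto simp: always_eventually)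
  finally show ?thesis .
qed

lemma Dnorm_pow_finite:
  assumes "disc_integral p \<omega> (deriv f) < \<infinity>"
  shows "Dnorm_pow p \<omega> f < \<infinity>"
  using assms unfolding Dnorm_pow_eq divide_ennreal_def
  by (simp add: ennreal_mult_less_top inverse_ennreal)

lemma Dspace_subset_D10:
  assumes \<omega>: "radial_weight \<omega>" and p: "0 < p" "p < 1" and lim: "(phi_quot p \<omega> \<longlongrightarrow> 0) (at_left 1)"
  shows "Dspace p \<omega> \<subseteq> D10"
proof
  fix f assume "f \<in> Dspace p \<omega>"
  then have f: "f holomorphic_on ball 0 1" "Dnorm_pow p \<omega> f < \<infinity>" by (auto simp: Dspace_def)
  define M where "M = enn2real (Dnorm_pow p \<omega> f)"
  have "Dnorm_pow p \<omega> f \<le> ennreal M" using f(2) by (simp add: M_def)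
  from disc_integral_le_of_Dnorm_pow_le(1)[OF this]
  have "disc_integral p \<omega> (deriv f) \<le> ennreal (pi * max 0 M)" .
  moreover obtain L where "\<And>G. G holomorphic_on ball 0 1 \<Longrightarrow> disc_integral p \<omega> G \<le> ennreal (pi * max 0 M) \<Longrightarrow>
     disc_integral 1 (\<lambda>_. 1) G \<le> ennreal L"
    using uniform_disc_integral_bound[OF \<omega> p lim, of "pi * max 0 M"] by (metis max.cobounded1 mult_nonneg_nonneg pi_ge_zero)
  ultimately have "disc_integral 1 (\<lambda>_. 1) (deriv f) \<le> ennreal L"
    using holomorphic_deriv[OF f(1)] by simp
  then have "disc_integral 1 (\<lambda>_. 1) (deriv f) < \<infinity>" by (rule le_less_trans) simp
  then have "Dnorm_pow 1 (\<lambda>_. 1) f < \<infinity>"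
    by (rule Dnorm_pow_finite)
  then show "f \<in> D10" using f(1) by (simp add: Dspace_def)
qed

lemma tendsto_ennreal_divide_const_0:
  fixes a :: "nat \<Rightarrow> ennreal"
  assumes "a \<longlonglongrightarrow> 0" "0 < c"
  shows "(\<lambda>n. a n / ennreal c) \<longlonglongrightarrow> 0"
proof -
  have "(\<lambda>n. inverse (ennreal c) * a n) \<longlonglongrightarrow> inverse (ennreal c) * 0"
    using assms by (intro ennreal_tendsto_cmult) (auto simp: less_top[symmetric])
  then show ?thesis by (simp add: divide_ennreal_def mult.commute)
qed

text \<open>A form of Vitali's theorem: the derivatives need not have an integrable majorant on the
  whole disc, but uniformly small tails reduce the matter to a smaller disc, where the local bound
  is a majorant for dominated convergence.\<close>

lemma D10_convergence:
  assumes F: "\<And>n. F n holomorphic_on ball 0 1" and h: "h holomorphic_on ball 0 1"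
    and lim0: "(\<lambda>n. F n 0) \<longlonglongrightarrow> h 0"
    and lim: "\<And>z. norm z < 1 \<Longrightarrow> (\<lambda>n. deriv (F n) z) \<longlonglongrightarrow> deriv h z"
    and locbd: "\<And>R. R < 1 \<Longrightarrow> \<exists>K\<ge>0. \<forall>n z. norm z \<le> R \<longrightarrow> norm (deriv (F n) z) \<le> K"
    and tail: "\<And>e. 0 < e \<Longrightarrow> \<exists>R. R < 1 \<and> (\<forall>n. (\<integral>\<^sup>+z. indicator (ball 0 1 - ball 0 R) z * ennreal (norm (deriv (F n) z)) \<partial>lborel) \<le> ennreal e)"
  shows "(\<lambda>n. Dnorm_pow 1 (\<lambda>_. 1) (\<lambda>z. F n z - h z)) \<longlonglongrightarrow> 0"
proof -
  define G where "G n z = deriv (F n) z - deriv h z" for n z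
  have dF: "continuous_on (ball 0 1) (deriv (F n))" for n
    using F by (intro holomorphic_on_imp_continuous_on holomorphic_deriv) auto
  have dh: "continuous_on (ball 0 1) (deriv h)"
    using h by (intro holomorphic_on_imp_continuous_on holomorphic_deriv) auto
  have cG: "continuous_on (ball 0 1) (G n)" for n
    unfolding G_def using dF dh by (intro continuous_intros)
  have dd: "deriv (\<lambda>z. F n z - h z) z = G n z" if "norm z < 1" for n z
    unfolding G_def using that F[of n] h
    by (intro deriv_diff) (auto simp: holomorphic_on_open field_differentiable_def)
  have "(\<lambda>n. disc_integral 1 (\<lambda>_. 1) (deriv (\<lambda>z. F n z - h z))) \<longlonglongrightarrow> 0"
  proof (rule tendsto_zero_ennreal)
    fix e :: real assume e: "0 < e"
    \<comment> \<open>The tails of \<open>F n\<close> and of \<open>h\<close> get \<open>e/4\<close>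
      each, which leaves \<open>e/2\<close> for the inner disc.\<close>
    obtain R where R: "R < 1" and tF: "\<And>n. (\<integral>\<^sup>+z. indicator (ball 0 1 - ball 0 R) z * ennreal (norm (deriv (F n) z)) \<partial>lborel) \<le> ennreal (e/4)"
      using tail[of "e/4"] e by auto
    have m: "(\<lambda>z. indicator (ball 0 1 - ball 0 R) z * ennreal (norm (deriv (F n) z))) \<in> borel_measurable borel"
       "(\<lambda>z. indicator (ball 0 1 - ball 0 R) z * ennreal (norm (deriv h z))) \<in> borel_measurable borel" for n
      using dF dh by (auto intro!: borel_measurable_indicator_norm)
    have th: "(\<integral>\<^sup>+z. indicator (ball 0 1 - ball 0 R) z * ennreal (norm (deriv h z)) \<partial>lborel) \<le> ennreal (e/4)"
      by (rule nn_integral_norm_le_of_pointwise_limit[where G="\<lambda>n. deriv (F n)"]) (use dF lim tF in auto)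
    have tG: "(\<integral>\<^sup>+z. indicator (ball 0 1 - ball 0 R) z * ennreal (norm (G n z)) \<partial>lborel) \<le> ennreal (e/2)" for n
    proof -
      have "(\<integral>\<^sup>+z. indicator (ball 0 1 - ball 0 R) z * ennreal (norm (G n z)) \<partial>lborel) \<le>
        (\<integral>\<^sup>+z. indicator (ball 0 1 - ball 0 R) z * ennreal (norm (deriv (F n) z)) + indicator (ball 0 1 - ball 0 R) z * ennreal (norm (deriv h z)) \<partial>lborel)"
        unfolding G_def by (intro nn_integral_mono) (auto simp: indicator_def ennreal_plus[symmetric] norm_triangle_ineq4 intro!: ennreal_leI simp del: ennreal_plus)
      also have "\<dots> = (\<integral>\<^sup>+z. indicator (ball 0 1 - ball 0 R) z * ennreal (norm (deriv (F n) z)) \<partial>lborel) +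
          (\<integral>\<^sup>+z. indicator (ball 0 1 - ball 0 R) z * ennreal (norm (deriv h z)) \<partial>lborel)"
        using m by (intro nn_integral_add) auto
      also have "\<dots> \<le> ennreal (e/4) + ennreal (e/4)" by (intro add_mono tF th)
      also have "\<dots> = ennreal (e/2)" using e by (subst ennreal_plus[symmetric]) auto
      finally show ?thesis .
    qed
    obtain K where K: "0 \<le> K" "\<And>n z. norm z \<le> R \<Longrightarrow> norm (deriv (F n) z) \<le> K" using locbd[OF R] by blast
    have Kh: "norm (deriv h z) \<le> K" if "norm z \<le> R" for z
      using that R K(2) by (intro tendsto_upperbound[OF tendsto_norm[OF lim[of z]]]) auto
    have fin: "emeasure lborel (ball 0 R :: complex set) < \<infinity>" using emeasure_bounded_finite by blast
    have "(\<lambda>n. \<integral>\<^sup>+z. indicator (ball 0 R) z * ennreal (norm (G n z)) \<partial>lborel) \<longlonglongrightarrow> (\<integral>\<^sup>+z. 0 \<partial>(lborel :: complex measure))"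
    proof (rule nn_integral_dominated_convergence[where w="\<lambda>z. ennreal (2*K) * indicator (ball 0 R) z"])
      show "(\<lambda>z. indicator (ball 0 R) z * ennreal (norm (G n z))) \<in> borel_measurable lborel" for n
        using borel_measurable_indicator_norm[OF cG[of n], of "ball 0 R"] R by (simp add: subset_ball)
      show "(\<integral>\<^sup>+z. ennreal (2*K) * indicator (ball 0 R :: complex set) z \<partial>lborel) < \<infinity>"
        using fin by (simp add: nn_integral_cmult_indicator ennreal_mult_less_top)
      show "AE z in lborel. indicator (ball 0 R) z * ennreal (norm (G n z)) \<le> ennreal (2*K) * indicator (ball 0 R) z" for n
      proof (rule AE_I2)
        fix z
        have "norm (G n z) \<le> 2*K" if "norm z < R"
          using norm_triangle_ineq4[of "deriv (F n) z" "deriv h z"] K(2)[of z n] Kh[of z] that by (simp add: G_def)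
        then show "indicator (ball 0 R) z * ennreal (norm (G n z)) \<le> ennreal (2*K) * indicator (ball 0 R) z"
          by (auto simp: indicator_def intro!: ennreal_leI)
      qed
      show "AE z in lborel. (\<lambda>n. indicator (ball 0 R) z * ennreal (norm (G n z))) \<longlonglongrightarrow> 0"
      proof (rule AE_I2)
        fix z
        show "(\<lambda>n. indicator (ball 0 R) z * ennreal (norm (G n z))) \<longlonglongrightarrow> 0"
        proof (cases "norm z < R")
          case True
          then have "(\<lambda>n. deriv (F n) z - deriv h z) \<longlonglongrightarrow> deriv h z - deriv h z" using R by (intro tendsto_intros lim) auto
          then have "(\<lambda>n. norm (G n z)) \<longlonglongrightarrow> 0" by (simp add: G_def tendsto_norm_zero)
          then have "(\<lambda>n. ennreal (norm (G n z))) \<longlonglongrightarrow> ennreal 0" by (rule tendsto_ennrealI)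
          then show ?thesis using True by simp
        qed simp
      qed
      show "(\<lambda>z::complex. ennreal (2*K) * indicator (ball 0 R) z) \<in> borel_measurable lborel"
        by (intro borel_measurable_times_ennreal borel_measurable_indicator) auto
    qed auto
    then have "(\<lambda>n. \<integral>\<^sup>+z. indicator (ball 0 R) z * ennreal (norm (G n z)) \<partial>lborel) \<longlonglongrightarrow> 0" by simp
    then have "eventually (\<lambda>n. (\<integral>\<^sup>+z. indicator (ball 0 R) z * ennreal (norm (G n z)) \<partial>lborel) < ennreal (e/2)) sequentially"
      using e by (intro order_tendstoD(2)) auto
    then show "eventually (\<lambda>n. disc_integral 1 (\<lambda>_. 1) (deriv (\<lambda>z. F n z - h z)) < ennreal e) sequentially"
    proof eventually_elim
      case (elim n)
      have "disc_integral 1 (\<lambda>_. 1) (deriv (\<lambda>z. F n z - h z)) = (\<integral>\<^sup>+z. indicator (ball 0 1) z * ennreal (norm (G n z)) \<partial>lborel)"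
        unfolding disc_integral_1_1 by (intro nn_integral_cong) (auto simp: indicator_def dd)
      also have "\<dots> = (\<integral>\<^sup>+z. indicator (ball 0 R) z * ennreal (norm (G n z)) \<partial>lborel) +
          (\<integral>\<^sup>+z. indicator (ball 0 1 - ball 0 R) z * ennreal (norm (G n z)) \<partial>lborel)"
        using R by (intro nn_integral_disc_split cG) auto
      also have "\<dots> \<le> ennreal (e/2) + (\<integral>\<^sup>+z. indicator (ball 0 R) z * ennreal (norm (G n z)) \<partial>lborel)"
        using tG[of n] by (subst add.commute) (rule add_right_mono)
      also have "\<dots> < ennreal (e/2) + ennreal (e/2)"
        using elim by (simp add: ennreal_add_left_cancel_less)
      also have "\<dots> = ennreal e" using e by (subst ennreal_plus[symmetric]) auto
      finally show ?case .
    qed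
  qed
  then have "(\<lambda>n. disc_integral 1 (\<lambda>_. 1) (deriv (\<lambda>z. F n z - h z)) / ennreal pi) \<longlonglongrightarrow> 0"
    by (rule tendsto_ennreal_divide_const_0) simp
  moreover have "(\<lambda>n. ennreal (norm (F n 0 - h 0) powr 1)) \<longlonglongrightarrow> 0"
  proof -
    have "(\<lambda>n. norm (F n 0 - h 0)) \<longlonglongrightarrow> 0" using lim0 by (simp add: LIM_zero tendsto_norm_zero)
    then have "(\<lambda>n. ennreal (norm (F n 0 - h 0))) \<longlonglongrightarrow> ennreal 0" by (rule tendsto_ennrealI)
    then show ?thesis by simp
  qed
  ultimately have "(\<lambda>n. disc_integral 1 (\<lambda>_. 1) (deriv (\<lambda>z. F n z - h z)) / ennreal pi + ennreal (norm (F n 0 - h 0) powr 1)) \<longlonglongrightarrow> 0 + 0"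
    by (rule tendsto_add)
  then show ?thesis by (simp add: Dnorm_pow_eq)
qed

theorem identity_compact_D10_of_phi_quot_tendsto_0:
  assumes \<omega>: "radial_weight \<omega>" and p: "0 < p" "p < 1" and lim: "(phi_quot p \<omega> \<longlongrightarrow> 0) (at_left 1)"
  shows "identity_compact_D10 p \<omega>"
  unfolding identity_compact_D10_def
proof (intro conjI allI impI)
  show "Dspace p \<omega> \<subseteq> D10" by (rule Dspace_subset_D10[OF assms])
  fix F :: "nat \<Rightarrow> complex \<Rightarrow> complex" and M :: real
  assume "\<forall>n. F n \<in> Dspace p \<omega> \<and> Dnorm_pow p \<omega> (F n) \<le> ennreal M"
  then have F: "F n holomorphic_on ball 0 1" "Dnorm_pow p \<omega> (F n) \<le> ennreal M" for n
    by (auto simp: Dspace_def)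
  define B where "B = pi * max 0 M"
  have B: "0 \<le> B" by (simp add: B_def)
  have dF: "deriv (F n) holomorphic_on ball 0 1" for n using F(1) by (intro holomorphic_deriv) auto
  have XF: "disc_integral p \<omega> (deriv (F n)) \<le> ennreal B" for n
    unfolding B_def by (rule disc_integral_le_of_Dnorm_pow_le(1)[OF F(2)])
  have F0: "norm (F n 0) \<le> (max 0 M) powr (1/p)" for n
  proof -
    have "(norm (F n 0) powr p) powr (1/p) \<le> (max 0 M) powr (1/p)"
      using disc_integral_le_of_Dnorm_pow_le(2)[OF F(2)[of n]] p by (intro powr_mono2) auto
    then show ?thesis using p by (simp add: powr_powr)
  qed
  have locbd: "\<exists>K\<ge>0. \<forall>n z. norm z \<le> R \<longrightarrow> norm (deriv (F n) z) \<le> K" if "R < 1" for R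
    using local_bound_of_disc_integral[OF \<omega> p(1) B that] dF XF by metis
  \<comment> \<open>Montel's theorem asks for bounds on the functions, whereas the disc integral
    controls derivatives. The value at 0 is bounded by the norm, and the derivative bound extends
    this to a disc containing \<open>K\<close>.\<close>
  have bdd: "\<exists>C. \<forall>f\<in>range F. \<forall>z\<in>K. norm (f z) \<le> C" if K: "compact K" "K \<subseteq> ball 0 1" for K
  proof -
    obtain R where R: "R < 1" "K \<subseteq> cball 0 R"
    proof (cases "K = {}")
      case False
      obtain x where x: "x \<in> K" "\<forall>y\<in>K. norm y \<le> norm x"
        using continuous_attains_sup[OF K(1) False continuous_on_norm_id] by blast
      show ?thesis
      proof (rule that[of "norm x"])
        show "norm x < 1" using x K(2) by auto
        show "K \<subseteq> cball 0 (norm x)" using x by auto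
      qed
    qed (use that[of 0] in auto)
    obtain L where L: "0 \<le> L" "\<And>n z. norm z \<le> R \<Longrightarrow> norm (deriv (F n) z) \<le> L" using locbd[OF R(1)] by blast
    have "norm (F n z) \<le> (max 0 M) powr (1/p) + L" if z: "z \<in> K" for n z
    proof -
      have zR: "norm z \<le> R" using z R by auto
      then have R0: "0 \<le> R" using norm_ge_zero[of z] by linarith
      have "norm (F n z - F n 0) \<le> L * norm (z - 0)"
      proof (rule field_differentiable_bound[of "cball 0 R"])
        show "(F n has_field_derivative deriv (F n) w) (at w within cball 0 R)" if "w \<in> cball 0 R" for w
          using that R by (intro holomorphic_derivI[OF F(1)]) auto
      qed (use L zR R0 in auto)
      also have "\<dots> \<le> L * 1" using L zR R by (intro mult_left_mono) auto
      finally show ?thesis using F0[of n] norm_triangle_sub[of "F n z" "F n 0"] by linarith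
    qed
    then show ?thesis by blast
  qed
  obtain h r where h: "h holomorphic_on ball 0 1" "strict_mono r"
      "\<And>z. z \<in> ball 0 1 \<Longrightarrow> (\<lambda>n. F (r n) z) \<longlonglongrightarrow> h z"
      "\<And>K. compact K \<Longrightarrow> K \<subseteq> ball 0 1 \<Longrightarrow> uniform_limit K (F \<circ> r) h sequentially"
    using Montel[of "ball 0 1" "range F" F] F(1) bdd by blast
  \<comment> \<open>Locally uniform convergence of holomorphic functions passes to derivatives; the
    smaller disc gives a set on which it is uniform.\<close>
  have dlim: "(\<lambda>n. deriv (F (r n)) z) \<longlonglongrightarrow> deriv h z" if z: "norm z < 1" for z
  proof -
    obtain R where R: "norm z < R" "R < 1" using z dense by blast
    have "uniform_limit (ball 0 R) (F \<circ> r) h sequentially"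
      using R by (intro uniform_limit_on_subset[OF h(4)[of "cball 0 R"]]) auto
    then have "(\<lambda>n. deriv ((F \<circ> r) n) z) \<longlonglongrightarrow> deriv h z"
      using R by (intro deriv_complex_uniform_limit[where A="ball 0 R"])
        (auto simp: o_def intro!: always_eventually holomorphic_on_subset[OF F(1)])
    then show ?thesis by simp
  qed
  obtain L where L: "\<And>G. G holomorphic_on ball 0 1 \<Longrightarrow> disc_integral p \<omega> G \<le> ennreal B \<Longrightarrow>
     disc_integral 1 (\<lambda>_. 1) G \<le> ennreal L"
    using uniform_disc_integral_bound[OF \<omega> p lim B] by metis
  have "disc_integral 1 (\<lambda>_. 1) (deriv h) \<le> ennreal L"
    unfolding disc_integral_1_1
    by (rule nn_integral_norm_le_of_pointwise_limit[where G="\<lambda>n. deriv (F (r n))"])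
       (use dF L XF dlim in \<open>auto simp: disc_integral_1_1 intro: holomorphic_on_imp_continuous_on\<close>)
  then have "disc_integral 1 (\<lambda>_. 1) (deriv h) < \<infinity>" by (rule le_less_trans) simp
  then have "Dnorm_pow 1 (\<lambda>_. 1) h < \<infinity>"
    by (rule Dnorm_pow_finite)
  then have "h \<in> D10" using h(1) by (simp add: Dspace_def)
  moreover have "(\<lambda>n. Dnorm_pow 1 (\<lambda>_. 1) (\<lambda>z. F (r n) z - h z)) \<longlonglongrightarrow> 0"
  proof (rule D10_convergence)
    show "\<exists>R<1. \<forall>n. (\<integral>\<^sup>+z. indicator (ball 0 1 - ball 0 R) z * ennreal (norm (deriv (F (r n)) z)) \<partial>lborel) \<le> ennreal e"
      if "0 < e" for e
      using uniform_disc_tail[OF \<omega> p lim B that] dF XF by metis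
    show "\<exists>K\<ge>0. \<forall>n z. norm z \<le> R \<longrightarrow> norm (deriv (F (r n)) z) \<le> K" if "R < 1" for R
      using locbd[OF that] by blast
  qed (use F(1) h dlim in auto)
  ultimately show "\<exists>r h. strict_mono r \<and> h \<in> D10 \<and> (\<lambda>n. Dnorm_pow 1 (\<lambda>_. 1) (\<lambda>z. F (r n) z - h z)) \<longlonglongrightarrow> 0"
    using h(2) by blast
qed

section \<open>The integral operator with symbol z\<close>

text \<open>The disc is convex, so the integrand has a primitive \<open>H\<close> there, and the
  segment integral defining \<open>Tg\<close> is \<open>H z - H 0\<close>.\<close>

lemma Tg_has_field_derivative:
  assumes f: "f holomorphic_on ball 0 1" and g: "g holomorphic_on ball 0 1" and z: "norm z < 1"
  shows "(Tg g f has_field_derivative f z * deriv g z) (at z)"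
proof -
  have fg: "(\<lambda>w. f w * deriv g w) holomorphic_on ball 0 1"
    using f g by (intro holomorphic_intros) auto
  obtain H where H: "\<And>w. w \<in> ball 0 1 \<Longrightarrow> (H has_field_derivative f w * deriv g w) (at w within ball 0 1)"
    by (rule holomorphic_convex_primitive'[OF convex_ball open_ball fg]) blast
  have eq: "H w - H 0 = Tg g f w" if w: "w \<in> ball 0 1" for w
  proof -
    have "closed_segment 0 w \<subseteq> ball 0 1" using w by (intro closed_segment_subset) auto
    then have "((\<lambda>w. f w * deriv g w) has_contour_integral H (pathfinish (linepath 0 w)) - H (pathstart (linepath 0 w))) (linepath 0 w)"
      by (intro contour_integral_primitive[OF H]) auto
    then show ?thesis by (simp add: Tg_def contour_integral_unique)
  qed
  have "(H has_field_derivative f z * deriv g z) (at z)"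
    using H[of z] z by (simp add: at_within_open[of _ "ball 0 1"])
  then have "((\<lambda>w. H w - H 0) has_field_derivative f z * deriv g z - 0) (at z)"
    by (intro derivative_intros)
  then have "((\<lambda>w. H w - H 0) has_field_derivative f z * deriv g z) (at z)" by simp
  then show ?thesis
    by (rule has_field_derivative_transform_within_open[of _ _ _ "ball 0 1"]) (use z eq in auto)
qed

lemma Tg_0: "Tg g f 0 = 0"
  by (simp add: Tg_def)

lemma Tg_holomorphic:
  assumes "f holomorphic_on ball 0 1" "g holomorphic_on ball 0 1"
  shows "Tg g f holomorphic_on ball 0 1"
  using Tg_has_field_derivative[OF assms] by (subst holomorphic_on_open) (auto, blast)

lemma deriv_Tg:
  assumes "f holomorphic_on ball 0 1" "g holomorphic_on ball 0 1" "norm z < 1"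
  shows "deriv (Tg g f) z = f z * deriv g z"
  using Tg_has_field_derivative[OF assms] by (rule DERIV_imp_deriv)

lemma Tg_diff:
  assumes "f holomorphic_on ball 0 1" "h holomorphic_on ball 0 1" "g holomorphic_on ball 0 1" "norm z < 1"
  shows "Tg g (\<lambda>w. f w - h w) z = Tg g f z - Tg g h z"
proof -
  have seg: "closed_segment 0 z \<subseteq> ball 0 1" using assms(4) by (intro closed_segment_subset) auto
  have "(\<lambda>w. k w * deriv g w) contour_integrable_on linepath 0 z" if "k holomorphic_on ball 0 1" for k
    using that assms(3) seg
    by (intro contour_integrable_continuous_linepath continuous_on_subset[OF holomorphic_on_imp_continuous_on seg]
        holomorphic_intros) auto
  then show ?thesis
    unfolding Tg_def using assms by (simp add: contour_integral_diff[symmetric] left_diff_distrib)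
qed

lemma norm_diff_le_radial_integral:
  assumes h: "h holomorphic_on ball 0 1" and u: "norm u = 1" and s: "0 \<le> s" "s < 1"
  shows "ennreal (norm (h (of_real s * u) - h 0))
    \<le> (\<integral>\<^sup>+x. indicator {0..s} x * ennreal (norm (deriv h (of_real x * u))) \<partial>lborel)"
proof -
  have c: "continuous_on {0..s} (\<lambda>x. deriv h (of_real x * u))"
  proof (rule continuous_on_compose2[of "ball 0 1" "deriv h"])
    show "continuous_on (ball 0 1) (deriv h)"
      using h by (intro holomorphic_on_imp_continuous_on holomorphic_deriv) auto
  qed (use s u in \<open>auto simp: norm_mult intro!: continuous_intros\<close>)
  have "((\<lambda>x. deriv h (of_real x * u) * u) has_integral (h (of_real s * u) - h (of_real 0 * u))) {0..s}"
  proof (rule fundamental_theorem_of_calculus[OF s(1)])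
    fix x assume x: "x \<in> {0..s}"
    have "(h has_field_derivative deriv h (of_real x * u)) (at (of_real x * u))"
      using x s u by (intro holomorphic_derivI[OF h]) (auto simp: norm_mult)
    moreover have "((\<lambda>x. of_real x * u) has_vector_derivative u) (at x within {0..s})"
      using has_vector_derivative_scaleR[of "\<lambda>x. x" 1 x "{0..s}" "\<lambda>_. u" 0] by (simp add: scaleR_conv_of_real)
    ultimately show "((\<lambda>x. h (of_real x * u)) has_vector_derivative deriv h (of_real x * u) * u) (at x within {0..s})"
      using field_vector_diff_chain_within[of "\<lambda>x. of_real x * u" u x "{0..s}" h "deriv h (of_real x * u)"]
      by (simp add: o_def mult.commute has_field_derivative_at_within)
  qed
  moreover have hi: "((\<lambda>x. norm (deriv h (of_real x * u))) has_integral integral {0..s} (\<lambda>x. norm (deriv h (of_real x * u)))) {0..s}"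
    using c by (intro integrable_integral integrable_continuous_real continuous_on_norm)
  ultimately have "norm (h (of_real s * u) - h (of_real 0 * u)) \<le> integral {0..s} (\<lambda>x. norm (deriv h (of_real x * u))) \<bullet> 1"
    by (rule has_integral_norm_bound_integral_component) (use u in \<open>simp add: norm_mult\<close>)
  moreover have "(\<integral>\<^sup>+x. ennreal (norm (deriv h (of_real x * u))) * indicator {0..s} x \<partial>lborel) = ennreal (integral {0..s} (\<lambda>x. norm (deriv h (of_real x * u))))"
    using hi by (intro nn_integral_has_integral_lebesgue') auto
  ultimately show ?thesis by (simp add: mult.commute ennreal_leI)
qed

lemma radial_weight_1: "radial_weight (\<lambda>_. 1)"
proof -
  have "omega_hat (\<lambda>_. 1) r = 1 - r" if "r < 1" for r
    using that by (simp add: omega_hat_def set_lebesgue_integral_def)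
  moreover have "set_integrable lborel {0..<1::real} (\<lambda>_. 1::real)"
    by (simp add: set_integrable_def)
  ultimately show ?thesis by (auto simp: radial_weight_def)
qed

text \<open>Integrating \<open>f'\<close> twice along a radius and exchanging the integrals leaves
  \<open>|f'(x u)|\<close> with weight at most \<open>1 - x\<close>. This weight cancels the gap in
  the pointwise bound by the mean on the radius \<open>(1 + x)/2\<close>, and integrating those
  means in \<open>x\<close> gives an area integral, the same for every direction \<open>u\<close>.
  The constant is \<open>2/pi\<close> from the pointwise bound, 2 from the substitution and 2 from
  the polar Jacobian; the \<open>pi\<close> is absorbed by the normalised area measure.\<close>

lemma norm_Tg_id_le:
  assumes f: "f holomorphic_on ball 0 1" and z: "norm z < 1"
  shows "ennreal (norm (Tg (\<lambda>z. z) f z)) \<le> 8 * Dnorm_pow 1 (\<lambda>_. 1) f"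
proof -
  define u where "u = (if z = 0 then 1 else z / of_real (norm z))"
  define \<rho> where "\<rho> = norm z"
  have u: "norm u = 1" "z = of_real \<rho> * u" by (auto simp: u_def \<rho>_def norm_divide)
  have \<rho>: "0 \<le> \<rho>" "\<rho> < 1" using z by (auto simp: \<rho>_def)
  have df: "deriv f holomorphic_on ball 0 1" using f by (intro holomorphic_deriv) auto
  define k where "k x = indicator (ball 0 1) (of_real x * u) * ennreal (norm (deriv f (of_real x * u)) powr 1)" for x
  have [measurable]: "k \<in> borel_measurable borel"
    unfolding k_def using measurable_compose[OF _ borel_measurable_indicator_norm_powr[OF holomorphic_on_imp_continuous_on[OF df], of 1], of "\<lambda>x. of_real x * u" borel]
    by simp
  note [measurable] = borel_measurable_pmean[OF holomorphic_on_imp_continuous_on[OF df]]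
  define A where "A = disc_integral 1 (\<lambda>_. 1) (deriv f)"
  have k_eq: "ennreal (norm (deriv f (of_real x * u))) = k x" if "0 \<le> x" "x < 1" for x
    using that u by (simp add: k_def norm_mult)
  have fs: "ennreal (norm (f (of_real s * u))) \<le> ennreal (norm (f 0)) + (\<integral>\<^sup>+x. indicator {0..s} x * k x \<partial>lborel)"
    if s: "0 \<le> s" "s < 1" for s
  proof -
    have "ennreal (norm (f (of_real s * u))) \<le> ennreal (norm (f 0) + norm (f (of_real s * u) - f 0))"
      by (intro ennreal_leI norm_triangle_sub)
    also have "\<dots> = ennreal (norm (f 0)) + ennreal (norm (f (of_real s * u) - f 0))" by (rule ennreal_plus) auto
    also have "ennreal (norm (f (of_real s * u) - f 0)) \<le> (\<integral>\<^sup>+x. indicator {0..s} x * ennreal (norm (deriv f (of_real x * u))) \<partial>lborel)"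
      by (rule norm_diff_le_radial_integral[OF f u(1) s])
    also have "\<dots> = (\<integral>\<^sup>+x. indicator {0..s} x * k x \<partial>lborel)"
      using s k_eq by (intro nn_integral_cong) (auto simp: indicator_def)
    finally show ?thesis by (simp add: add_left_mono)
  qed
  have T: "Tg (\<lambda>z. z) f holomorphic_on ball 0 1" using f by (intro Tg_holomorphic holomorphic_intros)
  have dT: "deriv (Tg (\<lambda>z. z) f) (of_real x * u) = f (of_real x * u)" if "0 \<le> x" "x < 1" for x
    using that u f by (subst deriv_Tg) (auto simp: norm_mult intro!: holomorphic_intros)
  \<comment> \<open>\<open>D\<close> restricts \<open>k\<close> to the triangle
    \<open>0 \<le> x \<le> s\<close>; as one function of two variables it is visibly jointly
    measurable, as the exchange of integrals requires.\<close>
  define D where "D s x = (if 0 \<le> x \<and> x \<le> s then k x else 0)" for s x :: real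
  have D_eq: "indicator {0..s} x * k x = D s x" for s x by (auto simp: D_def)
  have [measurable]: "(\<lambda>x. D (fst x) (snd x)) \<in> borel_measurable (borel \<Otimes>\<^sub>M borel)"
    "(\<lambda>x. D (snd x) (fst x)) \<in> borel_measurable (borel \<Otimes>\<^sub>M borel)" "D s \<in> borel_measurable borel" for s
    unfolding D_def by measurable
  have "ennreal (norm (Tg (\<lambda>z. z) f z)) = ennreal (norm (Tg (\<lambda>z. z) f (of_real \<rho> * u) - Tg (\<lambda>z. z) f 0))"
    by (simp add: Tg_0 u(2))
  also have "\<dots> \<le> (\<integral>\<^sup>+s. indicator {0..\<rho>} s * ennreal (norm (deriv (Tg (\<lambda>z. z) f) (of_real s * u))) \<partial>lborel)"
    by (rule norm_diff_le_radial_integral[OF T u(1) \<rho>])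
  also have "\<dots> \<le> (\<integral>\<^sup>+s. ennreal (norm (f 0)) * indicator {0..1} s + indicator {0..\<rho>} s * (\<integral>\<^sup>+x. D s x \<partial>lborel) \<partial>lborel)"
    using \<rho> fs[unfolded D_eq] dT by (intro nn_integral_mono) (auto simp: indicator_def)
  also have "\<dots> = (\<integral>\<^sup>+s. ennreal (norm (f 0)) * indicator {0..1::real} s \<partial>lborel) + (\<integral>\<^sup>+s. indicator {0..\<rho>} s * (\<integral>\<^sup>+x. D s x \<partial>lborel) \<partial>lborel)"
    by (rule nn_integral_add) measurable
  also have "(\<integral>\<^sup>+s. ennreal (norm (f 0)) * indicator {0..1::real} s \<partial>lborel) = ennreal (norm (f 0))"
    by (simp add: nn_integral_cmult_indicator)
  finally have bound1: "ennreal (norm (Tg (\<lambda>z. z) f z)) \<le> ennreal (norm (f 0)) + (\<integral>\<^sup>+s. indicator {0..\<rho>} s * (\<integral>\<^sup>+x. D s x \<partial>lborel) \<partial>lborel)" .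
  have "(\<integral>\<^sup>+s. indicator {0..\<rho>} s * (\<integral>\<^sup>+x. D s x \<partial>lborel) \<partial>lborel) = (\<integral>\<^sup>+s. (\<integral>\<^sup>+x. indicator {0..\<rho>} s * D s x \<partial>lborel) \<partial>lborel)"
    by (intro nn_integral_cong nn_integral_cmult[symmetric]) simp
  also have "\<dots> = (\<integral>\<^sup>+x. (\<integral>\<^sup>+s. indicator {0..\<rho>} s * D s x \<partial>lborel) \<partial>lborel)"
    by (rule lborel_pair.Fubini') measurable
  also have "\<dots> \<le> (\<integral>\<^sup>+x. indicator {0..<1} x * (ennreal (1 - x) * k x) \<partial>lborel)"
  proof (intro nn_integral_mono)
    fix x :: real
    show "(\<integral>\<^sup>+s. indicator {0..\<rho>} s * D s x \<partial>lborel) \<le> indicator {0..<1} x * (ennreal (1 - x) * k x)"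
    proof (cases "0 \<le> x \<and> x \<le> \<rho>")
      case True
      have "(\<integral>\<^sup>+s. indicator {0..\<rho>} s * D s x \<partial>lborel) = (\<integral>\<^sup>+s. k x * indicator {x..\<rho>} s \<partial>lborel)"
        using True by (intro nn_integral_cong) (auto simp: D_def indicator_def)
      also have "\<dots> = k x * ennreal (\<rho> - x)" using True by (simp add: nn_integral_cmult_indicator)
      also have "\<dots> \<le> k x * ennreal (1 - x)" using \<rho> by (intro mult_left_mono ennreal_leI) auto
      finally show ?thesis using True \<rho> by (simp add: mult.commute)
    next
      case False
      then have "(\<integral>\<^sup>+s. indicator {0..\<rho>} s * D s x \<partial>lborel) = (\<integral>\<^sup>+s. 0 \<partial>(lborel::real measure))"
        by (intro nn_integral_cong) (auto simp: D_def indicator_def)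
      then show ?thesis by simp
    qed
  qed
  also have "\<dots> \<le> (\<integral>\<^sup>+x. ennreal (2/pi) * (indicator {0..<1} x * pmean 1 (deriv f) (1/2 + 1/2 * x)) \<partial>lborel)"
  proof (intro nn_integral_mono)
    fix x :: real
    show "indicator {0..<1} x * (ennreal (1 - x) * k x) \<le> ennreal (2/pi) * (indicator {0..<1} x * pmean 1 (deriv f) (1/2 + 1/2 * x))"
    proof (cases "x \<in> {0..<1}")
      case True
      then have nx: "norm (of_real x * u) = x" using u by (simp add: norm_mult)
      have "k x \<le> ennreal (norm (deriv f (of_real x * u)) powr 1)" by (simp add: k_def indicator_def)
      also have "\<dots> \<le> ennreal (1 / (pi * ((1/2 + 1/2 * x) - norm (of_real x * u)))) * pmean 1 (deriv f) (1/2 + 1/2 * x)"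
        using True nx by (intro norm_powr_le_pmean df) auto
      finally have "ennreal (1 - x) * k x \<le> ennreal (1 - x) * (ennreal (1 / (pi * ((1/2 + 1/2 * x) - x))) * pmean 1 (deriv f) (1/2 + 1/2 * x))"
        unfolding nx by (rule mult_left_mono) simp
      also have "\<dots> = ennreal ((1 - x) * (1 / (pi * ((1/2 + 1/2 * x) - x)))) * pmean 1 (deriv f) (1/2 + 1/2 * x)"
        using True by (subst ennreal_mult) (auto simp: mult.assoc)
      also have "(1 - x) * (1 / (pi * ((1/2 + 1/2 * x) - x))) = 2 / pi"
      proof -
        have e: "(1/2 + 1/2 * x) - x = (1 - x)/2" by (simp add: field_simps)
        have "y * (1 / (pi * (y/2))) = 2 / pi" if "y \<noteq> 0" for y :: real using that by simp
        from this[of "1 - x"] show ?thesis unfolding e using True by simp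
      qed
      finally show ?thesis using True by simp
    qed simp
  qed
  also have "\<dots> = ennreal (2/pi) * (\<integral>\<^sup>+x. indicator {0..<1} x * pmean 1 (deriv f) (1/2 + 1/2 * x) \<partial>lborel)"
    by (rule nn_integral_cmult) measurable
  also have "(\<integral>\<^sup>+x. indicator {0..<1} x * pmean 1 (deriv f) (1/2 + 1/2 * x) \<partial>lborel) = 2 * (\<integral>\<^sup>+\<rho>. indicator {1/2..<1} \<rho> * pmean 1 (deriv f) \<rho> \<partial>lborel)"
  proof -
    have "2 * ennreal \<bar>1/2\<bar> = 1" by (subst ennreal_numeral[symmetric], subst ennreal_mult[symmetric]) auto
    moreover have "indicator {1/2..<1} (1/2 + 1/2 * x) = (indicator {0..<1} x :: ennreal)" for x :: real
      by (auto simp: indicator_def)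
    ultimately show ?thesis
      by (subst (2) nn_integral_real_affine[where c="1/2" and t="1/2"]) (measurable, simp_all only: mult.assoc[symmetric], auto)
  qed
  finally have bound2: "(\<integral>\<^sup>+s. indicator {0..\<rho>} s * (\<integral>\<^sup>+x. D s x \<partial>lborel) \<partial>lborel)
     \<le> ennreal (2/pi) * (2 * (\<integral>\<^sup>+\<rho>. indicator {1/2..<1} \<rho> * pmean 1 (deriv f) \<rho> \<partial>lborel))" .
  have "(\<integral>\<^sup>+\<rho>. indicator {1/2..<1} \<rho> * pmean 1 (deriv f) \<rho> \<partial>lborel) =
     (\<integral>\<^sup>+\<rho>. indicator {1/2..<1} \<rho> * (pmean 1 (deriv f) \<rho> * radial_density (\<lambda>_. 1) \<rho>) \<partial>lborel)"
    by (intro nn_integral_cong) (auto simp: indicator_def radial_density_def)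
  also have "\<dots> \<le> 2 * A" unfolding A_def by (rule radial_integral_le_disc_integral[OF radial_weight_1 df]) simp
  finally have "ennreal (2/pi) * (2 * (\<integral>\<^sup>+\<rho>. indicator {1/2..<1} \<rho> * pmean 1 (deriv f) \<rho> \<partial>lborel)) \<le> ennreal (2/pi) * (2 * (2 * A))"
    by (intro mult_left_mono) auto
  also have "\<dots> = 8 * (A / ennreal pi)"
  proof -
    have "ennreal (2/pi) * (2 * 2) = ennreal (2/pi * (2 * 2))" by (simp only: ennreal_mult divide_nonneg_nonneg mult_nonneg_nonneg zero_le_numeral pi_ge_zero ennreal_numeral)
    also have "\<dots> = ennreal (8 * inverse pi)" by (simp add: divide_inverse)
    also have "\<dots> = 8 * inverse (ennreal pi)" by (simp add: ennreal_mult inverse_ennreal)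
    finally show ?thesis by (simp add: divide_ennreal_def mult_ac flip: mult.assoc)
  qed
  finally have "ennreal (norm (Tg (\<lambda>z. z) f z)) \<le> ennreal (norm (f 0)) + 8 * (A / ennreal pi)"
    using bound1 bound2 by (meson add_left_mono order_trans)
  also have "\<dots> \<le> 8 * ennreal (norm (f 0)) + 8 * (A / ennreal pi)"
  proof -
    have "1 * ennreal (norm (f 0)) \<le> 8 * ennreal (norm (f 0))" by (rule mult_right_mono) auto
    then show ?thesis by (intro add_right_mono) simp
  qed
  also have "\<dots> = 8 * Dnorm_pow 1 (\<lambda>_. 1) f" by (simp add: Dnorm_pow_eq A_def distrib_left add.commute)
  finally show ?thesis .
qed

text \<open>It serves in contrapositive form: a compact identity would place a nonconstant symbol in
  \<open>Tc_Hinf\<close>. The preceding estimate, applied to differences, turns convergence in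
  \<open>D10\<close> into uniform convergence.\<close>

theorem id_in_Tc_Hinf_of_identity_compact:
  assumes "identity_compact_D10 p \<omega>"
  shows "(\<lambda>z. z) \<in> Tc_Hinf p \<omega>"
proof -
  have sub: "Dspace p \<omega> \<subseteq> D10" using assms by (simp add: identity_compact_D10_def)
  have "bounded (Tg (\<lambda>z. z) f ` ball 0 1)" if "f \<in> Dspace p \<omega>" for f
  proof -
    have f: "f holomorphic_on ball 0 1" "Dnorm_pow 1 (\<lambda>_. 1) f < \<infinity>" using that sub by (auto simp: Dspace_def)
    define L where "L = enn2real (Dnorm_pow 1 (\<lambda>_. 1) f)"
    have L: "Dnorm_pow 1 (\<lambda>_. 1) f = ennreal L" "0 \<le> L" using f(2) by (simp_all add: L_def)
    have "norm (Tg (\<lambda>z. z) f z) \<le> 8 * L" if "norm z < 1" for z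
    proof -
      have "ennreal (norm (Tg (\<lambda>z. z) f z)) \<le> ennreal (8 * L)"
        using norm_Tg_id_le[OF f(1) that] L by (simp add: ennreal_mult)
      then show ?thesis using L(2) by (simp add: ennreal_le_iff)
    qed
    then show ?thesis by (intro boundedI[of _ "8 * L"]) auto
  qed
  moreover have "\<exists>r h. strict_mono r \<and> uniform_limit (ball 0 1) (\<lambda>n. Tg (\<lambda>z. z) (F (r n))) h sequentially"
    if F: "\<forall>n. F n \<in> Dspace p \<omega> \<and> Dnorm_pow p \<omega> (F n) \<le> ennreal M" for F :: "nat \<Rightarrow> complex \<Rightarrow> complex" and M
  proof -
    obtain r h where r: "strict_mono r" and h: "h \<in> D10"
      and lim: "(\<lambda>n. Dnorm_pow 1 (\<lambda>_. 1) (\<lambda>z. F (r n) z - h z)) \<longlonglongrightarrow> 0"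
      using assms F unfolding identity_compact_D10_def by blast
    have hol: "F n holomorphic_on ball 0 1" "h holomorphic_on ball 0 1" for n
      using F h by (auto simp: Dspace_def)
    have "uniform_limit (ball 0 1) (\<lambda>n. Tg (\<lambda>z. z) (F (r n))) (Tg (\<lambda>z. z) h) sequentially"
    proof (rule uniform_limitI)
      fix e :: real assume e: "0 < e"
      have "eventually (\<lambda>n. Dnorm_pow 1 (\<lambda>_. 1) (\<lambda>z. F (r n) z - h z) < ennreal (e/8)) sequentially"
        using lim e by (intro order_tendstoD(2)) auto
      then show "\<forall>\<^sub>F n in sequentially. \<forall>z\<in>ball 0 1. dist (Tg (\<lambda>z. z) (F (r n)) z) (Tg (\<lambda>z. z) h z) < e"
      proof (eventually_elim, intro ballI)
        fix n z assume elim: "Dnorm_pow 1 (\<lambda>_. 1) (\<lambda>z. F (r n) z - h z) < ennreal (e/8)" "z \<in> ball (0::complex) 1"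
        then have z: "norm z < 1" by simp
        have "ennreal (norm (Tg (\<lambda>z. z) (F (r n)) z - Tg (\<lambda>z. z) h z)) = ennreal (norm (Tg (\<lambda>z. z) (\<lambda>w. F (r n) w - h w) z))"
          using hol z by (subst Tg_diff) (auto intro: holomorphic_intros)
        also have "\<dots> \<le> 8 * Dnorm_pow 1 (\<lambda>_. 1) (\<lambda>z. F (r n) z - h z)"
          using hol z by (intro norm_Tg_id_le holomorphic_intros)
        also have "\<dots> < 8 * ennreal (e/8)" using elim(1) by (intro ennreal_mult_strict_left_mono) auto
        also have "\<dots> = ennreal (8 * (e/8))" using e by (subst ennreal_mult) auto
        finally show "dist (Tg (\<lambda>z. z) (F (r n)) z) (Tg (\<lambda>z. z) h z) < e"
          using e by (simp add: dist_norm ennreal_less_iff)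
      qed
    qed
    then show ?thesis using r by blast
  qed
  ultimately show ?thesis unfolding Tc_Hinf_def Tg_compact_Hinf_def by (auto intro: holomorphic_intros)
qed

section \<open>Test functions\<close>

text \<open>Each application of the doubling condition halves the distance to the boundary. The
  \<open>max\<close> stops the points at 0; there the midpoint 1/2 lies to the right of the point
  wanted, which is harmless because \<open>omega_hat\<close> decreases.\<close>

lemma omega_hat_doubling_iterated:
  assumes \<omega>: "radial_weight \<omega>" and C: "1 \<le> C" "\<And>r. 0 \<le> r \<Longrightarrow> r < 1 \<Longrightarrow> omega_hat \<omega> r \<le> C * omega_hat \<omega> ((1 + r)/2)"
    and d: "0 < d" "d \<le> 1"
  shows "omega_hat \<omega> (max 0 (1 - 2^j * d)) \<le> C^j * omega_hat \<omega> (1 - d)"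
proof (induction j)
  case 0
  then show ?case using d by simp
next
  case (Suc j)
  define r where "r = max 0 (1 - 2^Suc j * d)"
  have r: "0 \<le> r" "r < 1" using d by (auto simp: r_def)
  have "omega_hat \<omega> r \<le> C * omega_hat \<omega> ((1 + r)/2)" by (rule C(2)[OF r])
  also have "\<dots> \<le> C * omega_hat \<omega> (max 0 (1 - 2^j * d))"
    using C(1) r d by (intro mult_left_mono omega_hat_antimono[OF \<omega>]) (auto simp: r_def max_def field_simps)
  also have "\<dots> \<le> C * (C^j * omega_hat \<omega> (1 - d))" using C(1) Suc by (intro mult_left_mono) auto
  finally show ?case by (simp add: r_def)
qed

lemma ex_dyadic_scale:
  assumes "1 \<le> (x::real)"
  obtains j where "2^j \<le> x" "x < 2^Suc j"
proof -
  obtain m where m: "x < 2^m" using real_arch_pow[of 2 x] by auto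
  define k where "k = (LEAST m. x < 2^m)"
  have k: "x < 2^k" unfolding k_def using m by (rule LeastI)
  then have "k \<noteq> 0" using assms by (intro notI) auto
  then obtain j where j: "k = Suc j" by (cases k) auto
  have "\<not> x < 2^j" using not_less_Least[of j "\<lambda>m. x < 2^m"] j by (simp add: k_def)
  then show thesis using that[of j] k j by simp
qed

text \<open>Cut the radius where \<open>1 - r * s\<close> is about \<open>2^j * (1 - r)\<close>.
  There the kernel is at most \<open>2^(-j * N)\<close>, and \<open>s\<close> lies in the tail from
  \<open>1 - 2^(j+1) * (1 - r)\<close>, whose weight is at most
  \<open>C^(j+1) * omega_hat \<omega> r\<close> by doubling. Choosing \<open>N\<close> with
  \<open>C < 2^(N - 1)\<close> makes the ratio at most 1/2, so the series sums to at most
  \<open>2 * C * omega_hat \<omega> r\<close>.\<close>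

lemma Dhat_kernel_estimate:
  assumes "\<omega> \<in> Dhat"
  obtains N K where "1 \<le> N" "0 < K"
    "\<And>r. 0 \<le> r \<Longrightarrow> r < 1 \<Longrightarrow>
      (\<integral>\<^sup>+s. radial_density \<omega> s * ennreal (((1 - r)/(1 - r * s))^N) \<partial>lborel) \<le> ennreal (K * omega_hat \<omega> r)"
proof -
  have \<omega>: "radial_weight \<omega>" using assms by (simp add: Dhat_def)
  note [measurable] = borel_measurable_radial_density[OF \<omega>]
  obtain C where C: "1 \<le> C" "\<And>r. 0 \<le> r \<Longrightarrow> r < 1 \<Longrightarrow> omega_hat \<omega> r \<le> C * omega_hat \<omega> ((1 + r)/2)"
    using assms by (auto simp: Dhat_def)
  obtain N0 where N0: "C < 2^N0" using real_arch_pow[of 2 C] by auto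
  define N where "N = Suc N0"
  define q :: real where "q = 1 / 2^N"
  have qC: "q * C \<le> 1/2" using N0 by (simp add: q_def N_def field_simps)
  have q0: "0 < q" by (simp add: q_def)
  show thesis
  proof (rule that[of N "2 * C"])
    show "1 \<le> N" "0 < 2 * C" using C(1) by (auto simp: N_def)
    fix r :: real assume r: "0 \<le> r" "r < 1"
    define a where "a j = max 0 (1 - 2^j * (1 - r))" for j :: nat
    have pointwise: "radial_density \<omega> s * ennreal (((1 - r)/(1 - r * s))^N)
        \<le> (\<Sum>j. ennreal (q^j) * (indicator {a (Suc j)..<1} s * radial_density \<omega> s))" for s
    proof (cases "0 \<le> s \<and> s < 1")
      case True
      have rs: "r * s \<le> r" "r * s \<le> s" "r * s < 1"
        using True r mult_left_le[of s r] mult_left_le_one_le[of s r] by auto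
      define x where "x = (1 - r * s)/(1 - r)"
      have "1 \<le> x" using rs r by (simp add: x_def)
      then obtain j where j: "2^j \<le> x" "x < 2^Suc j" by (rule ex_dyadic_scale)
      have "(1 - r)/(1 - r * s) = 1 / x" by (simp add: x_def)
      also have "\<dots> \<le> 1 / 2^j" using j \<open>1 \<le> x\<close> by (intro divide_left_mono) auto
      finally have "((1 - r)/(1 - r * s))^N \<le> (1 / 2^j)^N" using r rs by (intro power_mono) auto
      also have "\<dots> = q^j" by (simp add: q_def power_divide power_mult[symmetric] mult.commute)
      finally have 1: "((1 - r)/(1 - r * s))^N \<le> q^j" .
      have "1 - s \<le> x * (1 - r)" using rs r by (simp add: x_def)
      also have "\<dots> < 2^Suc j * (1 - r)" using j(2) r by (intro mult_strict_right_mono) auto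
      finally have "s \<in> {a (Suc j)..<1}" using True by (simp add: a_def)
      then have "radial_density \<omega> s * ennreal (((1 - r)/(1 - r * s))^N) \<le> ennreal (q^j) * (indicator {a (Suc j)..<1} s * radial_density \<omega> s)"
        using ennreal_leI[OF 1] by (simp add: mult.commute mult_left_mono)
      also have "\<dots> \<le> (\<Sum>j. ennreal (q^j) * (indicator {a (Suc j)..<1} s * radial_density \<omega> s))"
        using sum_le_suminf[of "\<lambda>j. ennreal (q^j) * (indicator {a (Suc j)..<1} s * radial_density \<omega> s)" "{j}"] by simp
      finally show ?thesis .
    qed (auto simp: radial_density_def)
    have W: "0 < omega_hat \<omega> r" using omega_hat_pos[OF \<omega> r] .
    have term_le: "ennreal (q^j) * ennreal (omega_hat \<omega> (a (Suc j))) \<le> ennreal ((1/2)^j * (C * omega_hat \<omega> r))" for j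
    proof -
      have "omega_hat \<omega> (a (Suc j)) \<le> C^Suc j * omega_hat \<omega> (1 - (1 - r))"
        unfolding a_def using r by (intro omega_hat_doubling_iterated[OF \<omega> C]) auto
      then have "q^j * omega_hat \<omega> (a (Suc j)) \<le> q^j * (C^Suc j * omega_hat \<omega> r)" using q0 by (intro mult_left_mono) auto
      also have "\<dots> = (q * C)^j * (C * omega_hat \<omega> r)" by (simp add: power_mult_distrib)
      also have "\<dots> \<le> (1/2)^j * (C * omega_hat \<omega> r)" using qC q0 C W by (intro mult_right_mono power_mono) auto
      finally show ?thesis using q0 by (simp add: ennreal_mult'[symmetric] ennreal_leI)
    qed
    have "(\<integral>\<^sup>+s. radial_density \<omega> s * ennreal (((1 - r)/(1 - r * s))^N) \<partial>lborel) \<le>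
      (\<integral>\<^sup>+s. (\<Sum>j. ennreal (q^j) * (indicator {a (Suc j)..<1} s * radial_density \<omega> s)) \<partial>lborel)"
      by (intro nn_integral_mono pointwise)
    also have "\<dots> = (\<Sum>j. \<integral>\<^sup>+s. ennreal (q^j) * (indicator {a (Suc j)..<1} s * radial_density \<omega> s) \<partial>lborel)"
      by (intro nn_integral_suminf) measurable
    also have "\<dots> = (\<Sum>j. ennreal (q^j) * ennreal (omega_hat \<omega> (a (Suc j))))"
      by (intro suminf_cong) (simp add: nn_integral_cmult nn_integral_radial_density[OF \<omega>] a_def)
    also have "\<dots> \<le> (\<Sum>j. ennreal ((1/2)^j * (C * omega_hat \<omega> r)))"
      by (intro suminf_le term_le) auto
    also have "\<dots> = ennreal (\<Sum>j. (1/2)^j * (C * omega_hat \<omega> r))"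
      using C W by (intro suminf_ennreal2) (auto intro!: summable_mult2 summable_geometric)
    also have "(\<Sum>j. (1/2)^j * (C * omega_hat \<omega> r)) = 2 * C * omega_hat \<omega> r"
      by (subst suminf_mult2[symmetric]) (auto simp: suminf_geometric intro!: summable_geometric)
    finally show "(\<integral>\<^sup>+s. radial_density \<omega> s * ennreal (((1 - r)/(1 - r * s))^N) \<partial>lborel) \<le> ennreal (2 * C * omega_hat \<omega> r)" .
  qed
qed

text \<open>On the circle the denominator equals \<open>|cis t - w|\<close> with
  \<open>w = a * s\<close>. Two of its \<open>q + 1\<close> powers form a Poisson kernel, which
  integrates to 1; the other \<open>q - 1\<close> are bounded by their maximum, which is why
  \<open>q\<close> must be at least 1.\<close>

lemma nn_integral_circle_kernel:
  assumes a: "norm a < 1" and s: "0 \<le> s" "s < 1" and q: "1 \<le> q"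
  shows "(\<integral>\<^sup>+t. indicator {0..2*pi} t * ennreal (((1 - norm a) / norm (1 - cnj a * (of_real s * cis t))) powr (q + 1)) \<partial>lborel)
    \<le> ennreal (2 * pi * (1 - norm a) * ((1 - norm a) / (1 - norm a * s)) powr q)"
proof -
  define r where "r = norm a"
  have r: "0 \<le> r" "r < 1" using a by (auto simp: r_def)
  have rs: "r * s \<le> r" "r * s < 1" "0 \<le> r * s"
    using s r mult_left_le[of s r] by auto
  define w where "w = a * of_real s"
  have nw: "norm w = r * s" using s by (simp add: w_def r_def norm_mult)
  have w1: "norm w < 1" using rs nw by simp
  have eq: "norm (1 - cnj a * (of_real s * cis t)) = norm (cis t - w)" for t
  proof -
    have "cnj (1 - cnj a * (of_real s * cis t)) * cis t = cis t - w"
      by (simp add: w_def left_diff_distrib cis_cnj mult.assoc cis_mult)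
    then show ?thesis by (metis complex_mod_cnj mult.right_neutral norm_cis norm_mult)
  qed
  define Y where "Y = (1 - r) / (1 - r * s)"
  define c where "c = Y powr (q - 1) * (1 - r)\<^sup>2 * (2 * pi / (1 - (r * s)\<^sup>2))"
  have rs2: "(r * s)\<^sup>2 < 1" using rs by (simp add: power_less_one_iff abs_square_less_1)
  have c0: "0 \<le> c" unfolding c_def using rs2 by simp
  have le: "((1 - r) / norm (cis t - w)) powr (q + 1) \<le> c * poisson w t" for t
  proof -
    have d: "1 - r * s \<le> norm (cis t - w)" using norm_triangle_ineq2[of "cis t" w] nw by simp
    have d0: "0 < norm (cis t - w)" using d rs by linarith
    define y where "y = (1 - r) / norm (cis t - w)"
    have y0: "0 < y" using d0 r by (simp add: y_def)
    have "y \<le> Y" unfolding y_def Y_def using d r rs by (intro divide_left_mono) (auto intro!: mult_pos_pos d0)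
    then have "y powr (q - 1) \<le> Y powr (q - 1)" using y0 q by (intro powr_mono2) auto
    then have "y powr (q - 1) * y\<^sup>2 \<le> Y powr (q - 1) * y\<^sup>2" by (rule mult_right_mono) simp
    moreover have "y powr (q + 1) = y powr (q - 1) * y\<^sup>2"
      using y0 by (simp add: powr_add[symmetric] add.commute flip: powr_numeral)
    moreover have "Y powr (q - 1) * y\<^sup>2 = c * poisson w t"
      unfolding c_def poisson_def y_def nw using rs2 d0 by (simp add: power_divide field_simps)
    ultimately show ?thesis by (simp add: y_def)
  qed
  have "(\<integral>\<^sup>+t. indicator {0..2*pi} t * ennreal (((1 - norm a) / norm (1 - cnj a * (of_real s * cis t))) powr (q + 1)) \<partial>lborel)
     \<le> (\<integral>\<^sup>+t. ennreal c * (indicator {0..2*pi} t * ennreal (poisson w t)) \<partial>lborel)"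
  proof (intro nn_integral_mono)
    fix t :: real
    have "ennreal (((1 - r) / norm (cis t - w)) powr (q + 1)) \<le> ennreal c * ennreal (poisson w t)"
      using le[of t] c0 poisson_nonneg[OF w1, of t] by (simp add: ennreal_mult[symmetric] ennreal_leI)
    then show "indicator {0..2*pi} t * ennreal (((1 - norm a) / norm (1 - cnj a * (of_real s * cis t))) powr (q + 1))
      \<le> ennreal c * (indicator {0..2*pi} t * ennreal (poisson w t))"
      unfolding eq r_def[symmetric] by (auto simp: indicator_def)
  qed
  also have "\<dots> = ennreal c" by (subst nn_integral_cmult) (auto simp: nn_integral_poisson[OF w1])
  also have "c \<le> 2 * pi * (1 - r) * Y powr q"
  proof -
    have Y0: "0 < Y" using r rs by (simp add: Y_def)
    have "1 - (r * s)\<^sup>2 = (1 + r * s) * (1 - r * s)" by (simp add: power2_eq_square algebra_simps)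
    then have "1 - r * s \<le> 1 - (r * s)\<^sup>2" using rs by (simp add: mult_right_mono[of 1 "1 + r * s" "1 - r * s", simplified])
    then have "c \<le> Y powr (q - 1) * (1 - r)\<^sup>2 * (2 * pi / (1 - r * s))"
      unfolding c_def using rs rs2 by (intro mult_left_mono divide_left_mono mult_pos_pos) auto
    also have "\<dots> = 2 * pi * (1 - r) * (Y powr (q - 1) * Y)" by (simp add: Y_def power2_eq_square)
    also have "Y powr (q - 1) * Y = Y powr q" using Y0 by (simp add: powr_diff)
    finally show ?thesis .
  qed
  finally show ?thesis by (simp add: r_def Y_def ennreal_leI)
qed

text \<open>The p-th power of the derivative carries the kernel to the power
  \<open>(n + 1) * p = q + 1\<close>. Integration over the circle uses up one power, and the
  remaining \<open>q\<close> must reach the exponent \<open>N\<close> of the radial kernel estimate.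
  The decay statement keeps the factor \<open>1 - norm a\<close> explicit, so that the functions
  tend to 0 locally uniformly as \<open>a\<close> approaches the boundary.\<close>

lemma Dhat_test_functions:
  assumes "\<omega> \<in> Dhat" and p: "0 < p"
  obtains n :: nat and M where "0 \<le> M"
    "\<And>a. norm a < 1 \<Longrightarrow> \<exists>f. f \<in> Dspace p \<omega> \<and> Dnorm_pow p \<omega> f \<le> ennreal M
       \<and> (\<forall>z. norm z < 1 \<longrightarrow> norm (f z) \<le> (M * (1 - norm a)) powr (1/p) / (1 - norm z)^n)
       \<and> phi_quot p \<omega> (norm a) / (1 - norm a) / 2^n \<le> norm (f a)"
proof -
  have \<omega>: "radial_weight \<omega>" using assms by (simp add: Dhat_def)
  note [measurable] = borel_measurable_radial_density[OF \<omega>]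
  obtain N K where N: "1 \<le> N" and K: "0 < K" and ker: "\<And>r. 0 \<le> r \<Longrightarrow> r < 1 \<Longrightarrow>
      (\<integral>\<^sup>+s. radial_density \<omega> s * ennreal (((1 - r)/(1 - r * s))^N) \<partial>lborel) \<le> ennreal (K * omega_hat \<omega> r)"
    using Dhat_kernel_estimate[OF assms(1)] by metis
  \<comment> \<open>This gives \<open>q \<ge> N + 1\<close>, one more than the kernel estimate
    needs; the spare power of \<open>1 - r\<close> makes the functions tend to 0.\<close>
  obtain n :: nat where n: "(real N + 2) / p \<le> real n" using real_arch_simple by blast
  define q where "q = (real n + 1) * p - 1"
  have q: "real N + 1 \<le> q"
  proof -
    have "real N + 2 \<le> real n * p" using n p by (simp add: field_simps)
    then show ?thesis using p by (simp add: q_def algebra_simps)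
  qed
  have q1: "1 \<le> q" using q by simp
  have W0: "0 < omega_hat \<omega> 0" using omega_hat_pos[OF \<omega>] by simp
  define D where "D = 2 * pi * real n powr p * K"
  define E where "E = K / omega_hat \<omega> 0"
  have DE: "0 \<le> D" "0 < E" using K W0 by (auto simp: D_def E_def)
  \<comment> \<open>A weight in \<open>Dhat\<close> has tails of at least polynomial size: since
    \<open>1 - r \<le> (1 - r)/(1 - r * s)\<close>, the kernel estimate itself yields \<open>(1 -
    r)^N * omega_hat \<omega> 0 \<le> K * omega_hat \<omega> r\<close>.\<close>
  have growth: "(1 - r) powr q / omega_hat \<omega> r \<le> E * (1 - r)" if r: "0 \<le> r" "r < 1" for r
  proof -
    have W: "0 < omega_hat \<omega> r" using omega_hat_pos[OF \<omega> r] .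
    have "ennreal ((1 - r)^N * omega_hat \<omega> 0) = ennreal ((1 - r)^N) * (\<integral>\<^sup>+s. indicator {0..<1} s * radial_density \<omega> s \<partial>lborel)"
      using r W0 by (subst nn_integral_radial_density[OF \<omega>]) (auto simp: ennreal_mult)
    also have "\<dots> = (\<integral>\<^sup>+s. ennreal ((1 - r)^N) * (indicator {0..<1} s * radial_density \<omega> s) \<partial>lborel)"
      by (rule nn_integral_cmult[symmetric]) measurable
    also have "\<dots> \<le> (\<integral>\<^sup>+s. radial_density \<omega> s * ennreal (((1 - r)/(1 - r * s))^N) \<partial>lborel)"
    proof (intro nn_integral_mono)
      fix s :: real
      show "ennreal ((1 - r)^N) * (indicator {0..<1} s * radial_density \<omega> s) \<le> radial_density \<omega> s * ennreal (((1 - r)/(1 - r * s))^N)"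
      proof (cases "s \<in> {0..<1}")
        case True
        have rs: "r * s < 1" "0 \<le> r * s" using True r mult_left_le[of s r] by auto
        have "(1 - r) * (1 - r * s) \<le> (1 - r) * 1" using rs r by (intro mult_left_mono) auto
        then have "(1 - r) \<le> (1 - r)/(1 - r * s)" using rs by (simp add: field_simps)
        then have "ennreal ((1 - r)^N) \<le> ennreal (((1 - r)/(1 - r * s))^N)" using r by (intro ennreal_leI power_mono) auto
        then show ?thesis using True by (simp add: mult.commute mult_left_mono)
      qed simp
    qed
    also have "\<dots> \<le> ennreal (K * omega_hat \<omega> r)" by (rule ker[OF r])
    finally have le: "(1 - r)^N * omega_hat \<omega> 0 \<le> K * omega_hat \<omega> r" using K W by (simp add: ennreal_le_iff)
    have "(1 - r) powr q \<le> (1 - r) powr (real N + 1)" using r q by (intro powr_mono') auto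
    also have "\<dots> = (1 - r)^N * (1 - r)" using r by (simp add: powr_add powr_realpow)
    finally have "(1 - r) powr q / omega_hat \<omega> r \<le> (1 - r)^N * (1 - r) / omega_hat \<omega> r"
      using W by (intro divide_right_mono) auto
    also have "\<dots> = ((1 - r)^N / omega_hat \<omega> r) * (1 - r)" by simp
    also have "\<dots> \<le> E * (1 - r)" using le W W0 r by (intro mult_right_mono) (auto simp: E_def field_simps)
    finally show ?thesis .
  qed
  define M where "M = D / pi + E"
  have M0: "0 \<le> M" "E \<le> M" using DE by (auto simp: M_def)
  show thesis
  proof (rule that[OF M0(1)])
    fix a :: complex assume a: "norm a < 1"
    define r where "r = norm a"
    have r: "0 \<le> r" "r < 1" using a by (auto simp: r_def)
    define W where "W = omega_hat \<omega> r"
    have W: "0 < W" using omega_hat_pos[OF \<omega> r] by (simp add: W_def)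
    define A where "A = phi_quot p \<omega> r / (1 - r)"
    have A0: "0 \<le> A" using r phi_quot_nonneg by (simp add: A_def)
    have Ap: "A powr p = (1 - r) powr (p - 1) / W"
    proof -
      have "A powr p = ((1 - r) powr (2 - 1/p)) powr p / (W powr (1/p)) powr p / (1 - r) powr p"
        using r W unfolding A_def phi_quot_def W_def by (simp add: powr_divide powr_mult)
      also have "\<dots> = (1 - r) powr (2 * p - 1) / W / (1 - r) powr p"
        using p W by (simp add: powr_powr left_diff_distrib)
      also have "\<dots> = (1 - r) powr ((2 * p - 1) - p) / W"
        unfolding powr_diff[of "1 - r" "2 * p - 1" p] divide_divide_eq_left mult.commute[of W] ..
      finally show ?thesis by simp
    qed
    define f where "f z = of_real A * ((1 - of_real r) / (1 - cnj a * z))^n" for z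
    have az: "norm (cnj a * z) \<le> norm z" "norm (cnj a * z) < 1" if "norm z < 1" for z
      using that a mult_left_le_one_le[of "norm z" "norm a"] by (auto simp: norm_mult)
    have low: "1 - norm z \<le> norm (1 - cnj a * z)" if "norm z < 1" for z
      using norm_triangle_ineq2[of 1 "cnj a * z"] az[OF that] by simp
    have nz: "1 - cnj a * z \<noteq> 0" if "norm z < 1" for z using low[OF that] that by auto
    have df: "(f has_field_derivative of_real A * (of_nat n * cnj a * (1 - of_real r)^n / (1 - cnj a * z)^Suc n)) (at z)"
      if "norm z < 1" for z
    proof -
      define d where "d = 1 - cnj a * z"
      have d: "d \<noteq> 0" using nz[OF that] by (simp add: d_def)
      have "((\<lambda>z. (1 - of_real r) / (1 - cnj a * z)) has_field_derivative (1 - of_real r) * cnj a / d\<^sup>2) (at z)"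
        using d by (auto intro!: derivative_eq_intros simp: d_def power2_eq_square)
      then have "(f has_field_derivative of_real A * (of_nat n * ((1 - of_real r) * cnj a / d\<^sup>2 * ((1 - of_real r) / d)^(n - Suc 0)))) (at z)"
        unfolding f_def d_def by (intro DERIV_cmult DERIV_power)
      moreover have "of_nat n * ((1 - of_real r) * cnj a / d\<^sup>2 * ((1 - of_real r) / d)^(n - Suc 0)) = of_nat n * cnj a * (1 - of_real r)^n / d^Suc n"
        by (cases n) (auto simp: power_divide power2_eq_square mult_ac)
      ultimately show ?thesis by (simp only: d_def)
    qed
    have fhol: "f holomorphic_on ball 0 1"
      unfolding f_def using nz by (intro holomorphic_intros) auto
    have dfhol: "deriv f holomorphic_on ball 0 1" using fhol by (intro holomorphic_deriv) auto
    have n1r: "norm (1 - complex_of_real r) = 1 - r"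
      using r by (metis abs_of_pos diff_gt_0_iff_gt norm_of_real of_real_1 of_real_diff)
    have dle: "norm (deriv f z) powr p \<le> real n powr p / (W * (1 - r)) * ((1 - r) / norm (1 - cnj a * z)) powr (q + 1)"
      if z: "norm z < 1" for z
    proof -
      define y where "y = (1 - r) / norm (1 - cnj a * z)"
      have y0: "0 < y" using r nz[OF z] by (simp add: y_def)
      have "norm (deriv f z) = A * (real n * r * (1 - r)^n / norm (1 - cnj a * z)^Suc n)"
        unfolding DERIV_imp_deriv[OF df[OF z]]
        using A0 by (simp add: norm_mult norm_divide norm_power r_def[symmetric] n1r)
      also have "\<dots> \<le> A * (real n * 1 * (1 - r)^n / norm (1 - cnj a * z)^Suc n)"
        using A0 r by (intro mult_left_mono divide_right_mono mult_right_mono) auto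
      also have "\<dots> = A / (1 - r) * real n * y^Suc n" using r by (simp add: y_def power_divide)
      finally have "norm (deriv f z) powr p \<le> (A / (1 - r) * real n * y^Suc n) powr p"
        using p by (intro powr_mono2) auto
      also have "\<dots> = A powr p / (1 - r) powr p * real n powr p * (y powr real (Suc n)) powr p"
        using y0 r A0 by (simp add: powr_mult powr_divide powr_realpow del: power_Suc of_nat_Suc)
      also have "(y powr real (Suc n)) powr p = y powr (q + 1)" by (simp add: powr_powr q_def add.commute)
      also have "A powr p / (1 - r) powr p = 1 / (W * (1 - r))"
        unfolding Ap using r W by (simp add: powr_diff)
      finally show ?thesis by (simp add: y_def)
    qed
    have mean: "pmean p (deriv f) s \<le> ennreal (2 * pi * real n powr p / W) * ennreal (((1 - r)/(1 - r * s))^N)"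
      if s: "0 \<le> s" "s < 1" for s
    proof -
      have rs: "r * s \<le> r" "r * s < 1" "0 \<le> r * s" using s r mult_left_le[of s r] by auto
      define c where "c = real n powr p / (W * (1 - r))"
      have c0: "0 \<le> c" using W r by (simp add: c_def)
      have "pmean p (deriv f) s \<le> (\<integral>\<^sup>+t. ennreal c * (indicator {0..2*pi} t * ennreal (((1 - norm a) / norm (1 - cnj a * (of_real s * cis t))) powr (q + 1))) \<partial>lborel)"
        unfolding pmean_def
      proof (intro nn_integral_mono)
        fix t :: real
        have "ennreal (norm (deriv f (of_real s * cis t)) powr p) \<le> ennreal c * ennreal (((1 - norm a) / norm (1 - cnj a * (of_real s * cis t))) powr (q + 1))"
          using dle[of "of_real s * cis t"] s c0 by (subst ennreal_mult[symmetric]) (auto simp: norm_mult c_def r_def intro!: ennreal_leI)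
        then show "indicator {0..2*pi} t * (indicator (ball 0 1) (of_real s * cis t) * ennreal (norm (deriv f (of_real s * cis t)) powr p))
          \<le> ennreal c * (indicator {0..2*pi} t * ennreal (((1 - norm a) / norm (1 - cnj a * (of_real s * cis t))) powr (q + 1)))"
          by (auto simp: indicator_def)
      qed
      also have "\<dots> = ennreal c * (\<integral>\<^sup>+t. indicator {0..2*pi} t * ennreal (((1 - norm a) / norm (1 - cnj a * (of_real s * cis t))) powr (q + 1)) \<partial>lborel)"
        by (rule nn_integral_cmult) measurable
      also have "\<dots> \<le> ennreal c * ennreal (2 * pi * (1 - norm a) * ((1 - norm a) / (1 - norm a * s)) powr q)"
        by (intro mult_left_mono nn_integral_circle_kernel a s q1) simp
      also have "\<dots> = ennreal (2 * pi * real n powr p / W * ((1 - r)/(1 - r * s)) powr q)"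
      proof -
        have "x / (W * e) * (2 * pi * e * Y) = 2 * pi * x / W * Y" if "e \<noteq> 0" for x e Y :: real
          using that W by (simp add: field_simps)
        from this[of "1 - r"] show ?thesis
          using c0 r by (subst ennreal_mult[symmetric]) (auto simp only: c_def r_def[symmetric], auto)
      qed
      also have "\<dots> \<le> ennreal (2 * pi * real n powr p / W * ((1 - r)/(1 - r * s))^N)"
      proof (intro ennreal_leI mult_left_mono)
        have "((1 - r)/(1 - r * s)) powr q \<le> ((1 - r)/(1 - r * s)) powr real N"
          using q r rs by (intro powr_mono') auto
        also have "\<dots> = ((1 - r)/(1 - r * s))^N" using r rs by (intro powr_realpow) auto
        finally show "((1 - r)/(1 - r * s)) powr q \<le> ((1 - r)/(1 - r * s))^N" .
      qed (use W in auto)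
      also have "\<dots> = ennreal (2 * pi * real n powr p / W) * ennreal (((1 - r)/(1 - r * s))^N)"
        using W by (intro ennreal_mult') auto
      finally show ?thesis .
    qed
    have "disc_integral p \<omega> (deriv f) = (\<integral>\<^sup>+s. indicator {0<..<1} s * (ennreal s * (radial_density \<omega> s * pmean p (deriv f) s)) \<partial>lborel)"
      by (rule disc_integral_polar[OF \<omega> dfhol])
    also have "\<dots> \<le> (\<integral>\<^sup>+s. ennreal (2 * pi * real n powr p / W) * (radial_density \<omega> s * ennreal (((1 - r)/(1 - r * s))^N)) \<partial>lborel)"
    proof (intro nn_integral_mono)
      fix s :: real
      show "indicator {0<..<1} s * (ennreal s * (radial_density \<omega> s * pmean p (deriv f) s))
        \<le> ennreal (2 * pi * real n powr p / W) * (radial_density \<omega> s * ennreal (((1 - r)/(1 - r * s))^N))"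
      proof (cases "s \<in> {0<..<1}")
        case True
        have "ennreal s * (radial_density \<omega> s * pmean p (deriv f) s)
           \<le> 1 * (radial_density \<omega> s * (ennreal (2 * pi * real n powr p / W) * ennreal (((1 - r)/(1 - r * s))^N)))"
          using True by (intro mult_mono mult_left_mono mean) auto
        then show ?thesis using True by (simp add: mult_ac)
      qed simp
    qed
    also have "\<dots> = ennreal (2 * pi * real n powr p / W) * (\<integral>\<^sup>+s. radial_density \<omega> s * ennreal (((1 - r)/(1 - r * s))^N) \<partial>lborel)"
      by (rule nn_integral_cmult) measurable
    also have "\<dots> \<le> ennreal (2 * pi * real n powr p / W) * ennreal (K * W)"
      unfolding W_def by (intro mult_left_mono ker r) simp
    also have "\<dots> = ennreal D" using W K by (subst ennreal_mult[symmetric]) (auto simp: D_def)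
    finally have disc: "disc_integral p \<omega> (deriv f) \<le> ennreal D" .
    have small: "(A * (1 - r)^n) powr p \<le> E * (1 - r)"
    proof -
      have "(A * (1 - r)^n) powr p = A powr p * ((1 - r) powr real n) powr p"
        using r A0 by (simp add: powr_mult powr_realpow)
      also have "\<dots> = ((1 - r) powr (p - 1) * (1 - r) powr (real n * p)) / W" unfolding Ap by (simp add: powr_powr)
      also have "\<dots> = (1 - r) powr q / W" by (simp add: powr_add[symmetric] q_def algebra_simps)
      also have "\<dots> \<le> E * (1 - r)" unfolding W_def by (rule growth[OF r])
      finally show ?thesis .
    qed
    have f0: "norm (f 0) powr p \<le> E"
    proof -
      have "norm (f 0) = A * (1 - r)^n" using A0 by (simp add: f_def norm_mult norm_power n1r)
      then have "norm (f 0) powr p \<le> E * (1 - r)" using small by simp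
      also have "\<dots> \<le> E * 1" using DE r by (intro mult_left_mono) auto
      finally show ?thesis by simp
    qed
    have "Dnorm_pow p \<omega> f \<le> ennreal D / ennreal pi + ennreal E"
      unfolding Dnorm_pow_eq using disc f0 by (intro add_mono divide_right_mono_ennreal ennreal_leI)
    also have "\<dots> = ennreal M" using DE by (simp add: M_def divide_ennreal)
    finally have norm_le: "Dnorm_pow p \<omega> f \<le> ennreal M" .
    have "f \<in> Dspace p \<omega>" using fhol le_less_trans[OF norm_le] by (simp add: Dspace_def)
    moreover have "norm (f z) \<le> (M * (1 - norm a)) powr (1/p) / (1 - norm z)^n" if z: "norm z < 1" for z
    proof -
      have "A * (1 - r)^n = ((A * (1 - r)^n) powr p) powr (1/p)" using p A0 r by (simp add: powr_powr)
      also have "\<dots> \<le> (E * (1 - r)) powr (1/p)" using small p by (intro powr_mono2) auto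
      also have "\<dots> \<le> (M * (1 - r)) powr (1/p)" using p M0 r DE by (intro powr_mono2 mult_right_mono) auto
      finally have 1: "A * (1 - r)^n \<le> (M * (1 - r)) powr (1/p)" .
      have "norm (f z) = A * (1 - r)^n / norm (1 - cnj a * z)^n"
        using A0 by (simp add: f_def norm_mult norm_power norm_divide n1r power_divide)
      also have "\<dots> \<le> (M * (1 - r)) powr (1/p) / (1 - norm z)^n"
        using 1 low[OF z] z by (intro frac_le power_mono) auto
      finally show ?thesis by (simp add: r_def)
    qed
    moreover have "phi_quot p \<omega> (norm a) / (1 - norm a) / 2^n \<le> norm (f a)"
    proof -
      have "1 - cnj a * a = of_real (1 - r\<^sup>2)" using complex_norm_square[of a] by (simp add: r_def mult.commute)
      then have "norm (1 - cnj a * a) = \<bar>1 - r\<^sup>2\<bar>" by (simp only: norm_of_real)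
      also have "\<dots> = (1 - r) * (1 + r)"
        using r by (simp add: power_le_one) (simp add: power2_eq_square algebra_simps)
      finally have "norm (f a) = A * ((1 - r) / ((1 - r) * (1 + r)))^n"
        using A0 by (simp add: f_def norm_mult norm_power norm_divide n1r)
      also have "\<dots> = A / (1 + r)^n" using r by (simp add: power_divide)
      also have "\<dots> \<ge> A / 2^n" using A0 r by (intro divide_left_mono power_mono) auto
      finally show ?thesis by (simp add: A_def r_def)
    qed
    ultimately show "\<exists>f. f \<in> Dspace p \<omega> \<and> Dnorm_pow p \<omega> f \<le> ennreal M
       \<and> (\<forall>z. norm z < 1 \<longrightarrow> norm (f z) \<le> (M * (1 - norm a)) powr (1/p) / (1 - norm z)^n)
       \<and> phi_quot p \<omega> (norm a) / (1 - norm a) / 2^n \<le> norm (f a)"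
      using norm_le by blast
  qed
qed

text \<open>Test functions give information about \<open>deriv g\<close> at one point per circle;
  taking the point where \<open>|deriv g|\<close> is largest makes this a bound on the whole inner
  disc.\<close>

lemma max_deriv_on_sphere:
  assumes g: "g holomorphic_on ball 0 1" and r: "0 < r" "r < 1"
  obtains a where "norm a = r" "\<And>z. norm z \<le> r \<Longrightarrow> norm (deriv g z) \<le> norm (deriv g a)"
proof -
  have dg: "deriv g holomorphic_on ball 0 1" using g by (intro holomorphic_deriv) auto
  have c: "continuous_on (cball 0 r) (deriv g)"
    using r by (intro holomorphic_on_imp_continuous_on holomorphic_on_subset[OF dg]) auto
  have "continuous_on (sphere 0 r) (\<lambda>z. norm (deriv g z))"
    by (intro continuous_intros continuous_on_subset[OF c]) auto
  moreover have "sphere (0::complex) r \<noteq> {}" using r by (simp add: sphere_eq_empty)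
  ultimately obtain a where a: "a \<in> sphere 0 r" "\<forall>z\<in>sphere 0 r. norm (deriv g z) \<le> norm (deriv g a)"
    using continuous_attains_sup[OF compact_sphere] by blast
  show thesis
  proof (rule that)
    show "norm a = r" using a by simp
    fix z :: complex assume z: "norm z \<le> r"
    show "norm (deriv g z) \<le> norm (deriv g a)"
    proof (rule maximum_modulus_frontier[of "deriv g" "cball 0 r"])
      show "deriv g holomorphic_on interior (cball 0 r)" using r by (intro holomorphic_on_subset[OF dg]) auto
      show "norm (deriv g w) \<le> norm (deriv g a)" if "w \<in> frontier (cball 0 r)" for w
        using a that r by (auto simp: frontier_cball)
    qed (use c z in auto)
  qed
qed

theorem Tc_Hinf_constant:
  assumes \<omega>: "\<omega> \<in> Dhat" and p: "0 < p" and g: "g \<in> Tc_Hinf p \<omega>"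
    and nlim: "\<not> (phi_quot p \<omega> \<longlongrightarrow> 0) (at_left 1)"
  shows "\<exists>c. \<forall>z\<in>ball 0 1. g z = c"
proof -
  have ghol: "g holomorphic_on ball 0 1" and gc: "Tg_compact_Hinf p \<omega> g" using g by (auto simp: Tc_Hinf_def)
  have dg: "deriv g holomorphic_on ball 0 1" using ghol by (intro holomorphic_deriv) auto
  obtain c where c: "0 < c" "\<not> eventually (\<lambda>r. phi_quot p \<omega> r < c) (at_left 1)"
  proof -
    have "\<exists>e>0. \<not> eventually (\<lambda>r. dist (phi_quot p \<omega> r) 0 < e) (at_left 1)"
      using nlim unfolding tendsto_iff by blast
    then show ?thesis using that phi_quot_nonneg[of p \<omega>] by (auto simp: dist_norm)
  qed
  have "\<exists>r. b < r \<and> r < 1 \<and> c \<le> phi_quot p \<omega> r" if "b < 1" for b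
    using c(2) that unfolding eventually_at_left_field by (metis not_le)
  \<comment> \<open>The quotient is known to be at least \<open>c\<close> only along some radii
    tending to 1. With \<open>Suc j\<close> the lower bound is nonnegative, so all of them are
    positive.\<close>
  then have "\<forall>j::nat. \<exists>r. 1 - 1 / real (Suc j) < r \<and> r < 1 \<and> c \<le> phi_quot p \<omega> r" by simp
  then obtain r where r: "\<And>j::nat. 1 - 1 / real (Suc j) < r j \<and> r j < 1 \<and> c \<le> phi_quot p \<omega> (r j)" by metis
  have r0: "0 < r j" "r j < 1" for j
  proof -
    have "0 \<le> 1 - 1 / real (Suc j)" by simp
    then show "0 < r j" "r j < 1" using r[of j] by linarith+
  qed
  have rlim: "r \<longlonglongrightarrow> 1"
  proof (rule tendsto_sandwich[of "\<lambda>j. 1 - 1 / real (Suc j)" _ _ "\<lambda>_. 1"])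
    show "(\<lambda>j. 1 - 1 / real (Suc j)) \<longlonglongrightarrow> 1"
      using tendsto_diff[OF tendsto_const[of 1] LIMSEQ_inverse_real_of_nat] by (simp add: divide_inverse)
  qed (use r in \<open>auto intro!: always_eventually less_imp_le\<close>)
  have "\<forall>j. \<exists>a. norm a = r j \<and> (\<forall>z. norm z \<le> r j \<longrightarrow> norm (deriv g z) \<le> norm (deriv g a))"
    using max_deriv_on_sphere[OF ghol r0] by metis
  then obtain a where a: "\<And>j. norm (a j) = r j" "\<And>j z. norm z \<le> r j \<Longrightarrow> norm (deriv g z) \<le> norm (deriv g (a j))"
    by metis
  obtain n :: nat and M where M: "0 \<le> M" and tf:
    "\<And>a. norm a < 1 \<Longrightarrow> \<exists>f. f \<in> Dspace p \<omega> \<and> Dnorm_pow p \<omega> f \<le> ennreal M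
       \<and> (\<forall>z. norm z < 1 \<longrightarrow> norm (f z) \<le> (M * (1 - norm a)) powr (1/p) / (1 - norm z)^n)
       \<and> phi_quot p \<omega> (norm a) / (1 - norm a) / 2^n \<le> norm (f a)"
    using Dhat_test_functions[OF \<omega> p] by metis
  have "\<forall>j. \<exists>f. f \<in> Dspace p \<omega> \<and> Dnorm_pow p \<omega> f \<le> ennreal M
       \<and> (\<forall>z. norm z < 1 \<longrightarrow> norm (f z) \<le> (M * (1 - r j)) powr (1/p) / (1 - norm z)^n)
       \<and> phi_quot p \<omega> (r j) / (1 - r j) / 2^n \<le> norm (f (a j))"
    using tf[of "a _"] a(1) r0 by metis
  then obtain F where F: "\<And>j. F j \<in> Dspace p \<omega>" "\<And>j. Dnorm_pow p \<omega> (F j) \<le> ennreal M"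
      "\<And>j z. norm z < 1 \<Longrightarrow> norm (F j z) \<le> (M * (1 - r j)) powr (1/p) / (1 - norm z)^n"
      "\<And>j. phi_quot p \<omega> (r j) / (1 - r j) / 2^n \<le> norm (F j (a j))"
    by metis
  have Fhol: "F j holomorphic_on ball 0 1" for j using F(1)[of j] by (simp add: Dspace_def)
  note Thol = Tg_holomorphic[OF Fhol ghol]
  obtain \<sigma> h where \<sigma>: "strict_mono \<sigma>" and ul: "uniform_limit (ball 0 1) (\<lambda>j. Tg g (F (\<sigma> j))) h sequentially"
    using gc F(1,2) unfolding Tg_compact_Hinf_def by metis
  \<comment> \<open>The test functions are uniformly small on the disc of radius
    \<open>norm z\<close>, hence so is the derivative of \<open>Tg g (F j)\<close>, which vanishes
    at 0. This identifies the uniform limit \<open>h\<close> as 0.\<close>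
  have lim0: "(\<lambda>j. Tg g (F j) z) \<longlonglongrightarrow> 0" if z: "norm z < 1" for z
  proof -
    have "continuous_on (cball 0 (norm z)) (deriv g)"
      using z by (intro holomorphic_on_imp_continuous_on holomorphic_on_subset[OF dg]) auto
    then have "bounded (deriv g ` cball 0 (norm z))" by (intro compact_imp_bounded compact_continuous_image) auto
    then obtain G where G: "\<And>w. norm w \<le> norm z \<Longrightarrow> norm (deriv g w) \<le> G"
      unfolding bounded_iff by (metis imageI mem_cball_0)
    define B where "B j = (M * (1 - r j)) powr (1/p) / (1 - norm z)^n * G" for j
    have "norm (Tg g (F j) z - Tg g (F j) 0) \<le> B j * norm (z - 0)" for j
    proof (rule field_differentiable_bound[of "cball 0 (norm z)" _ "\<lambda>w. F j w * deriv g w"])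
      fix w :: complex assume w: "w \<in> cball 0 (norm z)"
      show "(Tg g (F j) has_field_derivative F j w * deriv g w) (at w within cball 0 (norm z))"
        using w z by (intro has_field_derivative_at_within[OF Tg_has_field_derivative[OF Fhol ghol]]) auto
      have "norm (F j w) \<le> (M * (1 - r j)) powr (1/p) / (1 - norm w)^n" using w z by (intro F(3)) auto
      also have "\<dots> \<le> (M * (1 - r j)) powr (1/p) / (1 - norm z)^n"
        using w z by (intro divide_left_mono power_mono) auto
      finally show "norm (F j w * deriv g w) \<le> B j"
        unfolding B_def norm_mult using G[of w] w z by (intro mult_mono) auto
    qed (use z in auto)
    then have le: "norm (Tg g (F j) z) \<le> B j * norm z" for j by (simp add: Tg_0)
    have "(\<lambda>j. (M * (1 - r j)) powr (1/p)) \<longlonglongrightarrow> 0 powr (1/p)"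
    proof (rule tendsto_powr')
      show "(\<lambda>j. M * (1 - r j)) \<longlonglongrightarrow> 0"
        using tendsto_mult[OF tendsto_const[of M] tendsto_diff[OF tendsto_const[of 1] rlim]] by simp
      have "0 \<le> M * (1 - r j)" for j using M r0(2)[of j] by simp
      then show "(0::real) \<noteq> 0 \<or> 0 < 1/p \<and> (\<forall>\<^sub>F j in sequentially. 0 \<le> M * (1 - r j))"
        using p by simp
    qed simp
    then have "(\<lambda>j. (M * (1 - r j)) powr (1/p) / (1 - norm z)^n * G * norm z) \<longlonglongrightarrow> 0 / (1 - norm z)^n * G * norm z"
      using z by (intro tendsto_intros) auto
    then have "(\<lambda>j. B j * norm z) \<longlonglongrightarrow> 0" unfolding B_def by simp
    then show ?thesis by (rule Lim_null_comparison[OF always_eventually[OF allI[OF le]]])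
  qed
  have h0: "h z = 0" if z: "norm z < 1" for z
  proof -
    have "(\<lambda>j. Tg g (F (\<sigma> j)) z) \<longlonglongrightarrow> h z" using tendsto_uniform_limitI[OF ul] z by simp
    moreover have "(\<lambda>j. Tg g (F (\<sigma> j)) z) \<longlonglongrightarrow> 0"
      using LIMSEQ_subseq_LIMSEQ[OF lim0[OF z] \<sigma>] by (simp add: o_def)
    ultimately show ?thesis by (rule LIMSEQ_unique)
  qed
  have small: "norm (deriv g z) \<le> 2^Suc n / c * e" if z: "norm z < 1" and e: "0 < e" for z e
  proof -
    have "eventually (\<lambda>j. \<forall>w\<in>ball 0 1. dist (Tg g (F (\<sigma> j)) w) (h w) < e) sequentially"
      using ul e by (rule uniform_limitD)
    moreover have "eventually (\<lambda>j. norm z < r (\<sigma> j)) sequentially"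
      using order_tendstoD(1)[OF LIMSEQ_subseq_LIMSEQ[OF rlim \<sigma>] z] by simp
    ultimately have "eventually (\<lambda>j. norm (deriv g z) \<le> 2^Suc n / c * e) sequentially"
    proof eventually_elim
      case (elim j)
      define k where "k = \<sigma> j"
      \<comment> \<open>The disc of radius \<open>d\<close> about \<open>a k\<close> stays inside
        the unit disc, and \<open>e / d = 2 * e / (1 - r k)\<close>. The lower bound for
        \<open>F k\<close> at \<open>a k\<close> contains the same \<open>1 / (1 - r k)\<close>; it
        cancels and leaves \<open>2^Suc n / c * e\<close>, independent of \<open>k\<close>.\<close>
      define d where "d = (1 - r k)/2"
      have d: "0 < d" using r0[of k] by (simp add: d_def)
      have sub: "cball (a k) d \<subseteq> ball 0 1"
      proof
        fix w assume "w \<in> cball (a k) d"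
        then have "norm w \<le> norm (a k) + d" using norm_triangle_sub[of w "a k"] by (simp add: dist_norm norm_minus_commute)
        then show "w \<in> ball 0 1" using a(1)[of k] r0[of k] by (simp add: d_def field_simps)
      qed
      have Te: "norm (Tg g (F k) w) \<le> e" if "norm w < 1" for w using elim(1) h0 that by (force simp: k_def)
      have "norm ((deriv ^^ 1) (Tg g (F k)) (a k)) \<le> fact 1 * e / d ^ 1"
      proof (rule Cauchy_inequality)
        show "Tg g (F k) holomorphic_on ball (a k) d" using sub by (intro holomorphic_on_subset[OF Thol]) auto
        show "continuous_on (cball (a k) d) (Tg g (F k))"
          using sub by (intro holomorphic_on_imp_continuous_on holomorphic_on_subset[OF Thol])
        show "norm (Tg g (F k) w) \<le> e" if "norm (a k - w) = d" for w
          using sub that by (intro Te) (auto simp: dist_norm subset_iff)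
      qed (use d in auto)
      then have 1: "norm (F k (a k)) * norm (deriv g (a k)) \<le> e / d"
        using a(1)[of k] r0[of k] by (simp add: deriv_Tg[OF Fhol ghol] norm_mult)
      have "c / (1 - r k) / 2^n \<le> phi_quot p \<omega> (r k) / (1 - r k) / 2^n"
        using r[of k] by (intro divide_right_mono) auto
      also have "\<dots> \<le> norm (F k (a k))" by (rule F(4))
      finally have "c / (1 - r k) / 2^n * norm (deriv g (a k)) \<le> norm (F k (a k)) * norm (deriv g (a k))"
        by (rule mult_right_mono) simp
      also note 1
      finally have "c / (1 - r k) / 2^n * norm (deriv g (a k)) \<le> e / d" .
      then have "norm (deriv g (a k)) \<le> 2^Suc n / c * e"
      proof -
        have "x \<le> 2 * m / c * e" if "c / y / m * x \<le> e / (y/2)" "0 < y" "0 < m" for x y m :: real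
          using that c(1) by (simp add: field_simps)
        from this[of "1 - r k" "2^n"] show ?thesis
          using \<open>c / (1 - r k) / 2^n * norm (deriv g (a k)) \<le> e / d\<close> r0[of k] by (simp add: d_def)
      qed
      moreover have "norm (deriv g z) \<le> norm (deriv g (a k))" using elim(2) by (intro a(2)) (simp add: k_def)
      ultimately show ?case by linarith
    qed
    then show ?thesis by (simp add: eventually_const)
  qed
  have dg0: "deriv g z = 0" if z: "norm z < 1" for z
  proof -
    have "((\<lambda>e. 2^Suc n / c * e) \<longlongrightarrow> 2^Suc n / c * 0) (at_right 0)" by (intro tendsto_intros)
    then have "norm (deriv g z) \<le> 2^Suc n / c * 0"
      using small[OF z] by (intro tendsto_lowerbound[of _ "2^Suc n / c * 0" "at_right 0"]) (auto simp: eventually_at_filter)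
    then show ?thesis by simp
  qed
  have "\<exists>c. \<forall>z\<in>ball 0 1. g z = c"
  proof (rule has_field_derivative_zero_constant)
    show "(g has_field_derivative 0) (at z within ball 0 1)" if "z \<in> ball 0 1" for z
      using holomorphic_derivI[OF ghol open_ball that, of "ball 0 1"] dg0[of z] that by simp
  qed simp
  then show ?thesis .
qed

section \<open>Abel means\<close>

text \<open>Conditions (ii) and (iii) become failures of convergence to 0. Nonnegativity is asked
  only near \<open>x\<close> because Abel means are nonnegative only for radii up to 1.\<close>

lemma Limsup_at_left_pos_iff:
  fixes u :: "real \<Rightarrow> ereal"
  assumes "eventually (\<lambda>r. 0 \<le> u r) (at_left x)"
  shows "0 < Limsup (at_left x) u \<longleftrightarrow> \<not> (u \<longlongrightarrow> 0) (at_left x)"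
proof
  assume "0 < Limsup (at_left x) u"
  then show "\<not> (u \<longlongrightarrow> 0) (at_left x)"
    using lim_imp_Limsup[of "at_left x" u 0] by (auto simp: trivial_limit_at_left_real)
next
  assume n: "\<not> (u \<longlongrightarrow> 0) (at_left x)"
  show "0 < Limsup (at_left x) u"
  proof (rule ccontr)
    assume "\<not> 0 < Limsup (at_left x) u"
    then have 1: "Limsup (at_left x) u \<le> 0" by simp
    have 2: "0 \<le> Liminf (at_left x) u" using assms by (rule Liminf_bounded)
    have 3: "Liminf (at_left x) u \<le> Limsup (at_left x) u"
      by (intro Liminf_le_Limsup) (simp add: trivial_limit_at_left_real)
    have "(u \<longlongrightarrow> 0) (at_left x)"
      using 1 2 3 by (intro Liminf_eq_Limsup) (auto simp: trivial_limit_at_left_real)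
    then show False using n by simp
  qed
qed

text \<open>The denominator decreases from \<open>t\<close> to \<open>s\<close>, and the ratio
  \<open>(1 - s)/(1 - t)\<close> lies in \<open>[1/4, 1]\<close>. The exponent
  \<open>2 - 1/p\<close> may have either sign, hence the minimum.\<close>

lemma phi_quot_lower_bound:
  assumes \<omega>: "radial_weight \<omega>" and p: "0 < p" and t: "0 \<le> t" "t \<le> s" "s < 1" and far: "(1 - t)/4 \<le> 1 - s"
  shows "min 1 ((1/4) powr (2 - 1/p)) * phi_quot p \<omega> t \<le> phi_quot p \<omega> s"
proof -
  define e where "e = 2 - 1/p"
  define x where "x = (1 - s)/(1 - t)"
  have x: "1/4 \<le> x" "x \<le> 1" using t far by (auto simp: x_def field_simps)
  have xe: "min 1 ((1/4) powr e) \<le> x powr e"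
  proof (cases "0 \<le> e")
    case True
    then have "(1/4) powr e \<le> x powr e" using x by (intro powr_mono2) auto
    then show ?thesis by simp
  next
    case False
    then have "1 powr e \<le> x powr e" using x by (intro powr_mono2') auto
    then show ?thesis by simp
  qed
  have Ws: "0 < omega_hat \<omega> s" "omega_hat \<omega> s \<le> omega_hat \<omega> t"
    using omega_hat_pos[OF \<omega>, of s] omega_hat_antimono[OF \<omega>, of t s] t by auto
  have "min 1 ((1/4) powr e) * phi_quot p \<omega> t \<le> x powr e * phi_quot p \<omega> t"
    using xe phi_quot_nonneg by (rule mult_right_mono)
  also have "\<dots> = (1 - s) powr e / omega_hat \<omega> t powr (1/p)"
  proof -
    have "x powr e * (1 - t) powr e = (1 - s) powr e"
      using t by (simp add: powr_mult[symmetric] x_def)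
    then show ?thesis by (simp add: phi_quot_def e_def)
  qed
  also have "\<dots> \<le> phi_quot p \<omega> s"
    unfolding phi_quot_def e_def[symmetric] using Ws p by (intro divide_left_mono powr_mono2 mult_pos_pos) auto
  finally show ?thesis by (simp add: e_def)
qed

text \<open>The index is shifted: \<open>a k\<close> belongs to the term \<open>k + 1\<close> of a
  series starting at 1. The sum is extended-real, so no summability is presupposed.\<close>

definition abel_mean :: "(nat \<Rightarrow> real) \<Rightarrow> real \<Rightarrow> ereal" where
  "abel_mean a r = ereal (1 - r) * (\<Sum>k. ereal (r ^ (2 * Suc k) * a k))"

lemma abel_mean_nonneg:
  assumes "\<And>k. 0 \<le> a k" "r \<le> 1"
  shows "0 \<le> abel_mean a r"
  unfolding abel_mean_def using assms
  by (intro ereal_0_le_mult suminf_0_le) (auto simp: power_mult simp del: mult_Suc_right)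

text \<open>Finitely many terms contribute at most \<open>(1 - r) * S\<close>. The others are below
  \<open>d\<close> and, by \<open>r^(2 * (k + 1)) \<le> r^k\<close> and the geometric series,
  contribute at most \<open>d\<close> after multiplication by \<open>1 - r\<close>.\<close>

lemma abel_mean_tendsto_0:
  assumes a0: "\<And>k. 0 \<le> a k" and lim: "a \<longlonglongrightarrow> 0"
  shows "(abel_mean a \<longlongrightarrow> 0) (at_left 1)"
proof (rule order_tendstoI)
  have ev: "eventually (\<lambda>r::real. 0 < r \<and> r < 1) (at_left 1)" using eventually_at_left_real[of 0 "1::real"] by simp
  fix y :: ereal
  show "eventually (\<lambda>r. y < abel_mean a r) (at_left 1)" if "y < 0"
    using ev by eventually_elim (use that abel_mean_nonneg[OF a0] in \<open>auto intro: less_le_trans less_imp_le\<close>)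
  assume "0 < y"
  then obtain e where e: "0 < ereal e" "ereal e < y" using ereal_dense2 by blast
  define d where "d = e/2"
  have d: "0 < d" using e by (simp add: d_def)
  obtain m where m: "\<And>k. m \<le> k \<Longrightarrow> a k < d"
    using order_tendstoD(2)[OF lim d] unfolding eventually_sequentially by blast
  define S where "S = (\<Sum>k<m. a k)"
  have bound: "abel_mean a r \<le> ereal ((1 - r) * S + d)" if r: "0 < r" "r < 1" for r
  proof -
    have s1: "(\<lambda>k. if k < m then a k else 0) sums S"
      using sums_If_finite_set[of "{..<m}" a] by (simp add: S_def)
    have s2: "(\<lambda>k. d * r^k) sums (d * (1 / (1 - r)))"
      using r by (intro sums_mult geometric_sums) auto
    have "(\<Sum>k. ereal (r ^ (2 * Suc k) * a k)) \<le> (\<Sum>k. ereal ((if k < m then a k else 0) + d * r^k))"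
    proof (rule suminf_le_pos)
      fix k
      have p1: "r ^ (2 * Suc k) \<le> 1" using r by (intro power_le_one) auto
      have p2: "r ^ (2 * Suc k) \<le> r ^ k" using r by (intro power_decreasing) auto
      show "ereal (r ^ (2 * Suc k) * a k) \<le> ereal ((if k < m then a k else 0) + d * r^k)"
      proof (cases "k < m")
        case True
        then show ?thesis using mult_right_mono[OF p1 a0[of k]] d r by (simp add: add_increasing2)
      next
        case False
        then have "r ^ (2 * Suc k) * a k \<le> r^k * d" using p2 m[of k] a0[of k] r by (intro mult_mono) auto
        then show ?thesis using False by (simp add: mult.commute)
      qed
      show "0 \<le> ereal (r ^ (2 * Suc k) * a k)" using a0[of k] r by simp
    qed
    also have "\<dots> = ereal (S + d * (1 / (1 - r)))"
      using sums_add[OF s1 s2] by (intro sums_unique[symmetric]) (simp only: sums_ereal)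
    finally have "abel_mean a r \<le> ereal (1 - r) * ereal (S + d * (1 / (1 - r)))"
      unfolding abel_mean_def using r by (intro ereal_mult_left_mono) auto
    also have "\<dots> = ereal ((1 - r) * S + d)" using r by (simp add: distrib_left)
    finally show ?thesis .
  qed
  have "((\<lambda>r. (1 - r) * S + d) \<longlongrightarrow> (1 - 1) * S + d) (at_left 1)" by (intro tendsto_intros)
  then have "eventually (\<lambda>r. (1 - r) * S + d < e) (at_left 1)"
    by (rule order_tendstoD(2)) (use d in \<open>simp add: d_def\<close>)
  with ev show "eventually (\<lambda>r. abel_mean a r < y) (at_left 1)"
  proof eventually_elim
    case (elim r)
    have "abel_mean a r \<le> ereal ((1 - r) * S + d)" using elim by (intro bound) auto
    also have "\<dots> < ereal e" using elim by simp
    also note e(2)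
    finally show ?case .
  qed
qed

lemma abel_mean_phi_quot_tendsto_0_iff:
  assumes \<omega>: "radial_weight \<omega>" and p: "0 < p"
  defines "a \<equiv> \<lambda>k. phi_quot p \<omega> (1 - 1 / real (Suc k))"
  shows "(abel_mean a \<longlongrightarrow> 0) (at_left 1) \<longleftrightarrow> (phi_quot p \<omega> \<longlongrightarrow> 0) (at_left 1)"
proof
  have a0: "0 \<le> a k" for k by (simp add: a_def phi_quot_nonneg)
  {
    assume lim: "(phi_quot p \<omega> \<longlongrightarrow> 0) (at_left 1)"
    have "filterlim (\<lambda>k. 1 - 1 / real (Suc k)) (at_left 1) sequentially"
    proof (rule filterlim_at_withinI)
      show "(\<lambda>k. 1 - 1 / real (Suc k)) \<longlonglongrightarrow> 1"
        using tendsto_diff[OF tendsto_const[of 1] LIMSEQ_inverse_real_of_nat] by (simp add: divide_inverse)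
    qed auto
    then have "a \<longlonglongrightarrow> 0" unfolding a_def using lim by (rule filterlim_compose[rotated])
    then show "(abel_mean a \<longlongrightarrow> 0) (at_left 1)" by (rule abel_mean_tendsto_0[OF a0])
  }
  assume lim: "(abel_mean a \<longlongrightarrow> 0) (at_left 1)"
  define \<kappa> where "\<kappa> = min 1 ((1/4) powr (2 - 1/p) :: real)"
  have \<kappa>: "0 < \<kappa>" by (simp add: \<kappa>_def)
  show "(phi_quot p \<omega> \<longlongrightarrow> 0) (at_left 1)"
  proof (rule ccontr)
    assume nlim: "\<not> (phi_quot p \<omega> \<longlongrightarrow> 0) (at_left 1)"
    obtain c where c: "0 < c" "\<not> eventually (\<lambda>r. phi_quot p \<omega> r < c) (at_left 1)"
    proof -
      have "\<exists>e>0. \<not> eventually (\<lambda>r. dist (phi_quot p \<omega> r) 0 < e) (at_left 1)"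
        using nlim unfolding tendsto_iff by blast
      then show ?thesis using that phi_quot_nonneg[of p \<omega>] by (auto simp: dist_norm)
    qed
    \<comment> \<open>The threshold is what one dyadic block yields: \<open>N\<close> terms of size
      at least \<open>\<kappa> * c / 2\<close>, multiplied by
      \<open>1 - r = 1 / (8 * N)\<close>.\<close>
    have "eventually (\<lambda>r. abel_mean a r < ereal (\<kappa> * c / 16)) (at_left 1)"
      using lim \<kappa> c(1) by (intro order_tendstoD(2)) auto
    then obtain b where b: "b < 1" "\<And>r. b < r \<Longrightarrow> r < 1 \<Longrightarrow> abel_mean a r < ereal (\<kappa> * c / 16)"
      unfolding eventually_at_left_field by blast
    have "max b 0 < 1" using b(1) by simp
    then obtain t where t: "max b 0 < t" "t < 1" "c \<le> phi_quot p \<omega> t"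
      using c(2) unfolding eventually_at_left_field by (metis not_le)
    \<comment> \<open>With \<open>N\<close> comparable to \<open>1 / (1 - t)\<close>, the points
      \<open>1 - 1/m\<close> for \<open>N \<le> m < 2 * N\<close> fall into the dyadic block beyond
      \<open>t\<close>: they need \<open>1/N \<le> 1 - t\<close> on one side and
      \<open>N * (1 - t) \<le> 2\<close> on the other.\<close>
    define N where "N = nat \<lceil>1 / (1 - t)\<rceil>"
    have inv1: "1 < 1 / (1 - t)" using t by simp
    have N1: "1 / (1 - t) \<le> real N" unfolding N_def by (rule real_nat_ceiling_ge)
    have N2: "real N < 1 / (1 - t) + 1"
    proof -
      have "0 \<le> \<lceil>1 / (1 - t)\<rceil>" using inv1 by linarith
      then show ?thesis unfolding N_def by (simp add: of_int_ceiling_le_add_one) linarith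
    qed
    have Npos: "1 < real N" using N1 inv1 by linarith
    have Nt: "1 / real N \<le> 1 - t" using N1 t Npos by (simp add: field_simps)
    have N2t: "real N * (1 - t) \<le> 2"
    proof -
      have "real N * (1 - t) \<le> (1 / (1 - t) + 1) * (1 - t)" using N2 t by (intro mult_right_mono) auto
      also have "\<dots> = 1 + (1 - t)" using t by (simp add: distrib_right)
      finally show ?thesis using t by simp
    qed
    \<comment> \<open>The exponents in the block are at most \<open>4 * N\<close>, and Bernoulli's
      inequality gives \<open>r^(4 * N) \<ge> 1 - 4 * N / (8 * N) = 1/2\<close>. Also
      \<open>r \<ge> t > b\<close>, so the assumed smallness of the Abel mean holds at
      \<open>r\<close>.\<close>
    define r where "r = 1 - 1 / (8 * real N)"
    have "1 / (8 * real N) \<le> 1 / real N" using Npos by (intro divide_left_mono) auto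
    then have rt: "t \<le> r" "r < 1" using Nt Npos by (auto simp: r_def)
    have r0: "0 < r" using rt t by simp
    have ak: "\<kappa> * c \<le> a k" if k: "k \<in> {N - 1..<2 * N - 1}" for k
    proof -
      have k1: "real N \<le> real (Suc k)" "real (Suc k) \<le> 2 * real N" using k Npos by auto
      define s where "s = 1 - 1 / real (Suc k)"
      have "1 / real (Suc k) \<le> 1 / real N" using k1 Npos by (intro divide_left_mono) auto
      then have "t \<le> s" using Nt by (simp add: s_def)
      moreover have "(1 - t)/4 \<le> 1 - s"
      proof -
        have "(1 - t) * real (Suc k) \<le> (1 - t) * (2 * real N)" using k1 t by (intro mult_left_mono) auto
        also have "\<dots> = 2 * (real N * (1 - t))" by simp
        also have "\<dots> \<le> 2 * 2" using N2t by (intro mult_left_mono) auto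
        finally show ?thesis by (simp add: s_def field_simps)
      qed
      ultimately have "\<kappa> * phi_quot p \<omega> t \<le> phi_quot p \<omega> s"
        unfolding \<kappa>_def using t by (intro phi_quot_lower_bound[OF \<omega> p]) (auto simp: s_def)
      moreover have "\<kappa> * c \<le> \<kappa> * phi_quot p \<omega> t" using t \<kappa> by (intro mult_left_mono) auto
      ultimately show ?thesis by (simp add: a_def s_def)
    qed
    have rpow: "1/2 \<le> r ^ (2 * Suc k)" if k: "k \<in> {N - 1..<2 * N - 1}" for k
    proof -
      have "1 + real (4 * N) * (- (1 / (8 * real N))) \<le> (1 + (- (1 / (8 * real N)))) ^ (4 * N)"
        using Npos by (intro Bernoulli_inequality) (auto simp: field_simps)
      then have "1/2 \<le> r ^ (4 * N)" using Npos by (simp add: r_def)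
      also have "\<dots> \<le> r ^ (2 * Suc k)" using k r0 rt by (intro power_decreasing) auto
      finally show ?thesis .
    qed
    have "real N * (1/2 * (\<kappa> * c)) = (\<Sum>k\<in>{N - 1..<2 * N - 1}. 1/2 * (\<kappa> * c))" using Npos by simp
    also have "\<dots> \<le> (\<Sum>k\<in>{N - 1..<2 * N - 1}. r ^ (2 * Suc k) * a k)"
      using ak rpow \<kappa> c(1) r0 by (intro sum_mono mult_mono) auto
    also have "\<dots> \<le> (\<Sum>k<2 * N. r ^ (2 * Suc k) * a k)"
      using a0 r0 by (intro sum_mono2) auto
    finally have "ereal (real N * (1/2 * (\<kappa> * c))) \<le> (\<Sum>k<2 * N. ereal (r ^ (2 * Suc k) * a k))" by simp
    also have "\<dots> \<le> (\<Sum>k. ereal (r ^ (2 * Suc k) * a k))"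
      using a0 r0 by (intro suminf_upper) auto
    finally have "ereal (1 - r) * ereal (real N * (1/2 * (\<kappa> * c))) \<le> abel_mean a r"
      unfolding abel_mean_def using rt by (intro ereal_mult_left_mono) auto
    moreover have "(1 - r) * (real N * (1/2 * (\<kappa> * c))) = \<kappa> * c / 16" using Npos by (simp add: r_def)
    ultimately have "ereal (\<kappa> * c / 16) \<le> abel_mean a r" by (simp only: times_ereal.simps)
    moreover have "abel_mean a r < ereal (\<kappa> * c / 16)" using b(2)[of r] t rt by simp
    ultimately show False by simp
  qed
qed

section \<open>The equivalences\<close>

theorem mainTheorem2:
  fixes p :: real and \<omega> :: "real \<Rightarrow> real"
  assumes "0 < p" "p < 1" and "\<omega> \<in> Dhat"
  defines "i \<equiv> (\<forall>g\<in>Tc_Hinf p \<omega>. \<exists>c. \<forall>z\<in>ball 0 1. g z = c)"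
      and "ii \<equiv> Limsup (at_left 1)
                 (\<lambda>r. ereal ((1 - r) powr (2 - 1 / p) / omega_hat \<omega> r powr (1 / p))) > 0"
      and "iii \<equiv> Limsup (at_left 1)
                 (\<lambda>r. ereal (1 - r) *
                    (\<Sum>k. ereal (r ^ (2 * Suc k) /
                       (omega_hat \<omega> (1 - 1 / real (Suc k)) powr (1 / p) *
                        real (Suc k) powr (2 - 1 / p))))) > 0"
      and "iv \<equiv> \<not> identity_compact_D10 p \<omega>"
  shows "(i \<longleftrightarrow> ii) \<and> (ii \<longleftrightarrow> iii) \<and> (iii \<longleftrightarrow> iv)"
  proof -
  have \<omega>: "radial_weight \<omega>" using assms(3) by (simp add: Dhat_def)
  have ii: "ii \<longleftrightarrow> \<not> (phi_quot p \<omega> \<longlongrightarrow> 0) (at_left 1)"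
    unfolding ii_def phi_quot_def[symmetric]
    by (subst Limsup_at_left_pos_iff) (simp_all add: phi_quot_nonneg zero_ereal_def lim_ereal)
  \<comment> \<open>At the radius \<open>1 - 1/m\<close> the distance to the boundary is
    \<open>1/m\<close>, so the quotient there is exactly the coefficient of \<open>r^(2 * m)\<close>
    in (iii), with \<open>m = k + 1\<close>.\<close>
  define a where "a k = phi_quot p \<omega> (1 - 1 / real (Suc k))" for k
  have "ereal (1 - r) * (\<Sum>k. ereal (r ^ (2 * Suc k) /
          (omega_hat \<omega> (1 - 1 / real (Suc k)) powr (1 / p) * real (Suc k) powr (2 - 1 / p)))) = abel_mean a r" for r
    unfolding abel_mean_def a_def phi_quot_def
    by (simp add: powr_divide mult.commute del: of_nat_Suc power_Suc mult_Suc_right)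
  then have "iii \<longleftrightarrow> 0 < Limsup (at_left 1) (abel_mean a)"
    unfolding iii_def by simp
  also have "\<dots> \<longleftrightarrow> \<not> (abel_mean a \<longlongrightarrow> 0) (at_left 1)"
  proof (rule Limsup_at_left_pos_iff)
    show "eventually (\<lambda>r. 0 \<le> abel_mean a r) (at_left 1)"
      using eventually_at_left_real[OF zero_less_one]
      by eventually_elim (auto intro!: abel_mean_nonneg simp: a_def phi_quot_nonneg)
  qed
  also have "\<dots> \<longleftrightarrow> \<not> (phi_quot p \<omega> \<longlongrightarrow> 0) (at_left 1)"
    unfolding a_def using abel_mean_phi_quot_tendsto_0_iff[OF \<omega> assms(1)] by simp
  finally have iii: "iii \<longleftrightarrow> ii" using ii by simp
  \<comment> \<open>The cycle is (ii) to (i) to (iv) to (ii); the second arrow uses the symbol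
    \<open>z\<close>, which is separated from the constants by its values at 0 and 1/2.\<close>
  have "i" if "ii"
    using that Tc_Hinf_constant[OF assms(3,1)] unfolding ii i_def by blast
  moreover have "iv" if hi: "i"
  proof (rule ccontr)
    assume "\<not> iv"
    then have "(\<lambda>z. z) \<in> Tc_Hinf p \<omega>"
      unfolding iv_def by (intro id_in_Tc_Hinf_of_identity_compact) simp
    with hi obtain c where c: "\<forall>z\<in>ball 0 1. (\<lambda>z. z) z = (c::complex)"
      unfolding i_def by (metis (no_types))
    from bspec[OF c, of 0] bspec[OF c, of "1/2"] show False by simp
  qed
  moreover have "ii" if "iv"
    using that identity_compact_D10_of_phi_quot_tendsto_0[OF \<omega> assms(1,2)] unfolding ii iv_def by blast
  ultimately show ?thesis using iii by blast
qed

end
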